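(* Let $\varepsilon>0$. For an integer $n\ge 1$ let \[ r'_{2,2}(n)=\sum_{\substack{p \text{ prime},\ m\ge 1 \text{ integer}\\ p^2+m^2=n}}\log p . \] Then there exist constants $C=C(\varepsilon)>0$, $K=K(\varepsilon)>0$ and $N_0=N_0(\varepsilon)$ such that for every integer $N\ge N_0$ and every integer $H$ with $N^{7/12+\varepsilon}\le H\le N^{1-\varepsilon}$, \[ \Bigl|\sum_{n=N+1}^{N+H} r'_{2,2}(n)-\frac{\pi}{4}H\Bigr|\le K\,H\exp\Bigl(-C\Bigl(\frac{\log N}{\log\log N}\Bigr)^{1/3}\Bigr). \]
   Context: No unproved hypothesis (such as the Riemann Hypothesis) is assumed. *)

theory Defs
  imports Complex_Main "HOL-Computational_Algebra.Primes"
begin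

definition prime_square_reps :: "nat \<Rightarrow> (nat \<times> nat) set" where
  "prime_square_reps n = {(p, m). prime p \<and> m \<ge> 1 \<and> p\<^sup>2 + m\<^sup>2 = n}"

text \<open>Finiteness ensures that the sum below is a genuine one (a sum over an infinite set would be \<open>0\<close>).\<close>

lemma finite_prime_square_reps: "finite (prime_square_reps n)"
proof (rule finite_subset)
  show "prime_square_reps n \<subseteq> {..n} \<times> {..n}"
  proof
    fix x assume "x \<in> prime_square_reps n"
    then obtain p m where x: "x = (p, m)" and n: "p\<^sup>2 + m\<^sup>2 = n"
      by (auto simp: prime_square_reps_def)
    have "p \<le> p\<^sup>2" "m \<le> m\<^sup>2" by (simp_all add: self_le_power power2_eq_square)
    with n have "p \<le> n" "m \<le> n" by linarith+
    with x show "x \<in> {..n} \<times> {..n}" by simp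
  qed
qed simp

definition r22' :: "nat \<Rightarrow> real" where
  "r22' n = (\<Sum>(p, m)\<in>prime_square_reps n. ln (real p))"

end

theory Submission
  imports
    Defs
    "HOL-Complex_Analysis.Complex_Analysis"
    "HOL-Number_Theory.Prime_Powers"
    "HOL-Real_Asymp.Real_Asymp"
begin

text \<open>
  Since \<open>H\<close> exceeds \<open>sqrt N\<close> by a power of \<open>N\<close>, it suffices to count, for every prime \<open>p\<close>, the \<open>m\<close> with
  \<open>N < p\<^sup>2 + m\<^sup>2 \<le> N + H\<close> as \<open>sqrt (N + H - p\<^sup>2) - sqrt (N - p\<^sup>2) + O(1)\<close>: the errors add up to
  \<open>O(sqrt N * ln N)\<close>. The main term is increasing in \<open>p\<close> as long as \<open>p\<close> is not too close to \<open>sqrt N\<close>, so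
  by Abel summation the prime number theorem allows to replace the weight \<open>ln p\<close> on primes by the weight
  one on all integers; the remaining \<open>p\<close> are bounded trivially. What is left is the number of lattice
  points in a quarter annulus. No information on primes in short intervals is used.

  The prime number theorem is needed with an error \<open>O(x * exp (- k * sqrt (ln x)))\<close>. It comes from the
  zero-free region \<open>Re s > 1 - b / ln (\<bar>Im s\<bar> + 3)\<close>, which follows from the inequality
  \<open>3 + 4 * cos t + cos (2 * t) \<ge> 0\<close> and Landau's lower bound for the real part of a logarithmic
  derivative, and from a truncated Perron formula with the kernel \<open>1 / (s * (s + 1))\<close>.
\<close>

section \<open>Dirichlet series and the continuation of zeta\<close>

text \<open>The obstacle is the range of \<open>n\<close> close to \<open>sqrt N\<close>, where the
  number of \<open>m\<close> grows far beyond \<open>H / sqrt N\<close> and Abel summation with this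
  weight becomes expensive. Cutting at \<open>sqrt N * (1 - \<kappa>)\<close> leaves \<kappa> free:
  Abel summation costs a factor \<open>1 / sqrt \<kappa>\<close>, the trivial bound beyond the cut
  gains \<open>sqrt \<kappa>\<close>, and taking for \<kappa> the relative error of the prime number
  theorem balances the two up to logarithms. The kernel with two factors in its denominator decays
  quadratically, so truncation at height \<open>T\<close> costs \<open>1 / T\<close> for every term,
  however close \<open>n\<close> is to \<open>x\<close>. The price is a weight
  \<open>1 - n / x\<close> in the sum over primes. It is removed by differencing, which is possible
  because the coefficients are bounded below and costs only half of the constant in the exponent.
  The resulting saving, with a square root of the logarithm in the exponent, dominates the cube root
  that is asked for.\<close>

definition abs_conv :: "(nat \<Rightarrow> real) \<Rightarrow> bool" where
  "abs_conv a \<longleftrightarrow> (\<forall>\<sigma>>1. summable (\<lambda>n. \<bar>a n\<bar> * real n powr (-\<sigma>)))"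

text \<open>Summing from 0 is harmless: \<open>0 powr z\<close> is 0, so the index 0 contributes
  nothing.\<close>

definition dirichlet :: "(nat \<Rightarrow> real) \<Rightarrow> complex \<Rightarrow> complex" where
  "dirichlet a s = (\<Sum>n. of_real (a n) * of_nat n powr (-s))"

lemma norm_nat_powr: "norm (of_nat n powr (s::complex)) = real n powr Re s"
  by (subst norm_powr_real_powr) auto

lemma ln_le_powr: "e > 0 \<Longrightarrow> x \<ge> 1 \<Longrightarrow> ln x \<le> x powr e / e" for x e :: real
  using ln_bound[of "x powr e"] by (simp add: ln_powr field_simps)

text \<open>The logarithm is absorbed into \<open>n powr e\<close>, with \<open>e\<close> half the
  distance from \<sigma> to 1. The factor that differentiation of a series produces therefore
  preserves absolute convergence to the right of 1.\<close>

lemma abs_conv_mult_ln: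
  assumes "abs_conv a" shows "abs_conv (\<lambda>n. ln (real n) * a n)"
  unfolding abs_conv_def
proof (intro allI impI)
  fix \<sigma> :: real assume \<sigma>: "\<sigma> > 1"
  define e where "e = (\<sigma> - 1) / 2"
  have e: "e > 0" "\<sigma> - e > 1" using \<sigma> by (auto simp: e_def field_simps)
  have "summable (\<lambda>n. \<bar>a n\<bar> * real n powr (-(\<sigma> - e)))"
    using assms e unfolding abs_conv_def by blast
  then have "summable (\<lambda>n. 1 / e * (\<bar>a n\<bar> * real n powr (-(\<sigma> - e))))" by (rule summable_mult)
  then show "summable (\<lambda>n. \<bar>ln (real n) * a n\<bar> * real n powr (-\<sigma>))"
  proof (rule summable_comparison_test'[where N = 1])
    fix n :: nat assume n: "n \<ge> 1"
    have "\<bar>ln (real n) * a n\<bar> * real n powr (-\<sigma>) \<le> (real n powr e / e) * \<bar>a n\<bar> * real n powr (-\<sigma>)"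
      using n e mult_right_mono[OF ln_le_powr[of e "real n"], of "\<bar>a n\<bar>"]
      by (intro mult_right_mono) (auto simp: abs_mult)
    also have "\<dots> = 1 / e * (\<bar>a n\<bar> * (real n powr e * real n powr (-\<sigma>)))" by simp
    also have "real n powr e * real n powr (-\<sigma>) = real n powr (-(\<sigma> - e))"
      by (simp flip: powr_add)
    finally show "norm (\<bar>ln (real n) * a n\<bar> * real n powr (-\<sigma>)) \<le> 1 / e * (\<bar>a n\<bar> * real n powr (-(\<sigma> - e)))"
      by simp
  qed
qed

lemma abs_conv_const: "abs_conv (\<lambda>_. c)"
  unfolding abs_conv_def by (auto intro!: summable_mult simp: summable_real_powr_iff)

lemma abs_conv_le:
  assumes "abs_conv b" "\<And>n. \<bar>a n\<bar> \<le> \<bar>b n\<bar>" shows "abs_conv a"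
  unfolding abs_conv_def
proof (intro allI impI)
  fix \<sigma> :: real assume "\<sigma> > 1"
  then have "summable (\<lambda>n. \<bar>b n\<bar> * real n powr (-\<sigma>))" using assms(1) by (simp add: abs_conv_def)
  then show "summable (\<lambda>n. \<bar>a n\<bar> * real n powr (-\<sigma>))"
    by (rule summable_comparison_test'[where N = 0]) (use mult_right_mono[OF assms(2)] in simp)
qed

lemma dirichlet_abs_summable:
  assumes "abs_conv a" "Re s > 1"
  shows "summable (\<lambda>n. norm (of_real (a n) * of_nat n powr (-s)))"
  using assms by (simp add: abs_conv_def norm_mult norm_nat_powr)

lemma norm_dirichlet_le:
  assumes "abs_conv a" "Re s > 1"
  shows "norm (dirichlet a s) \<le> (\<Sum>n. \<bar>a n\<bar> * real n powr (-Re s))"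
  unfolding dirichlet_def
  using summable_norm[OF dirichlet_abs_summable[OF assms]] by (simp add: norm_mult norm_nat_powr)

lemma dirichlet_of_real:
  assumes "abs_conv a" "\<sigma> > 1"
  shows "dirichlet a (of_real \<sigma>) = of_real (\<Sum>n. a n * real n powr (-\<sigma>))"
proof -
  have "summable (\<lambda>n. a n * real n powr (-\<sigma>))"
    by (rule summable_norm_cancel) (use assms in \<open>simp add: abs_conv_def abs_mult\<close>)
  moreover have eq: "of_real (a n) * of_nat n powr - of_real \<sigma> = (of_real (a n * real n powr (-\<sigma>)) :: complex)" for n
  proof -
    have "complex_of_real (real n powr (-\<sigma>)) = of_nat n powr - of_real \<sigma>"
      using powr_of_real[of "real n" "-\<sigma>"] by (metis of_nat_0_le_iff of_real_minus of_real_of_nat_eq)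
    then show ?thesis by (metis of_real_mult)
  qed
  ultimately show ?thesis unfolding dirichlet_def by (simp only: eq suminf_of_real)
qed

lemma has_field_derivative_nat_powr:
  "((\<lambda>s. of_nat n powr (-s)) has_field_derivative (- of_real (ln (real n)) * of_nat n powr (-s))) (at (s::complex))"
proof (cases "n = 0")
  case False
  then show ?thesis
    by (auto simp: powr_def Ln_of_nat intro!: derivative_eq_intros)
qed simp

text \<open>Termwise differentiation. On a ball whose radius is half the distance to the line
  \<open>Re s = 1\<close>, the terms are dominated by those of the absolutely convergent series at
  the leftmost real part.\<close>

lemma dirichlet_has_derivative:
  assumes a: "abs_conv a" and s: "Re s > 1"
  shows "(dirichlet a has_field_derivative - dirichlet (\<lambda>n. ln (real n) * a n) s) (at s)"
proof -
  have "\<exists>g g'. \<forall>x\<in>{s. Re s > 1}. (\<lambda>n. of_real (a n) * of_nat n powr (-x)) sums g x \<and>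
         (\<lambda>n. of_real (a n) * (- of_real (ln (real n)) * of_nat n powr (-x))) sums g' x \<and> (g has_field_derivative g' x) (at x)"
  proof (rule series_and_derivative_comparison_complex)
    fix x :: complex assume x: "x \<in> {s. Re s > 1}"
    define d where "d = (Re x - 1) / 2"
    have d: "d > 0" "Re x - d > 1" using x by (auto simp: d_def field_simps)
    show "\<exists>d h. 0 < d \<and> summable h \<and> range h \<subseteq> \<real>\<^sub>\<ge>\<^sub>0 \<and>
       (\<forall>\<^sub>F n in sequentially. \<forall>y\<in>ball x d \<inter> {s. Re s > 1}. norm (of_real (a n) * of_nat n powr (-y)) \<le> norm (h n :: complex))"
    proof (intro exI conjI)
      show "summable (\<lambda>n. complex_of_real (\<bar>a n\<bar> * real n powr (-(Re x - d))))"
        using a d unfolding abs_conv_def summable_of_real_iff by blast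
      show "\<forall>\<^sub>F n in sequentially. \<forall>y\<in>ball x d \<inter> {s. 1 < Re s}. norm (of_real (a n) * of_nat n powr (-y)) \<le>
          norm (complex_of_real (\<bar>a n\<bar> * real n powr (-(Re x - d))))"
        using eventually_ge_at_top[of 1]
      proof eventually_elim
        case (elim n)
        show ?case
        proof
          fix y assume "y \<in> ball x d \<inter> {s. 1 < Re s}"
          then have "\<bar>Re (x - y)\<bar> < d" using abs_Re_le_cmod[of "x - y"] by (auto simp: dist_norm)
          then have "- Re y \<le> -(Re x - d)" by simp
          then have "real n powr - Re y \<le> real n powr (-(Re x - d))" using elim by (intro powr_mono) auto
          then show "norm (of_real (a n) * of_nat n powr (-y)) \<le> norm (complex_of_real (\<bar>a n\<bar> * real n powr (-(Re x - d))))"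
            by (auto simp: norm_mult norm_nat_powr intro!: mult_left_mono)
        qed
      qed
    qed (use d in auto)
  next
    show "((\<lambda>x. of_real (a n) * of_nat n powr (-x)) has_field_derivative
        of_real (a n) * (- of_real (ln (real n)) * of_nat n powr (-x))) (at x)" for n and x :: complex
      by (intro DERIV_cmult has_field_derivative_nat_powr)
  qed (auto simp: open_halfspace_Re_gt)
  then obtain g g' where g: "\<And>x. Re x > 1 \<Longrightarrow> (\<lambda>n. of_real (a n) * of_nat n powr (-x)) sums g x"
    "\<And>x. Re x > 1 \<Longrightarrow> (\<lambda>n. of_real (a n) * (- of_real (ln (real n)) * of_nat n powr (-x))) sums g' x"
    "\<And>x. Re x > 1 \<Longrightarrow> (g has_field_derivative g' x) (at x)" by auto
  have "(\<lambda>n. - (of_real (a n) * (- of_real (ln (real n)) * of_nat n powr (-s)))) sums - g' s"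
    by (intro sums_minus g s)
  then have "(\<lambda>n. of_real (ln (real n) * a n) * of_nat n powr (-s)) sums - g' s"
    by (simp add: mult_ac)
  then have "dirichlet (\<lambda>n. ln (real n) * a n) s = - g' s"
    by (simp add: dirichlet_def sums_iff)
  moreover have "(dirichlet a has_field_derivative g' s) (at s)"
    using g(3)[OF s]
    by (rule has_field_derivative_transform_within_open[of _ _ _ "{s. Re s > 1}"])
       (use g(1) s in \<open>auto simp: dirichlet_def sums_iff open_halfspace_Re_gt\<close>)
  ultimately show ?thesis by simp
qed

lemma abs_conv_one: "abs_conv (\<lambda>n. 1)" and abs_conv_ln: "abs_conv (\<lambda>n. ln (real n))"
  using abs_conv_const[of 1] abs_conv_mult_ln[OF abs_conv_const[of 1]] by simp_all

lemma mangoldt_le_ln: "mangoldt n \<le> ln (real n)" "\<bar>mangoldt n\<bar> \<le> \<bar>ln (real n)\<bar>"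
  using mangoldt_le[of n] mangoldt_nonneg[of n] by (cases "n = 0"; force)+

lemma abs_conv_mangoldt: "abs_conv mangoldt"
  by (rule abs_conv_le[OF abs_conv_ln mangoldt_le_ln(2)])

section \<open>Zeta and the von Mangoldt function to the right of 1\<close>

abbreviation zeta :: "complex \<Rightarrow> complex" where "zeta \<equiv> dirichlet (\<lambda>n. 1)"

text \<open>The unordered form of the series, over positive indices only, in which the double series
  of \<open>mangoldt_convolution\<close> can be regrouped.\<close>

lemma dirichlet_infsum:
  assumes "abs_conv a" "Re s > 1"
  shows "((\<lambda>n. of_real (a n) * of_nat n powr (-s)) has_sum dirichlet a s) {1..}"
    "(\<lambda>n. norm (of_real (a n) * of_nat n powr (-s))) summable_on {1..}"
proof -
  have "((\<lambda>n. of_real (a n) * of_nat n powr (-s)) has_sum dirichlet a s) UNIV"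
    unfolding dirichlet_def using dirichlet_abs_summable[OF assms]
    by (intro norm_summable_imp_has_sum) (auto dest: summable_norm_cancel)
  then show "((\<lambda>n. of_real (a n) * of_nat n powr (-s)) has_sum dirichlet a s) {1..}"
    by (rule has_sum_cong_neutral[THEN iffD1, rotated -1]) (auto simp: not_le)
  show "(\<lambda>n. norm (of_real (a n) * of_nat n powr (-s))) summable_on {1..}"
    using dirichlet_abs_summable[OF assms] norm_summable_imp_summable_on[of "\<lambda>n. norm (of_real (a n) * of_nat n powr (-s))"]
    by (auto intro: summable_on_subset_banach)
qed

text \<open>The product is an absolutely convergent sum over pairs \<open>(d, e)\<close>. Collecting
  the pairs with the same product \<open>n\<close> leaves the divisor sum of
  \<open>mangoldt\<close>, which is \<open>ln n\<close>. As the right side is minus the derivative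
  of zeta, this is the source of the logarithmic derivative.\<close>

lemma mangoldt_convolution:
  assumes s: "Re s > 1"
  shows "dirichlet mangoldt s * zeta s = dirichlet (\<lambda>n. ln (real n)) s"
proof -
  define F where "F = (\<lambda>(d::nat, e::nat). (of_real (mangoldt d) * of_nat d powr (-s)) * (of_nat e powr (-s)) :: complex)"
  note M = dirichlet_infsum[OF abs_conv_mangoldt s]
  note Z = dirichlet_infsum[OF abs_conv_one s, simplified]
  have abs: "(\<lambda>x. norm (F x)) summable_on {1..} \<times> {1..}"
    unfolding Infinite_Sum.abs_summable_on_Sigma_iff
  proof
    show "\<forall>d\<in>{1..}. (\<lambda>e. norm (F (d, e))) summable_on {1..}"
      using Z(2) by (auto simp: F_def norm_mult intro!: summable_on_cmult_right)
    have "(\<Sum>\<^sub>\<infinity>e\<in>{1..}. norm (F (d, e))) = norm (of_real (mangoldt d) * of_nat d powr (-s)) * (\<Sum>\<^sub>\<infinity>e\<in>{1..}. norm (of_nat e powr (-s)))" for d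
      by (simp add: F_def norm_mult infsum_cmult_right')
    then show "(\<lambda>d. norm (\<Sum>\<^sub>\<infinity>e\<in>{1..}. norm (F (d, e)))) summable_on {1..}"
      using summable_on_cmult_left[OF M(2), of "\<Sum>\<^sub>\<infinity>e\<in>{1..}. norm (of_nat e powr (-s))"]
      by (simp add: norm_mult infsum_nonneg mangoldt_nonneg)
  qed
  have "infsum F ({1..} \<times> {1..}) = (\<Sum>\<^sub>\<infinity>d\<in>{1..}. \<Sum>\<^sub>\<infinity>e\<in>{1..}. F (d, e))"
    by (rule infsum_Sigma_banach[symmetric]) (rule abs_summable_summable[OF abs])
  also have "\<dots> = (\<Sum>\<^sub>\<infinity>d\<in>{1..}. (of_real (mangoldt d) * of_nat d powr (-s)) * zeta s)"
    using Z by (auto simp: F_def infsum_cmult_right' infsumI intro!: infsum_cong)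
  also have "\<dots> = dirichlet mangoldt s * zeta s"
    using M by (simp add: infsum_cmult_left' infsumI)
  finally have 1: "infsum F ({1..} \<times> {1..}) = dirichlet mangoldt s * zeta s" .
  define F' where "F' = (\<lambda>(n::nat, d::nat). (of_real (mangoldt d) * of_nat n powr (-s)) :: complex)"
  define S where "S = Sigma {1..} (\<lambda>n::nat. {d. d dvd n})"
  have bij: "bij_betw (\<lambda>(d, e). (d * e, d)) ({1..} \<times> {1..}) S"
    unfolding bij_betw_def
  proof
    show "inj_on (\<lambda>(d::nat, e). (d * e, d)) ({1..} \<times> {1..})"
      by (auto simp: inj_on_def)
    show "(\<lambda>(d::nat, e). (d * e, d)) ` ({1..} \<times> {1..}) = S"
    proof (intro equalityI subsetI)
      fix x assume "x \<in> (\<lambda>(d::nat, e). (d * e, d)) ` ({1..} \<times> {1..})"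
      then show "x \<in> S" by (auto simp: S_def)
    next
      fix x assume "x \<in> S"
      then obtain n d where x: "x = (n, d)" "n \<ge> 1" "d dvd n" by (auto simp: S_def)
      then obtain e where "n = d * e" by (auto elim: dvdE)
      with x show "x \<in> (\<lambda>(d::nat, e). (d * e, d)) ` ({1..} \<times> {1..})"
        by (intro image_eqI[where x = "(d, e)"]) (auto simp: Suc_le_eq)
    qed
  qed
  have F'F: "F' ((\<lambda>(d, e). (d * e, d)) x) = F x" if "x \<in> {1..} \<times> {1..}" for x
  proof -
    have "(of_nat (fst x) * of_nat (snd x)) powr (-s) = of_nat (fst x) powr (-s) * (of_nat (snd x) powr (-s) :: complex)"
      by (rule powr_times_real) auto
    then show ?thesis by (simp add: F'_def F_def split_beta)
  qed
  have "(\<lambda>x. F' ((\<lambda>(d, e). (d * e, d)) x)) summable_on {1..} \<times> {1..}"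
    by (rule summable_on_cong[OF F'F, THEN iffD2]) (use abs_summable_summable[OF abs] in auto)
  then have "F' summable_on S" by (rule summable_on_reindex_bij_betw[OF bij, THEN iffD1])
  then have "infsum F' S = (\<Sum>\<^sub>\<infinity>n\<in>{1..}. \<Sum>\<^sub>\<infinity>d\<in>{d. d dvd n}. F' (n, d))"
    unfolding S_def by (rule infsum_Sigma_banach[symmetric])
  also have "\<dots> = (\<Sum>\<^sub>\<infinity>n\<in>{1..}. of_real (ln (real n)) * of_nat n powr (-s))"
  proof (rule infsum_cong)
    fix n :: nat assume n: "n \<in> {1..}"
    then have "finite {d. d dvd n}" by auto
    then have "(\<Sum>\<^sub>\<infinity>d\<in>{d. d dvd n}. F' (n, d)) = (\<Sum>d | d dvd n. of_real (mangoldt d)) * of_nat n powr (-s)"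
      by (simp add: F'_def sum_distrib_right)
    also have "(\<Sum>d | d dvd n. of_real (mangoldt d) :: complex) = of_real (\<Sum>d | d dvd n. mangoldt d)"
      by simp
    also have "(\<Sum>d | d dvd n. mangoldt d) = ln (real n)" using n by (subst mangoldt_sum) auto
    finally show "(\<Sum>\<^sub>\<infinity>d\<in>{d. d dvd n}. F' (n, d)) = of_real (ln (real n)) * of_nat n powr (-s)" .
  qed
  also have "\<dots> = dirichlet (\<lambda>n. ln (real n)) s"
    by (rule infsumI) (rule dirichlet_infsum[OF abs_conv_ln s])
  finally have 2: "infsum F' S = dirichlet (\<lambda>n. ln (real n)) s" .
  have "infsum F ({1..} \<times> {1..}) = infsum F' S"
    using infsum_cong[OF F'F] infsum_reindex_bij_betw[OF bij, of F'] by (rule trans[OF sym])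
  with 1 2 show ?thesis by simp
qed


lemma norm_zeta_real_ge:
  assumes "\<sigma> > 1" shows "norm (zeta (of_real \<sigma>)) \<ge> 1"
proof -
  have sm: "summable (\<lambda>n. real n powr (-\<sigma>))" using assms by (simp add: summable_real_powr_iff)
  have "1 = (\<Sum>n\<in>{1::nat}. real n powr (-\<sigma>))" by simp
  also have "\<dots> \<le> (\<Sum>n. real n powr (-\<sigma>))" by (rule sum_le_suminf[OF sm]) auto
  finally have "1 \<le> (\<Sum>n. real n powr (-\<sigma>))" .
  then show ?thesis using dirichlet_of_real[OF abs_conv_one assms] by simp
qed

text \<open>
  By \<open>mangoldt_convolution\<close>, \<open>\<zeta>\<close> divided by the exponential of the series with
  coefficients \<open>\<Lambda>(n) / ln n\<close> has derivative zero. The value of the constant (which is one) is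
  irrelevant for a lower bound on \<open>\<zeta>\<close>.
\<close>

lemma norm_zeta_eq_exp:
  obtains K b where "K > 0" "abs_conv b" "\<And>n. b n \<ge> 0"
    "\<And>s. Re s > 1 \<Longrightarrow> norm (zeta s) = K * exp (Re (dirichlet b s))"
proof -
  \<comment> \<open>These are the coefficients of the logarithm of zeta. At \<open>n = 1\<close>
    numerator and denominator both vanish and the quotient is 0, so that multiplying by
    \<open>ln n\<close> gives back \<open>mangoldt\<close> everywhere.\<close>
  define b where "b = (\<lambda>n. mangoldt n / ln (real n) :: real)"
  have "\<bar>b n\<bar> \<le> \<bar>1\<bar>" for n
    using mangoldt_le_ln(2)[of n] by (simp add: b_def divide_le_eq_1)
  have b0: "b n \<ge> 0" for n
    unfolding b_def by (cases "n = 0") (auto intro!: divide_nonneg_nonneg mangoldt_nonneg)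
  have b: "abs_conv b" by (rule abs_conv_le[OF abs_conv_one]) fact
  have lnb: "(\<lambda>n. ln (real n) * b n) = mangoldt"
  proof
    show "ln (real n) * b n = mangoldt n" for n
      using mangoldt_le_ln(1)[of n] mangoldt_nonneg[of n] by (cases "ln (real n) = 0") (auto simp: b_def)
  qed
  define h where "h = (\<lambda>s. zeta s * exp (- dirichlet b s))"
  have "\<exists>c. \<forall>s\<in>{s. Re s > 1}. h s = c"
  proof (rule has_field_derivative_zero_constant)
    show "convex {s. Re s > 1}" by (rule convex_halfspace_Re_gt)
    fix s assume "s \<in> {s. Re s > 1}"
    then have s: "Re s > 1" by simp
    have "(h has_field_derivative (- dirichlet (\<lambda>n. ln (real n)) s * exp (- dirichlet b s) + 
        zeta s * (exp (- dirichlet b s) * dirichlet mangoldt s))) (at s)"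
      unfolding h_def
      using dirichlet_has_derivative[OF abs_conv_one s] dirichlet_has_derivative[OF b s] lnb
      by (auto intro!: derivative_eq_intros)
    also have "- dirichlet (\<lambda>n. ln (real n)) s * exp (- dirichlet b s) + 
        zeta s * (exp (- dirichlet b s) * dirichlet mangoldt s) = 0"
      unfolding mangoldt_convolution[OF s, symmetric] by simp
    finally show "(h has_field_derivative 0) (at s within {s. 1 < Re s})"
      by (rule has_field_derivative_at_within)
  qed
  then obtain c where c: "\<And>s. Re s > 1 \<Longrightarrow> h s = c" by auto
  have eq: "zeta s = c * exp (dirichlet b s)" if "Re s > 1" for s
    using c[OF that] by (auto simp: h_def exp_minus field_simps)
  \<comment> \<open>One point where zeta is known not to vanish is enough; at 2 the term
    \<open>n = 1\<close> of the series provides it.\<close>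
  have "c \<noteq> 0" using norm_zeta_real_ge[of 2] eq[of 2] by auto
  then show thesis
    using that[of "norm c" b] eq b b0 by (simp add: norm_mult)
qed

text \<open>Since the coefficients of the exponent are nonnegative, its real part at
  \<open>s\<close> is at least minus its value at \<open>Re s\<close>, so the two exponents add up
  to something nonnegative. A lower bound for zeta at any height thus follows from an upper bound on
  the real axis.\<close>

lemma norm_zeta_mult_ge:
  obtains K where "K > 0"
    "\<And>s. Re s > 1 \<Longrightarrow> norm (zeta s) * norm (zeta (of_real (Re s))) \<ge> K"
proof -
  obtain K b where K: "K > 0" and b: "abs_conv b" and b0: "\<And>n. b n \<ge> 0"
    and Keq: "\<And>s. Re s > 1 \<Longrightarrow> norm (zeta s) = K * exp (Re (dirichlet b s))"
    by (rule norm_zeta_eq_exp) (rule that)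
  have "norm (zeta s) * norm (zeta (of_real (Re s))) \<ge> K\<^sup>2" if s: "Re s > 1" for s
  proof -
    have "Re (dirichlet b (of_real (Re s))) = (\<Sum>n. \<bar>b n\<bar> * real n powr (-Re s))"
      using dirichlet_of_real[OF b s] b0 by simp
    moreover have "- Re (dirichlet b s) \<le> norm (dirichlet b s)"
      using complex_Re_le_cmod[of "- dirichlet b s"] by simp
    ultimately have "0 \<le> Re (dirichlet b s) + Re (dirichlet b (of_real (Re s)))"
      using norm_dirichlet_le[OF b s] by linarith
    then have "K\<^sup>2 * 1 \<le> K\<^sup>2 * exp (Re (dirichlet b s) + Re (dirichlet b (of_real (Re s))))"
      by (intro mult_left_mono) auto
    then show ?thesis using Keq[of s] Keq[of "of_real (Re s)"] s
      by (simp add: exp_add power2_eq_square mult_ac)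
  qed
  then show thesis using that[of "K\<^sup>2"] K by simp
qed

text \<open>
  \<open>zeta_reg\<close> is \<open>(s - 1) \<zeta>(s)\<close>, continued to \<open>Re s > 0\<close>. For \<open>N = n + 1\<close>, the summand is \<open>s - 1\<close> times the
  difference between \<open>N\<^sup>-\<^sup>s\<close> and the integral of \<open>x\<^sup>-\<^sup>s\<close> over \<open>[N, N + 1]\<close>; the factor cancels the
  denominator \<open>1 - s\<close> of that integral.
\<close>

definition zeta_reg_term :: "nat \<Rightarrow> complex \<Rightarrow> complex" where
  "zeta_reg_term n s = (s - 1) * of_nat (Suc n) powr (-s) - of_nat (Suc n) powr (1 - s) + of_nat (Suc (Suc n)) powr (1 - s)"

definition zeta_reg :: "complex \<Rightarrow> complex" where
  "zeta_reg s = 1 + (\<Sum>n. zeta_reg_term n s)"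

lemma norm_of_real_powr: "x > 0 \<Longrightarrow> norm (of_real x powr s) = x powr Re s"
  by (subst norm_powr_real_powr) auto

text \<open>With \<open>N = Suc n\<close>, the term is the integral over \<open>[N, N + 1]\<close>
  of \<open>(s - 1) * (N powr (-s) - x powr (-s))\<close>. The mean value inequality is applied
  twice: to the difference of powers, and to the antiderivative \<phi>. The power of
  \<open>N\<close> gained is what moves convergence from \<open>Re s > 1\<close> to
  \<open>Re s > 0\<close>.\<close>

lemma norm_zeta_reg_term_le:
  assumes s: "Re s > -1"
  shows "norm (zeta_reg_term n s) \<le> norm s * norm (s - 1) * real (Suc n) powr (-1 - Re s)"
proof -
  define N where "N = real (Suc n)"
  have N: "N > 0" by (simp add: N_def)
  define S where "S = closed_segment (complex_of_real N) (of_real (N + 1))"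
  have S: "\<exists>r. x = of_real r \<and> N \<le> r \<and> r \<le> N + 1" if "x \<in> S" for x
    using that unfolding S_def closed_segment_of_real by (auto simp: closed_segment_eq_real_ivl)
  have Npos: "x \<notin> \<real>\<^sub>\<le>\<^sub>0" if "x \<in> S" for x using S[OF that] N by auto
  have ends: "of_real N \<in> S" "of_real (N + 1) \<in> S" by (auto simp: S_def)
  define B where "B = norm s * N powr (-1 - Re s)"
  have B0: "B \<ge> 0" by (simp add: B_def)
  have 1: "norm (of_real N powr (-s) - x powr (-s)) \<le> B" if x: "x \<in> S" for x
  proof -
    have "norm (of_real N powr (-s) - x powr (-s)) \<le> B * norm (of_real N - x)"
    proof (rule field_differentiable_bound[where S = S and f' = "\<lambda>x. - s * x powr (-s - 1)"])
      show "convex S" by (simp add: S_def)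
      show "((\<lambda>x. x powr (-s)) has_field_derivative - s * z powr (-s - 1)) (at z within S)" if "z \<in> S" for z
        by (rule has_field_derivative_at_within, rule has_field_derivative_powr, rule Npos, rule that)
      show "norm (- s * z powr (-s - 1)) \<le> B" if z: "z \<in> S" for z
      proof -
        obtain r where r: "z = of_real r" "N \<le> r" using S[OF z] by auto
        have "norm (z powr (-s - 1)) = r powr (- Re s - 1)"
          using r N by (simp add: norm_of_real_powr)
        also have "\<dots> \<le> N powr (- Re s - 1)" using r N s by (intro powr_mono2') auto
        also have "- Re s - 1 = -1 - Re s" by simp
        finally show ?thesis by (simp add: B_def norm_mult mult_left_mono)
      qed
    qed (use x ends in auto)
    also have "norm (of_real N - x) \<le> 1"
    proof -
      obtain r where r: "x = of_real r" "N \<le> r" "r \<le> N + 1" using S[OF x] by auto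
      have "complex_of_real N - x = of_real (N - r)" using r by simp
      then have "norm (of_real N - x) = \<bar>N - r\<bar>" by (simp only: norm_of_real)
      then show ?thesis using r by simp
    qed
    finally show ?thesis using B0 by (simp add: mult_left_mono)
  qed
  define \<phi> where "\<phi> = (\<lambda>x. (s - 1) * of_real N powr (-s) * x + x powr (1 - s))"
  have "norm (\<phi> (of_real (N + 1)) - \<phi> (of_real N)) \<le> (norm (s - 1) * B) * norm (of_real (N + 1) - of_real N :: complex)"
  proof (rule field_differentiable_bound[where S = S and f' = "\<lambda>x. (s - 1) * (of_real N powr (-s) - x powr (-s))"])
    show "convex S" by (simp add: S_def)
    show "(\<phi> has_field_derivative (s - 1) * (of_real N powr - s - z powr - s)) (at z within S)" if "z \<in> S" for z
    proof (rule has_field_derivative_at_within)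
      have "((\<lambda>x. x powr (1 - s)) has_field_derivative (1 - s) * z powr (1 - s - 1)) (at z)"
        by (intro has_field_derivative_powr Npos that)
      then have "(\<phi> has_field_derivative (s - 1) * of_real N powr (-s) + (1 - s) * z powr (1 - s - 1)) (at z)"
        unfolding \<phi>_def by (intro DERIV_add DERIV_cmult_Id)
      then show "(\<phi> has_field_derivative (s - 1) * (of_real N powr - s - z powr - s)) (at z)"
        by (simp add: algebra_simps)
    qed
    show "norm ((s - 1) * (of_real N powr - s - z powr - s)) \<le> norm (s - 1) * B" if "z \<in> S" for z
      using 1[OF that] by (simp add: norm_mult mult_left_mono)
  qed (use ends in auto)
  also have "norm (of_real (N + 1) - of_real N :: complex) = 1" by simp
  also have "\<phi> (of_real (N + 1)) - \<phi> (of_real N) = zeta_reg_term n s"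
    by (simp add: \<phi>_def zeta_reg_term_def N_def algebra_simps)
  finally show ?thesis by (simp add: B_def N_def mult_ac)
qed

lemma summable_Suc_powr: "a < -1 \<Longrightarrow> summable (\<lambda>n. real (Suc n) powr a)"
  by (subst summable_Suc_iff) (simp add: summable_real_powr_iff)

lemma zeta_reg_term_summable: "Re s > 0 \<Longrightarrow> summable (\<lambda>n. norm (zeta_reg_term n s))"
  by (rule summable_comparison_test'[where N = 0 and g = "\<lambda>n. norm s * norm (s - 1) * real (Suc n) powr (-1 - Re s)"])
     (auto intro!: summable_mult summable_Suc_powr norm_zeta_reg_term_le simp del: of_nat_Suc)

text \<open>\<open>B\<close> is the value of zeta at 3/2. The factor \<open>norm (s - 1)\<close> is
  kept because it gives \<open>zeta_reg 1 = 1\<close> and bounds the difference quotient of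
  \<open>zeta_reg\<close> at 1; together with \<open>norm s\<close> it accounts for the quadratic
  growth.\<close>

lemma norm_zeta_reg_minus_1:
  obtains B where "B > 0" "\<And>s. Re s \<ge> 1/2 \<Longrightarrow> norm (zeta_reg s - 1) \<le> B * norm s * norm (s - 1)"
proof -
  define B where "B = (\<Sum>n. real (Suc n) powr (-3/2))"
  have sm: "summable (\<lambda>n. real (Suc n) powr (-3/2))" by (rule summable_Suc_powr) simp
  have "B > 0" unfolding B_def by (rule suminf_pos[OF sm]) simp
  moreover have "norm (zeta_reg s - 1) \<le> B * norm s * norm (s - 1)" if s: "Re s \<ge> 1/2" for s
  proof -
    have "norm (zeta_reg s - 1) \<le> (\<Sum>n. norm (zeta_reg_term n s))"
      unfolding zeta_reg_def using summable_norm[OF zeta_reg_term_summable[of s]] s by simp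
    also have "\<dots> \<le> (\<Sum>n. norm s * norm (s - 1) * real (Suc n) powr (-3/2))"
    proof (intro suminf_le zeta_reg_term_summable summable_mult sm)
      fix n
      have "norm (zeta_reg_term n s) \<le> norm s * norm (s - 1) * real (Suc n) powr (-1 - Re s)"
        using s by (intro norm_zeta_reg_term_le) simp
      also have "\<dots> \<le> norm s * norm (s - 1) * real (Suc n) powr (-3/2)"
        using s by (intro mult_left_mono powr_mono) auto
      finally show "norm (zeta_reg_term n s) \<le> norm s * norm (s - 1) * real (Suc n) powr (-3/2)" .
    qed (use s in simp)
    also have "\<dots> = B * norm s * norm (s - 1)" unfolding B_def by (subst suminf_mult[OF sm]) simp
    finally show ?thesis .
  qed
  ultimately show thesis by (rule that)
qed

text \<open>The powers with exponent \<open>1 - s\<close> telescope. For \<open>Re s > 1\<close>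
  they tend to 0 and leave only -1, which cancels the 1 in the definition of
  \<open>zeta_reg\<close>.\<close>

lemma zeta_reg_eq_zeta:
  assumes s: "Re s > 1" shows "zeta_reg s = (s - 1) * zeta s"
proof -
  have "(\<lambda>n. of_real 1 * of_nat n powr (-s)) sums zeta s"
    unfolding dirichlet_def using dirichlet_abs_summable[OF abs_conv_one s]
    by (intro summable_sums) (rule summable_norm_cancel, simp)
  then have "(\<lambda>n. of_nat (Suc n) powr (-s)) sums zeta s"
    by (subst sums_Suc_iff) simp
  then have 1: "(\<lambda>n. (s - 1) * of_nat (Suc n) powr (-s)) sums ((s - 1) * zeta s)" by (rule sums_mult)
  have "(\<lambda>n. norm (of_nat (Suc n) powr (1 - s))) \<longlonglongrightarrow> 0"
  proof -
    have "(\<lambda>n. real (Suc n) powr (1 - Re s)) \<longlonglongrightarrow> 0"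
      using s by real_asymp
    then show ?thesis by (simp only: norm_nat_powr minus_complex.sel one_complex.sel)
  qed
  then have "(\<lambda>n. of_nat (Suc n) powr (1 - s)) \<longlonglongrightarrow> 0" by (rule tendsto_norm_zero_cancel)
  then have "(\<lambda>n. of_nat (Suc (Suc n)) powr (1 - s) - of_nat (Suc n) powr (1 - s)) sums (0 - of_nat (Suc 0) powr (1 - s))"
    by (rule telescope_sums)
  then have "(\<lambda>n. (s - 1) * of_nat (Suc n) powr (-s) + (of_nat (Suc (Suc n)) powr (1 - s) - of_nat (Suc n) powr (1 - s)))
      sums ((s - 1) * zeta s + (0 - of_nat (Suc 0) powr (1 - s)))"
    by (rule sums_add[OF 1])
  moreover have "(s - 1) * of_nat (Suc n) powr (-s) + (of_nat (Suc (Suc n)) powr (1 - s) - of_nat (Suc n) powr (1 - s))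
      = zeta_reg_term n s" for n by (simp only: zeta_reg_term_def diff_conv_add_uminus add_ac)
  ultimately have "(\<lambda>n. zeta_reg_term n s) sums ((s - 1) * zeta s + (0 - of_nat (Suc 0) powr (1 - s)))" by (simp only:)
  from sums_unique[OF this, symmetric] show ?thesis by (simp add: zeta_reg_def)
qed

lemma zeta_reg_holomorphic: "zeta_reg holomorphic_on {s. Re s > 0}"
proof -
  have "\<exists>g. \<forall>x\<in>{s. Re s > 0}. ((\<lambda>n. zeta_reg_term n x) sums g x) \<and> g field_differentiable (at x)"
  proof (rule series_differentiable_comparison_complex[of "{s. Re s > 0}" zeta_reg_term])
    show "open {s. Re s > 0}" by (rule open_halfspace_Re_gt)
    show "zeta_reg_term n field_differentiable at x" for n x
      unfolding zeta_reg_term_def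
      by (rule holomorphic_on_imp_differentiable_at[OF _ open_UNIV]) (auto intro!: holomorphic_intros)
    fix x :: complex assume "x \<in> {s. Re s > 0}"
    then have x: "Re x > 0" by simp
    define d where "d = Re x / 2"
    define K where "K = (norm x + d) * (norm x + d + 1)"
    have K0: "K \<ge> 0" using x by (simp add: K_def d_def)
    show "\<exists>d h. 0 < d \<and> summable h \<and> range h \<subseteq> \<real>\<^sub>\<ge>\<^sub>0 \<and>
      (\<forall>\<^sub>F n in sequentially. \<forall>y\<in>ball x d \<inter> {s. 0 < Re s}. norm (zeta_reg_term n y) \<le> norm (h n :: complex))"
    proof (intro exI conjI)
      show "summable (\<lambda>n. complex_of_real (K * real (Suc n) powr (-1 - d)))"
        unfolding summable_of_real_iff using x by (intro summable_mult summable_Suc_powr) (simp add: d_def)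
      show "\<forall>\<^sub>F n in sequentially. \<forall>y\<in>ball x d \<inter> {s. 0 < Re s}. norm (zeta_reg_term n y) \<le> norm (complex_of_real (K * real (Suc n) powr (-1 - d)))"
      proof (intro always_eventually allI ballI)
        fix n y assume y: "y \<in> ball x d \<inter> {s. 0 < Re s}"
        then have nd: "norm (x - y) < d" by (simp add: dist_norm)
        have "Re y \<ge> d" using nd abs_Re_le_cmod[of "x - y"] by (simp add: d_def)
        have ny: "norm y \<le> norm x + d" using nd norm_triangle_ineq2[of y x] by (simp add: norm_minus_commute)
        have "norm (y - 1) \<le> norm x + d + 1" using ny norm_triangle_ineq4[of y 1] by simp
        then have "norm y * norm (y - 1) \<le> K" unfolding K_def using ny x by (intro mult_mono) (auto simp: d_def)
        moreover have "real (Suc n) powr (-1 - Re y) \<le> real (Suc n) powr (-1 - d)"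
          using \<open>Re y \<ge> d\<close> by (intro powr_mono) auto
        ultimately have "norm y * norm (y - 1) * real (Suc n) powr (-1 - Re y) \<le> K * real (Suc n) powr (-1 - d)"
          using K0 by (intro mult_mono) auto
        then have "norm (zeta_reg_term n y) \<le> K * real (Suc n) powr (-1 - d)"
          using norm_zeta_reg_term_le[of y n] y by simp
        also have "\<dots> = norm (complex_of_real (K * real (Suc n) powr (-1 - d)))"
          using K0 by (simp only: norm_of_real) simp
        finally show "norm (zeta_reg_term n y) \<le> norm (complex_of_real (K * real (Suc n) powr (-1 - d)))" .
      qed
    qed (use x K0 in \<open>auto simp: d_def\<close>)
  qed blast
  then obtain g where g: "\<And>x. Re x > 0 \<Longrightarrow> (\<lambda>n. zeta_reg_term n x) sums g x" "\<And>x. Re x > 0 \<Longrightarrow> g field_differentiable (at x)"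
    by auto
  have "(\<lambda>s. 1 + g s) holomorphic_on {s. Re s > 0}"
    using g(2) by (intro holomorphic_intros) (auto simp: holomorphic_on_def intro: field_differentiable_at_within)
  then show ?thesis
    by (rule holomorphic_transform) (use g(1) in \<open>auto simp: zeta_reg_def sums_iff\<close>)
qed

section \<open>Logarithmic derivatives of holomorphic functions\<close>

text \<open>The map taking \<open>w\<close> to \<open>w / (2 * A - w)\<close> sends the half plane
  \<open>Re w < A\<close> into the unit disc and fixes 0, so Schwarz's lemma applies to its
  composition with \<open>h\<close>. Solving for \<open>h\<close> gives the bound.\<close>

lemma Borel_Caratheodory_unit_ball:
  fixes h :: "complex \<Rightarrow> complex"
  assumes hol: "h holomorphic_on ball 0 1" and h0: "h 0 = 0"
    and Re: "\<And>z. norm z < 1 \<Longrightarrow> Re (h z) < A" and z: "norm z < 1"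
  shows "norm (h z) \<le> 2 * A * norm z / (1 - norm z)"
proof -
  have A: "A > 0" using Re[of 0] h0 by simp
  have nz: "2 * of_real A - h w \<noteq> 0" if "norm w < 1" for w
  proof
    assume "2 * of_real A - h w = 0"
    then have "Re (2 * of_real A - h w) = 0" by (metis zero_complex.sel(1))
    then show False using Re[OF that] A by simp
  qed
  define \<phi> where "\<phi> = (\<lambda>w. h w / (2 * of_real A - h w))"
  have "\<phi> holomorphic_on ball 0 1"
    unfolding \<phi>_def using nz by (intro holomorphic_intros hol) auto
  moreover have "\<phi> 0 = 0" by (simp add: \<phi>_def h0)
  moreover have "norm (\<phi> w) < 1" if "norm w < 1" for w
  proof -
    have "0 < 4 * A * (A - Re (h w))" using A Re[OF that] by simp
    also have "\<dots> = (norm (2 * of_real A - h w))\<^sup>2 - (norm (h w))\<^sup>2"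
      unfolding cmod_power2 by (simp add: power2_eq_square algebra_simps)
    finally have "(norm (h w))\<^sup>2 < (norm (2 * of_real A - h w))\<^sup>2" by simp
    then have "norm (h w) < norm (2 * of_real A - h w)"
      by (rule power_less_imp_less_base) (rule norm_ge_zero)
    then show ?thesis unfolding \<phi>_def norm_divide using nz[OF that] by (simp add: divide_simps)
  qed
  ultimately have le: "norm (\<phi> z) \<le> norm z" using z by (rule Schwarz_Lemma(1))
  have "h z = \<phi> z * (2 * of_real A - h z)" using nz[OF z] by (simp add: \<phi>_def)
  then have "norm (h z) = norm (\<phi> z) * norm (2 * of_real A - h z)" by (metis norm_mult)
  also have "\<dots> \<le> norm z * (2 * A + norm (h z))"
    using le A norm_triangle_ineq4[of "2 * of_real A" "h z"] by (intro mult_mono) (auto simp: norm_mult)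
  finally show ?thesis using z by (simp add: field_simps)
qed

text \<open>Writing \<open>f = exp g\<close>, the hypothesis bounds only the real part of
  \<open>g - g s\<close>. Borel-Caratheodory turns this into the bound \<open>14 * A\<close> for its
  norm on radius \<open>7/8 * R\<close>, and Cauchy's inequality on a disc of radius
  \<open>R / 8\<close> about \<open>z\<close> multiplies it by \<open>8 / R\<close>; hence
  112.\<close>

lemma log_deriv_bound:
  fixes f :: "complex \<Rightarrow> complex"
  assumes hol: "f holomorphic_on ball s R" and nz: "\<And>z. z \<in> ball s R \<Longrightarrow> f z \<noteq> 0"
    and le: "\<And>z. z \<in> ball s R \<Longrightarrow> norm (f z) < exp A * norm (f s)"
    and z: "norm (z - s) \<le> 3/4 * R" and R: "R > 0"
  shows "norm (deriv f z / f z) \<le> 112 * A / R"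
proof -
  obtain g where g: "g holomorphic_on ball s R" "\<And>z. z \<in> ball s R \<Longrightarrow> f z = exp (g z)"
    using contractible_imp_holomorphic_log[OF hol convex_imp_contractible[OF convex_ball]] nz by blast
  define h where "h = (\<lambda>w. g (s + of_real R * w) - g s)"
  have inb: "s + of_real R * w \<in> ball s R" if "norm w < 1" for w
    using that R by (auto simp: dist_norm norm_mult)
  have A: "A > 0" using le[of s] nz[of s] R by simp
  have hh: "h holomorphic_on ball 0 1"
  proof -
    have "(g \<circ> (\<lambda>w. s + of_real R * w)) holomorphic_on ball 0 1"
      by (intro holomorphic_on_compose holomorphic_intros holomorphic_on_subset[OF g(1)]) (use inb in auto)
    then show ?thesis unfolding h_def o_def by (intro holomorphic_intros) 
  qed
  have Reh: "Re (h w) < A" if "norm w < 1" for w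
  proof -
    have "exp (Re (h w)) = norm (f (s + of_real R * w)) / norm (f s)"
      using g(2)[OF inb[OF that]] g(2)[of s] R by (simp add: h_def exp_diff)
    also have "\<dots> < exp A" using le[OF inb[OF that]] nz[of s] R by (simp add: field_simps)
    finally show ?thesis by simp
  qed
  have hb: "norm (g u - g s) \<le> 14 * A" if "norm (u - s) \<le> 7/8 * R" for u
  proof -
    define w where "w = (u - s) / of_real R"
    have w: "norm w \<le> 7/8" using that R by (simp add: w_def norm_divide field_simps)
    have "u = s + of_real R * w" using R by (simp add: w_def)
    then have "g u - g s = h w" by (simp add: h_def)
    also have "norm (h w) \<le> 2 * A * norm w / (1 - norm w)"
      using w by (intro Borel_Caratheodory_unit_ball[OF hh _ Reh]) (auto simp: h_def)
    also have "\<dots> \<le> 14 * A"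
    proof -
      have "2 * A * norm w \<le> 2 * A * (7 * (1 - norm w))" using w A by (intro mult_left_mono) auto
      then have "2 * A * norm w \<le> 14 * A * (1 - norm w)" by (simp add: algebra_simps)
      then show ?thesis using w by (subst pos_divide_le_eq) auto
    qed
    finally show ?thesis .
  qed
  have zin: "z \<in> ball s R" using z R by (simp add: dist_norm norm_minus_commute)
  have sub: "cball z (R/8) \<subseteq> ball s R"
  proof
    fix u assume "u \<in> cball z (R/8)"
    then show "u \<in> ball s R" using z R norm_triangle_ineq[of "u - z" "z - s"]
      by (auto simp: dist_norm norm_minus_commute)
  qed
  have "norm ((deriv ^^ 1) (\<lambda>u. g u - g s) z) \<le> fact 1 * (14 * A) / (R/8) ^ 1"
  proof (rule Cauchy_inequality)
    show "(\<lambda>u. g u - g s) holomorphic_on ball z (R/8)"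
      using sub ball_subset_cball by (intro holomorphic_intros holomorphic_on_subset[OF g(1)]) blast
    show "continuous_on (cball z (R / 8)) (\<lambda>u. g u - g s)"
      by (intro continuous_intros continuous_on_subset[OF holomorphic_on_imp_continuous_on[OF g(1)] sub])
    fix x assume "norm (z - x) = R/8"
    then have "norm (x - s) \<le> 7/8 * R"
      using z norm_triangle_ineq[of "x - z" "z - s"] by (auto simp: norm_minus_commute)
    then show "norm (g x - g s) \<le> 14 * A" by (rule hb)
  qed (use R in auto)
  moreover have gd: "(g has_field_derivative deriv g z) (at z)"
    using g(1) zin by (auto intro: holomorphic_derivI)
  then have "deriv (\<lambda>u. g u - g s) z = deriv g z"
    by (intro DERIV_imp_deriv) (auto intro!: derivative_eq_intros)
  moreover have "deriv f z = deriv g z * f z"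
  proof (rule DERIV_imp_deriv)
    have "((\<lambda>u. exp (g u)) has_field_derivative deriv g z * f z) (at z)"
      using gd g(2)[OF zin] by (auto intro!: derivative_eq_intros)
    then show "(f has_field_derivative deriv g z * f z) (at z)"
      by (rule has_field_derivative_transform_within_open[of _ _ _ "ball s R"]) (use g(2) zin in auto)
  qed
  then have "deriv f z / f z = deriv g z" using nz[OF zin] by simp
  moreover have "fact 1 * (14 * A) / (R / 8) ^ 1 = 112 * A / R" by simp
  ultimately show ?thesis by simp
qed

text \<open>
  On the sphere the factor \<open>z - \<rho>\<close> is at least three times as large as at the centre, so dividing
  it out lowers the exponent \<open>n\<close>. Induction on \<open>n\<close> therefore removes all zeros near the centre
  without counting their multiplicities.
\<close>

lemma divide_out_zero:
  fixes f :: "complex \<Rightarrow> complex"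
  assumes hol: "f holomorphic_on cball s r" and r: "r > 0" and fs: "f s \<noteq> 0"
    and le: "\<And>z. z \<in> sphere s r \<Longrightarrow> norm (f z) \<le> 3 ^ n * norm (f s)"
    and left: "\<And>z. z \<in> ball s r \<Longrightarrow> f z = 0 \<Longrightarrow> Re z \<le> Re s"
    and \<rho>: "norm (\<rho> - s) \<le> r/4" "f \<rho> = 0"
  obtains f1 m where "n = Suc m" "f1 holomorphic_on cball s r" "f1 s \<noteq> 0"
    "\<And>z. z \<in> sphere s r \<Longrightarrow> norm (f1 z) \<le> 3 ^ m * norm (f1 s)"
    "\<And>z. z \<in> ball s r \<Longrightarrow> f1 z = 0 \<Longrightarrow> Re z \<le> Re s"
    "deriv f s / f s = 1 / (s - \<rho>) + deriv f1 s / f1 s"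
proof -
  define f1 where "f1 = (\<lambda>z. if z = \<rho> then deriv f \<rho> else (f z - f \<rho>) / (z - \<rho>))"
  have \<rho>in: "\<rho> \<in> ball s r" using \<rho> r by (simp add: dist_norm norm_minus_commute)
  have h1: "f1 holomorphic_on cball s r"
    unfolding f1_def using \<rho>in by (intro pole_lemma hol) (auto simp: interior_cball)
  have ne: "s \<noteq> \<rho>" using fs \<rho>(2) by auto
  have f1: "f1 z = f z / (z - \<rho>)" if "z \<noteq> \<rho>" for z using that \<rho>(2) by (simp add: f1_def)
  have f1s: "f1 s \<noteq> 0" using f1[OF ne] fs ne by simp
  have bd: "norm (f1 z) \<le> (3 ^ n / 3) * norm (f1 s)" if z: "z \<in> sphere s r" for z
  proof -
    have ns: "norm (z - s) = r" using z by (simp add: dist_norm norm_minus_commute)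
    have zr: "norm (z - \<rho>) \<ge> 3/4 * r"
      using norm_triangle_ineq[of "z - \<rho>" "\<rho> - s"] ns \<rho>(1) by simp
    then have "z \<noteq> \<rho>" using r by auto
    then have "norm (f1 z) = norm (f z) / norm (z - \<rho>)" by (simp add: f1 norm_divide)
    also have "\<dots> \<le> (3 ^ n * norm (f s)) / (3/4 * r)"
      using zr r le[OF z] by (intro frac_le) auto
    also have "\<dots> = 3 ^ n / 3 * (norm (f s) / (r/4))" using r by (simp add: field_simps)
    also have "\<dots> \<le> 3 ^ n / 3 * (norm (f s) / norm (s - \<rho>))"
      using \<rho>(1) ne r by (intro mult_left_mono divide_left_mono) (auto simp: norm_minus_commute)
    also have "norm (f s) / norm (s - \<rho>) = norm (f1 s)" by (simp add: f1[OF ne] norm_divide)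
    finally show ?thesis .
  qed
  \<comment> \<open>For \<open>n = 0\<close> the maximum principle would bound \<open>f1 s\<close>
    by a third of itself. So at most \<open>n\<close> zeros can ever be divided out, which is why
    the induction ends.\<close>
  have "n \<noteq> 0"
  proof
    assume n: "n = 0"
    have "norm (f1 s) \<le> 1/3 * norm (f1 s)"
    proof (rule maximum_modulus_frontier[of f1 "cball s r"])
      show "f1 holomorphic_on interior (cball s r)"
        by (rule holomorphic_on_subset[OF h1]) (simp add: interior_subset)
      show "continuous_on (closure (cball s r)) f1"
        using holomorphic_on_imp_continuous_on[OF h1] by simp
    qed (use r bd n in auto)
    then show False using f1s by simp
  qed
  then obtain m where m: "n = Suc m" using not0_implies_Suc by blast
  have d1: "(f1 has_field_derivative deriv f1 s) (at s)"
    using holomorphic_derivI[OF holomorphic_on_subset[OF h1 ball_subset_cball], of s] r by simp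
  have "deriv f s = f1 s + (s - \<rho>) * deriv f1 s"
  proof (rule DERIV_imp_deriv)
    have "((\<lambda>z. (z - \<rho>) * f1 z) has_field_derivative f1 s + (s - \<rho>) * deriv f1 s) (at s)"
      using d1 by (auto intro!: derivative_eq_intros)
    moreover have "(\<lambda>z. (z - \<rho>) * f1 z) = f" using \<rho>(2) by (auto simp: f1_def fun_eq_iff)
    ultimately show "(f has_field_derivative f1 s + (s - \<rho>) * deriv f1 s) (at s)" by simp
  qed
  moreover have "f s = (s - \<rho>) * f1 s" using f1[OF ne] ne by simp
  ultimately have "deriv f s / f s = 1 / (s - \<rho>) + deriv f1 s / f1 s"
    using ne f1s by (simp add: add_divide_distrib)
  moreover have "Re z \<le> Re s" if "z \<in> ball s r" "f1 z = 0" for z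
  proof (cases "z = \<rho>")
    case True then show ?thesis using left[OF \<rho>in \<rho>(2)] by simp
  next
    case False then show ?thesis using left[OF that(1)] that(2) by (simp add: f1)
  qed
  ultimately show thesis using that[OF m h1 f1s] bd m by simp
qed

lemma Re_inverse_nonneg: "Re z \<ge> 0 \<Longrightarrow> Re (1 / z) \<ge> 0"
  by (simp add: Re_divide)

lemma Re_log_deriv_ge:
  fixes f :: "complex \<Rightarrow> complex"
  assumes "f holomorphic_on cball s r" "r > 0" "f s \<noteq> 0"
    and "\<And>z. z \<in> sphere s r \<Longrightarrow> norm (f z) \<le> 3 ^ n * norm (f s)"
    and "\<And>z. z \<in> ball s r \<Longrightarrow> f z = 0 \<Longrightarrow> Re z \<le> Re s"
  shows "Re (deriv f s / f s) \<ge> - (672 * (real n + 1) / r)"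
proof -
  have noz: "Re (deriv f s / f s) \<ge> - (672 * (real n + 1) / r)"
    if hol: "f holomorphic_on cball s r" and fs: "f s \<noteq> 0"
      and le: "\<And>z. z \<in> sphere s r \<Longrightarrow> norm (f z) \<le> 3 ^ n * norm (f s)"
      and nz: "\<And>\<rho>. norm (\<rho> - s) \<le> r/4 \<Longrightarrow> f \<rho> \<noteq> 0" for f n
  proof -
    have ln3: "ln 3 \<le> (3/2::real)"
    proof -
      have "(3::real) \<le> exp 1 * exp (1/2)"
        using exp_ge_add_one_self[of 1] exp_ge_add_one_self[of "1/2"] mult_mono[of 2 "exp 1" "3/2" "exp (1/2)::real"] by simp
      also have "\<dots> = exp (3/2)" by (simp flip: exp_add)
      finally have "ln 3 \<le> ln (exp (3/2::real))" by (subst ln_le_cancel_iff) auto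
      then show ?thesis by simp
    qed
    have "norm (deriv f s / f s) \<le> 112 * ((real n + 1) * ln 3) / (r/4)"
    proof (rule log_deriv_bound)
      show "f holomorphic_on ball s (r/4)" using assms(2) by (intro holomorphic_on_subset[OF hol]) auto
      show "f z \<noteq> 0" if "z \<in> ball s (r / 4)" for z
        using that by (intro nz) (auto simp: dist_norm norm_minus_commute)
      show "norm (f z) < exp ((real n + 1) * ln 3) * norm (f s)" if "z \<in> ball s (r / 4)" for z
      proof -
        have "norm (f z) \<le> 3 ^ n * norm (f s)"
        proof (rule maximum_modulus_frontier[of f "cball s r"])
          show "f holomorphic_on interior (cball s r)"
            by (rule holomorphic_on_subset[OF hol]) (simp add: interior_subset)
          show "continuous_on (closure (cball s r)) f"
            using holomorphic_on_imp_continuous_on[OF hol] by simp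
        qed (use assms(2) le that in auto)
        also have "\<dots> < 3 ^ Suc n * norm (f s)" using fs by simp
        also have "(3::real) ^ Suc n = exp ((real n + 1) * ln 3)"
          by (subst powr_realpow[symmetric]) (simp_all add: powr_def algebra_simps)
        finally show ?thesis .
      qed
    qed (use assms(2) in auto)
    also have "\<dots> = 448 * (real n + 1) * ln 3 / r" by simp
    also have "\<dots> \<le> 448 * (real n + 1) * (3/2) / r"
      using ln3 assms(2) by (intro divide_right_mono mult_left_mono) auto
    also have "448 * (real n + 1) * (3/2) = 672 * (real n + 1)" by simp
    finally have "norm (deriv f s / f s) \<le> 672 * (real n + 1) / r" .
    then have "- (672 * (real n + 1) / r) \<le> - norm (deriv f s / f s)" by (rule le_imp_neg_le)
    also have "\<dots> \<le> Re (deriv f s / f s)"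
      using complex_Re_le_cmod[of "- (deriv f s / f s)"] by (simp only: norm_minus_cancel uminus_complex.sel minus_le_iff)
    finally show ?thesis .
  qed
  show ?thesis
    using assms
  proof (induction n arbitrary: f)
    case 0
    show ?case
    proof (cases "\<exists>\<rho>. norm (\<rho> - s) \<le> r/4 \<and> f \<rho> = 0")
      case True
      then obtain \<rho> where "norm (\<rho> - s) \<le> r/4" "f \<rho> = 0" by blast
      \<comment> \<open>With exponent 0 there can be no zero: dividing it out would give
        \<open>0 = Suc m\<close>.\<close>
      show ?thesis by (rule divide_out_zero[OF 0 \<open>norm (\<rho> - s) \<le> r/4\<close> \<open>f \<rho> = 0\<close>]; (assumption | simp))
    next
      case False
      then have nz: "f \<rho> \<noteq> 0" if "norm (\<rho> - s) \<le> r/4" for \<rho> using that by blast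
      show ?thesis
        by (rule noz[OF 0(1,3,4) nz])
    qed
  next
    case (Suc n)
    show ?case
    proof (cases "\<exists>\<rho>. norm (\<rho> - s) \<le> r/4 \<and> f \<rho> = 0")
      case True
      then obtain \<rho> where \<rho>: "norm (\<rho> - s) \<le> r/4" "f \<rho> = 0" by blast
      obtain f1 m where f1: "Suc n = Suc m" "f1 holomorphic_on cball s r" "f1 s \<noteq> 0"
        "\<And>z. z \<in> sphere s r \<Longrightarrow> norm (f1 z) \<le> 3 ^ m * norm (f1 s)"
        "\<And>z. z \<in> ball s r \<Longrightarrow> f1 z = 0 \<Longrightarrow> Re z \<le> Re s"
        "deriv f s / f s = 1 / (s - \<rho>) + deriv f1 s / f1 s"
        by (rule divide_out_zero[OF Suc.prems \<rho>]; (assumption | (rule that; assumption)))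
      have mn: "m = n" using f1(1) by simp
      have "Re (1 / (s - \<rho>)) \<ge> 0"
        using Suc.prems(5)[of \<rho>] \<rho> assms(2) by (intro Re_inverse_nonneg) (auto simp: dist_norm norm_minus_commute)
      moreover have "Re (deriv f1 s / f1 s) \<ge> - (672 * (real n + 1) / r)"
        by (rule Suc.IH[OF f1(2) assms(2) f1(3) f1(4)[unfolded mn] f1(5)])
      moreover have "672 * (real n + 1) / r \<le> 672 * (real (Suc n) + 1) / r"
        using assms(2) by (intro divide_right_mono) auto
      moreover have "Re (deriv f s / f s) = Re (1 / (s - \<rho>)) + Re (deriv f1 s / f1 s)"
        by (simp only: f1(6) plus_complex.sel)
      ultimately show ?thesis by linarith
    next
      case False
      then have nz: "f \<rho> \<noteq> 0" if "norm (\<rho> - s) \<le> r/4" for \<rho> using that by blast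
      show ?thesis
        by (rule noz[OF Suc.prems(1,3,4) nz])
    qed
  qed
qed

text \<open>The known zero is divided out and its contribution kept; the quotient still satisfies
  the hypotheses of \<open>Re_log_deriv_ge\<close>.\<close>

lemma Re_log_deriv_ge_zero:
  fixes f :: "complex \<Rightarrow> complex"
  assumes "f holomorphic_on cball s r" "r > 0" "f s \<noteq> 0"
    and "\<And>z. z \<in> sphere s r \<Longrightarrow> norm (f z) \<le> 3 ^ n * norm (f s)"
    and "\<And>z. z \<in> ball s r \<Longrightarrow> f z = 0 \<Longrightarrow> Re z \<le> Re s"
    and "norm (\<rho> - s) \<le> r/4" "f \<rho> = 0"
  shows "Re (deriv f s / f s) \<ge> Re (1 / (s - \<rho>)) - 672 * (real n + 1) / r"
proof -
  obtain f1 m where f1: "n = Suc m" "f1 holomorphic_on cball s r" "f1 s \<noteq> 0"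
    "\<And>z. z \<in> sphere s r \<Longrightarrow> norm (f1 z) \<le> 3 ^ m * norm (f1 s)"
    "\<And>z. z \<in> ball s r \<Longrightarrow> f1 z = 0 \<Longrightarrow> Re z \<le> Re s"
    "deriv f s / f s = 1 / (s - \<rho>) + deriv f1 s / f1 s"
    by (rule divide_out_zero[OF assms]; (assumption | (rule that; assumption)))
  have "Re (deriv f1 s / f1 s) \<ge> - (672 * (real m + 1) / r)"
    by (rule Re_log_deriv_ge[OF f1(2) assms(2) f1(3-5)])
  moreover have "672 * (real m + 1) / r \<le> 672 * (real n + 1) / r"
    using assms(2) f1(1) by (intro divide_right_mono) auto
  moreover have "Re (deriv f s / f s) = Re (1 / (s - \<rho>)) + Re (deriv f1 s / f1 s)"
    by (simp only: f1(6) plus_complex.sel)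
  ultimately show ?thesis by linarith
qed

section \<open>The zero-free region\<close>

lemma zeta_nonzero: "Re s > 1 \<Longrightarrow> zeta s \<noteq> 0"
  by (rule norm_zeta_mult_ge) (metis mult_zero_left norm_zero not_le)

lemma zeta_reg_nonzero: "Re s > 1 \<Longrightarrow> zeta_reg s \<noteq> 0"
  by (auto simp: zeta_reg_eq_zeta zeta_nonzero)

lemma zeta_reg_one: "zeta_reg 1 = 1"
proof -
  obtain B where "\<And>s. Re s \<ge> 1/2 \<Longrightarrow> norm (zeta_reg s - 1) \<le> B * norm s * norm (s - 1)"
    by (rule norm_zeta_reg_minus_1) (rule that)
  from this[of 1] show ?thesis by simp
qed

lemma norm_zeta_reg_le:
  obtains A where "A > 0" "\<And>s. 1/2 \<le> Re s \<Longrightarrow> Re s \<le> 3 \<Longrightarrow> norm (zeta_reg s) \<le> A * (\<bar>Im s\<bar> + 3)\<^sup>2"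
proof -
  obtain B where B: "B > 0" "\<And>s. Re s \<ge> 1/2 \<Longrightarrow> norm (zeta_reg s - 1) \<le> B * norm s * norm (s - 1)"
    by (rule norm_zeta_reg_minus_1) (rule that)
  have "norm (zeta_reg s) \<le> (1 + B) * (\<bar>Im s\<bar> + 3)\<^sup>2" if s: "1/2 \<le> Re s" "Re s \<le> 3" for s
  proof -
    have "norm s \<le> \<bar>Im s\<bar> + 3" using cmod_le[of s] s by simp
    moreover have "norm (s - 1) \<le> \<bar>Im s\<bar> + 3" using cmod_le[of "s - 1"] s by simp
    ultimately have "norm s * norm (s - 1) \<le> (\<bar>Im s\<bar> + 3)\<^sup>2"
      unfolding power2_eq_square by (intro mult_mono) auto
    then have "B * norm s * norm (s - 1) \<le> B * (\<bar>Im s\<bar> + 3)\<^sup>2" using B(1) by (simp add: mult.assoc)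
    moreover have "1 \<le> (\<bar>Im s\<bar> + 3)\<^sup>2" by (rule one_le_power) simp
    moreover have "norm (zeta_reg s) \<le> norm (zeta_reg s - 1) + 1" using norm_triangle_ineq[of "zeta_reg s - 1" 1] by simp
    ultimately show ?thesis using B(2)[OF s(1)] unfolding distrib_right by linarith
  qed
  then show thesis using that[of "1 + B"] B(1) by simp
qed

text \<open>On the real axis the growth bound is \<open>9 * A\<close>, so zeta at \<sigma> is at
  most \<open>9 * A / (\<sigma> - 1)\<close>, and \<open>norm_zeta_mult_ge\<close> turns this into a
  lower bound at every height. It serves at the centres of discs, where the maximum of
  \<open>zeta_reg\<close> is compared with its central value.\<close>

lemma norm_zeta_reg_ge:
  obtains c where "c > 0" "\<And>s. 1 < Re s \<Longrightarrow> Re s \<le> 2 \<Longrightarrow> c * norm (s - 1) * (Re s - 1) \<le> norm (zeta_reg s)"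
proof -
  obtain A where A: "A > 0" "\<And>s. 1/2 \<le> Re s \<Longrightarrow> Re s \<le> 3 \<Longrightarrow> norm (zeta_reg s) \<le> A * (\<bar>Im s\<bar> + 3)\<^sup>2"
    by (rule norm_zeta_reg_le) (rule that)
  obtain K where K: "K > 0" "\<And>s. Re s > 1 \<Longrightarrow> norm (zeta s) * norm (zeta (of_real (Re s))) \<ge> K"
    by (rule norm_zeta_mult_ge) (rule that)
  have "K / (9 * A) * norm (s - 1) * (Re s - 1) \<le> norm (zeta_reg s)" if s: "1 < Re s" "Re s \<le> 2" for s
  proof -
    have "norm (zeta (of_real (Re s))) * (Re s - 1) = norm (zeta_reg (of_real (Re s)))"
      using s by (simp add: zeta_reg_eq_zeta norm_mult) (metis abs_of_pos diff_gt_0_iff_gt norm_of_real of_real_1 of_real_diff)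
    also have "\<dots> \<le> 9 * A" using A(2)[of "of_real (Re s)"] s by simp
    finally have z: "norm (zeta (of_real (Re s))) * (Re s - 1) \<le> 9 * A" .
    have "K * (Re s - 1) \<le> norm (zeta s) * norm (zeta (of_real (Re s))) * (Re s - 1)"
      using K(2)[OF s(1)] s by (intro mult_right_mono) auto
    also have "\<dots> \<le> norm (zeta s) * (9 * A)" unfolding mult.assoc by (intro mult_left_mono z) auto
    finally have "K / (9 * A) * (Re s - 1) \<le> norm (zeta s)" using A(1) by (simp add: field_simps)
    then have "K / (9 * A) * (Re s - 1) * norm (s - 1) \<le> norm (zeta s) * norm (s - 1)" by (rule mult_right_mono) simp
    then show ?thesis using s by (simp add: zeta_reg_eq_zeta norm_mult mult_ac)
  qed
  then show thesis using that[of "K / (9 * A)"] K(1) A(1) by simp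
qed

lemma dirichlet_mangoldt_eq:
  assumes s: "Re s > 1"
  shows "dirichlet mangoldt s = 1 / (s - 1) - deriv zeta_reg s / zeta_reg s"
proof -
  have "((\<lambda>s. (s - 1) * zeta s) has_field_derivative (zeta s - (s - 1) * (dirichlet mangoldt s * zeta s))) (at s)"
    using dirichlet_has_derivative[OF abs_conv_one s] unfolding mangoldt_convolution[OF s]
    by (auto intro!: derivative_eq_intros)
  then have "(zeta_reg has_field_derivative (zeta s - (s - 1) * (dirichlet mangoldt s * zeta s))) (at s)"
    by (rule has_field_derivative_transform_within_open[of _ _ _ "{s. Re s > 1}"])
       (use s in \<open>auto simp: open_halfspace_Re_gt zeta_reg_eq_zeta\<close>)
  then have "deriv zeta_reg s = zeta s - (s - 1) * (dirichlet mangoldt s * zeta s)" by (rule DERIV_imp_deriv)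
  moreover have "s \<noteq> 1" using s by auto
  ultimately show ?thesis using zeta_nonzero[OF s] by (simp add: zeta_reg_eq_zeta[OF s] diff_divide_distrib)
qed

lemma Re_dirichlet_sums:
  assumes a: "abs_conv a" and s: "Re s > 1"
  shows "(\<lambda>n. a n * real n powr (-Re s) * cos (Im s * ln (real n))) sums Re (dirichlet a s)"
proof -
  have "(\<lambda>n. of_real (a n) * of_nat n powr (-s)) sums dirichlet a s"
    unfolding dirichlet_def by (rule summable_sums) (rule summable_norm_cancel[OF dirichlet_abs_summable[OF a s]])
  then have "(\<lambda>n. Re (of_real (a n) * of_nat n powr (-s))) sums Re (dirichlet a s)" by (rule sums_Re)
  moreover have eq: "Re (of_real (a n) * of_nat n powr (-s)) = a n * real n powr (-Re s) * cos (Im s * ln (real n))" for n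
  proof (cases "n = 0")
    case False
    then have "Re (of_nat n powr (-s)) = exp (- (Re s * ln (real n))) * cos (Im s * ln (real n))"
      by (simp add: powr_def Ln_of_nat Re_exp)
    then show ?thesis using False by (simp add: powr_def)
  qed simp
  ultimately show ?thesis by (simp only: eq)
qed

lemma mangoldt_3_4_1:
  assumes "\<sigma> > 1"
  shows "0 \<le> 3 * Re (dirichlet mangoldt (of_real \<sigma>)) + 4 * Re (dirichlet mangoldt (Complex \<sigma> t))
      + Re (dirichlet mangoldt (Complex \<sigma> (2 * t)))"
proof -
  define w where "w = (\<lambda>n. mangoldt n * real n powr (-\<sigma>) :: real)"
  have w: "w n \<ge> 0" for n by (simp add: w_def mangoldt_nonneg)
  have S: "(\<lambda>n. w n * cos (u * ln (real n))) sums Re (dirichlet mangoldt (Complex \<sigma> u))" for u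
    using Re_dirichlet_sums[OF abs_conv_mangoldt, of "Complex \<sigma> u"] assms by (simp add: w_def)
  have sm: "(\<lambda>n. 3 * (w n * cos (0 * ln (real n))) + 4 * (w n * cos (t * ln (real n))) + w n * cos (2 * t * ln (real n))) sums
     (3 * Re (dirichlet mangoldt (Complex \<sigma> 0)) + 4 * Re (dirichlet mangoldt (Complex \<sigma> t))
      + Re (dirichlet mangoldt (Complex \<sigma> (2 * t))))"
    by (intro sums_add sums_mult S)
  have pos: "0 \<le> 3 * (w n * cos (0 * ln (real n))) + 4 * (w n * cos (t * ln (real n))) + w n * cos (2 * t * ln (real n))" for n
  proof -
    have "3 * (w n * cos (0 * ln (real n))) + 4 * (w n * cos (t * ln (real n))) + w n * cos (2 * t * ln (real n))
        = w n * (2 * (1 + cos (t * ln (real n)))\<^sup>2)"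
    proof -
      have "cos (2 * t * ln (real n)) = 2 * (cos (t * ln (real n)))\<^sup>2 - 1"
        using cos_double_cos[of "t * ln (real n)"] by (simp add: mult.assoc)
      then show ?thesis by (simp only: ) (simp add: algebra_simps power2_eq_square)
    qed
    then show ?thesis using w[of n] by simp
  qed
  have "0 \<le> 3 * Re (dirichlet mangoldt (Complex \<sigma> 0)) + 4 * Re (dirichlet mangoldt (Complex \<sigma> t))
      + Re (dirichlet mangoldt (Complex \<sigma> (2 * t)))"
    by (rule sums_le[OF pos sums_zero sm])
  then show ?thesis by (simp add: complex_of_real_def)
qed

section \<open>Logarithmic derivatives just to the right of 1 and the position of zeros\<close>

lemma ln_ge_1: "x \<ge> 3 \<Longrightarrow> 1 \<le> ln (x::real)"
  using exp_le by (subst ln_ge_iff) auto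

lemma ln_mult_squares: "q > 0 \<Longrightarrow> u > 0 \<Longrightarrow> v > 0 \<Longrightarrow> ln (q * (u\<^sup>2 * v\<^sup>2)) = ln q + (2 * ln u + 2 * ln (v::real))"
  by (simp add: ln_mult ln_realpow)

abbreviation Re_log_deriv_zeta_reg :: "real \<Rightarrow> real \<Rightarrow> real" where
  "Re_log_deriv_zeta_reg \<delta> t \<equiv> Re (deriv zeta_reg (Complex (1 + \<delta>) t) / zeta_reg (Complex (1 + \<delta>) t))"

text \<open>On the disc of radius 1/2 about \<open>Complex (1 + \<delta>) t\<close>, the growth
  bound exceeds the central lower bound by a factor \<open>X\<close> of order
  \<open>(\<bar>t\<bar> + 4)\<^sup>2 / \<delta>\<^sup>2\<close>, so the exponent \<open>n\<close>
  needed in \<open>Re_log_deriv_ge\<close> is of order \<open>ln X\<close>. The radius keeps the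
  disc in \<open>Re s \<ge> 1/2\<close>; a quarter of it is the admissible distance 1/8 of a
  zero.\<close>

lemma zeta_reg_log_deriv_ge:
  obtains B where "B > 0"
    "\<And>\<delta> t. 0 < \<delta> \<Longrightarrow> \<delta> \<le> 1/16 \<Longrightarrow> Re_log_deriv_zeta_reg \<delta> t \<ge> - (B * (ln (\<bar>t\<bar> + 3) + ln (1 / \<delta>)))"
    "\<And>\<delta> t \<rho>. 0 < \<delta> \<Longrightarrow> \<delta> \<le> 1/16 \<Longrightarrow> norm (\<rho> - Complex (1 + \<delta>) t) \<le> 1/8 \<Longrightarrow> zeta_reg \<rho> = 0 \<Longrightarrow>
       Re_log_deriv_zeta_reg \<delta> t \<ge> Re (1 / (Complex (1 + \<delta>) t - \<rho>)) - B * (ln (\<bar>t\<bar> + 3) + ln (1 / \<delta>))"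
proof -
  obtain A0 where A0: "A0 > 0" "\<And>s. 1/2 \<le> Re s \<Longrightarrow> Re s \<le> 3 \<Longrightarrow> norm (zeta_reg s) \<le> A0 * (\<bar>Im s\<bar> + 3)\<^sup>2"
    by (rule norm_zeta_reg_le) (rule that)
  obtain c where c: "c > 0" "\<And>s. 1 < Re s \<Longrightarrow> Re s \<le> 2 \<Longrightarrow> c * norm (s - 1) * (Re s - 1) \<le> norm (zeta_reg s)"
    by (rule norm_zeta_reg_ge) (rule that)
  \<comment> \<open>Enlarged so that \<open>A / c \<ge> 1\<close>, which makes
    \<open>X \<ge> 1\<close> and \<open>ln X \<ge> 0\<close> below.\<close>
  define A where "A = max A0 c"
  have A: "A > 0" "A \<ge> c" "A \<ge> A0" using c by (auto simp: A_def)
  define D where "D = ln (A / c) + 2"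
  have D: "D \<ge> 0" using A c by (simp add: D_def)
  \<comment> \<open>1344 is 672 divided by the radius 1/2. The 4 comes from
    \<open>2 * ln (\<bar>t\<bar> + 4) \<le> 4 * ln (\<bar>t\<bar> + 3)\<close>, the 2 in
    \<open>D\<close> from rounding \<open>n\<close> up and from \<open>n + 1\<close>.\<close>
  define B where "B = 1344 * (D + 4)"
  have B: "B > 0" using D by (simp add: B_def)
  have main: "\<exists>n. (\<forall>z\<in>sphere (Complex (1 + \<delta>) t) (1/2). norm (zeta_reg z) \<le> 3 ^ n * norm (zeta_reg (Complex (1 + \<delta>) t)))
      \<and> 672 * (real n + 1) / (1/2) \<le> B * (ln (\<bar>t\<bar> + 3) + ln (1 / \<delta>))"
    if \<delta>: "0 < \<delta>" "\<delta> \<le> 1/16" for \<delta> t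
  proof -
    define s where "s = Complex (1 + \<delta>) t"
    define X where "X = A * (\<bar>t\<bar> + 4)\<^sup>2 / (c * \<delta>\<^sup>2)"
    have "1 * 1 \<le> (A / c) * ((\<bar>t\<bar> + 4)\<^sup>2 / \<delta>\<^sup>2)"
    proof (rule mult_mono)
      have "\<delta>\<^sup>2 \<le> (\<bar>t\<bar> + 4)\<^sup>2" using \<delta> by (intro power_mono) auto
      then show "1 \<le> (\<bar>t\<bar> + 4)\<^sup>2 / \<delta>\<^sup>2" using \<delta> by simp
    qed (use A c in auto)
    then have X1: "X \<ge> 1" by (simp add: X_def)
    define n where "n = nat \<lceil>ln X\<rceil>"
    have lnX: "ln X \<ge> 0" using X1 by simp
    have n: "ln X \<le> real n" "real n \<le> ln X + 1" using lnX by (auto simp: n_def)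
    have "X = exp (ln X)" using X1 by simp
    also have "\<dots> \<le> exp (real n)" using n by simp
    also have "\<dots> = exp 1 ^ n" by (simp flip: exp_of_nat_mult)
    also have "\<dots> \<le> 3 ^ n" using exp_le by (intro power_mono) auto
    finally have X3: "X \<le> 3 ^ n" .
    have Gs: "c * \<delta>\<^sup>2 \<le> norm (zeta_reg s)"
    proof -
      have "c * \<delta> * \<delta> \<le> c * norm (s - 1) * \<delta>"
        using c \<delta> abs_Re_le_cmod[of "s - 1"] by (intro mult_right_mono mult_left_mono) (auto simp: s_def)
      also have "\<dots> \<le> norm (zeta_reg s)" using c(2)[of s] \<delta> by (simp add: s_def)
      finally show ?thesis by (simp add: power2_eq_square mult.assoc)
    qed
    have "norm (zeta_reg z) \<le> 3 ^ n * norm (zeta_reg s)" if "z \<in> sphere s (1/2)" for z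
    proof -
      have nz: "norm (z - s) = 1/2" using that by (simp add: dist_norm norm_minus_commute)
      have "\<bar>Re (z - s)\<bar> \<le> 1/2" "\<bar>Im (z - s)\<bar> \<le> 1/2"
        using abs_Re_le_cmod[of "z - s"] abs_Im_le_cmod[of "z - s"] nz by auto
      then have "\<bar>Re z - (1 + \<delta>)\<bar> \<le> 1/2" "\<bar>Im z - t\<bar> \<le> 1/2" by (simp_all add: s_def)
      then have z: "1/2 \<le> Re z" "Re z \<le> 3" "\<bar>Im z\<bar> + 3 \<le> \<bar>t\<bar> + 4" using \<delta> by linarith+
      have "norm (zeta_reg z) \<le> A0 * (\<bar>Im z\<bar> + 3)\<^sup>2" by (rule A0(2)[OF z(1,2)])
      also have "\<dots> \<le> A * (\<bar>t\<bar> + 4)\<^sup>2" using A A0(1) z(3) by (intro mult_mono power_mono) auto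
      also have "\<dots> = X * (c * \<delta>\<^sup>2)" using c \<delta> by (simp add: X_def)
      also have "\<dots> \<le> 3 ^ n * norm (zeta_reg s)" using X3 Gs X1 c by (intro mult_mono) auto
      finally show ?thesis .
    qed
    moreover have "672 * (real n + 1) / (1/2) \<le> B * (ln (\<bar>t\<bar> + 3) + ln (1 / \<delta>))"
    proof -
      have "\<bar>t\<bar> + 4 \<le> (\<bar>t\<bar> + 3)\<^sup>2" by (simp add: power2_eq_square algebra_simps)
      then have "ln (\<bar>t\<bar> + 4) \<le> ln ((\<bar>t\<bar> + 3)\<^sup>2)" by (subst ln_le_cancel_iff) auto
      then have l4: "ln (\<bar>t\<bar> + 4) \<le> 2 * ln (\<bar>t\<bar> + 3)" by (subst (asm) ln_realpow) auto
      have l3: "1 \<le> ln (\<bar>t\<bar> + 3)" by (rule ln_ge_1) auto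
      have ld: "0 \<le> ln (1 / \<delta>)" using \<delta> by simp
      have "X = (A / c) * ((\<bar>t\<bar> + 4)\<^sup>2 * (1 / \<delta>)\<^sup>2)" by (simp add: X_def power_divide)
      then have "ln X = ln (A / c) + (2 * ln (\<bar>t\<bar> + 4) + 2 * ln (1 / \<delta>))"
        using A c(1) \<delta> by (simp only:) (rule ln_mult_squares, auto)
      then have "real n + 1 \<le> D + 4 * ln (\<bar>t\<bar> + 3) + 2 * ln (1 / \<delta>)" using n l4 by (simp add: D_def)
      also have "\<dots> \<le> D * (ln (\<bar>t\<bar> + 3) + ln (1 / \<delta>)) + 4 * (ln (\<bar>t\<bar> + 3) + ln (1 / \<delta>))"
        using mult_left_mono[of 1 "ln (\<bar>t\<bar> + 3) + ln (1 / \<delta>)" D] D l3 ld by (auto simp del: ln_div)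
      finally show ?thesis by (simp add: B_def algebra_simps del: ln_div)
    qed
    ultimately show ?thesis unfolding s_def by blast
  qed
  have hol: "zeta_reg holomorphic_on cball (Complex (1 + \<delta>) t) (1/2)" if "0 < \<delta>" for \<delta> t
  proof (rule holomorphic_on_subset[OF zeta_reg_holomorphic])
    show "cball (Complex (1 + \<delta>) t) (1/2) \<subseteq> {s. 0 < Re s}"
    proof
      fix z assume "z \<in> cball (Complex (1 + \<delta>) t) (1/2)"
      then have "\<bar>Re (Complex (1 + \<delta>) t - z)\<bar> \<le> 1/2"
        using abs_Re_le_cmod[of "Complex (1 + \<delta>) t - z"] by (simp add: dist_norm)
      then have "\<bar>1 + \<delta> - Re z\<bar> \<le> 1/2" by simp
      then have "0 < Re z" using that by linarith
      then show "z \<in> {s. 0 < Re s}" by simp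
    qed
  qed
  have left: "Re z \<le> Re (Complex (1 + \<delta>) t)" if "0 < \<delta>" "zeta_reg z = 0" for \<delta> t z
    using zeta_reg_nonzero[of z] that by fastforce
  have nz: "zeta_reg (Complex (1 + \<delta>) t) \<noteq> 0" if "0 < \<delta>" for \<delta> t
    using that by (intro zeta_reg_nonzero) simp
  show thesis
  proof (rule that[OF B])
    fix \<delta> t :: real assume \<delta>: "0 < \<delta>" "\<delta> \<le> 1/16"
    obtain n where n: "\<And>z. z\<in>sphere (Complex (1 + \<delta>) t) (1/2) \<Longrightarrow> norm (zeta_reg z) \<le> 3 ^ n * norm (zeta_reg (Complex (1 + \<delta>) t))"
      "672 * (real n + 1) / (1/2) \<le> B * (ln (\<bar>t\<bar> + 3) + ln (1 / \<delta>))"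
      using main[OF \<delta>, of t] by blast
    have "Re_log_deriv_zeta_reg \<delta> t \<ge> - (672 * (real n + 1) / (1/2))"
      by (rule Re_log_deriv_ge[OF hol[OF \<delta>(1)] _ nz[OF \<delta>(1)] n(1) left[OF \<delta>(1)]]) auto
    then show "Re_log_deriv_zeta_reg \<delta> t \<ge> - (B * (ln (\<bar>t\<bar> + 3) + ln (1 / \<delta>)))"
      by (rule order_trans[OF le_imp_neg_le[OF n(2)]])
    fix \<rho> assume \<rho>: "norm (\<rho> - Complex (1 + \<delta>) t) \<le> 1/8" "zeta_reg \<rho> = 0"
    have "Re_log_deriv_zeta_reg \<delta> t \<ge> Re (1 / (Complex (1 + \<delta>) t - \<rho>)) - 672 * (real n + 1) / (1/2)"
      by (rule Re_log_deriv_ge_zero[OF hol[OF \<delta>(1)] _ nz[OF \<delta>(1)] n(1) left[OF \<delta>(1)] _ \<rho>(2)]) (use \<rho>(1) in auto)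
    then show "Re_log_deriv_zeta_reg \<delta> t \<ge> Re (1 / (Complex (1 + \<delta>) t - \<rho>)) - B * (ln (\<bar>t\<bar> + 3) + ln (1 / \<delta>))"
      by (rule order_trans[OF diff_left_mono[OF n(2)]])
  qed
qed

text \<open>\<open>mangoldt_3_4_1\<close> is evaluated at 1 + \<delta>. The pole at 1 gives
  \<open>3 / \<delta>\<close> at height 0 and, at heights \<open>t\<close> and \<open>2 * t\<close>
  together, the term with coefficient 4 + 1; the zero gives
  \<open>- 4 / (1 + \<delta> - Re \<rho>)\<close> at height \<open>t\<close>. The bounds 1/16 and
  15/16 place \<rho> within the distance 1/8 at which \<open>zeta_reg_log_deriv_ge\<close> can use
  it.\<close>

lemma zeta_reg_zero_inequality:
  obtains B where "B \<ge> 1"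
    "\<And>\<delta> \<rho>. 0 < \<delta> \<Longrightarrow> \<delta> \<le> 1/16 \<Longrightarrow> zeta_reg \<rho> = 0 \<Longrightarrow> Re \<rho> \<ge> 15/16 \<Longrightarrow>
       4 / (1 + \<delta> - Re \<rho>) \<le> 3 / \<delta> + 5 * (\<delta> / (\<delta>\<^sup>2 + (Im \<rho>)\<^sup>2)) + B * (ln (\<bar>Im \<rho>\<bar> + 3) + ln (1 / \<delta>))"
proof -
  obtain B where B: "B > 0"
    and B1: "\<And>\<delta> t. 0 < \<delta> \<Longrightarrow> \<delta> \<le> 1/16 \<Longrightarrow> Re_log_deriv_zeta_reg \<delta> t \<ge> - (B * (ln (\<bar>t\<bar> + 3) + ln (1 / \<delta>)))"
    and B2: "\<And>\<delta> t \<rho>. 0 < \<delta> \<Longrightarrow> \<delta> \<le> 1/16 \<Longrightarrow> norm (\<rho> - Complex (1 + \<delta>) t) \<le> 1/8 \<Longrightarrow> zeta_reg \<rho> = 0 \<Longrightarrow>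
       Re_log_deriv_zeta_reg \<delta> t \<ge> Re (1 / (Complex (1 + \<delta>) t - \<rho>)) - B * (ln (\<bar>t\<bar> + 3) + ln (1 / \<delta>))"
    by (rule zeta_reg_log_deriv_ge) (rule that)
  have "4 / (1 + \<delta> - Re \<rho>) \<le> 3 / \<delta> + 5 * (\<delta> / (\<delta>\<^sup>2 + (Im \<rho>)\<^sup>2)) + (16 * B + 1) * (ln (\<bar>Im \<rho>\<bar> + 3) + ln (1 / \<delta>))"
    if \<delta>: "0 < \<delta>" "\<delta> \<le> 1/16" and \<rho>: "zeta_reg \<rho> = 0" "Re \<rho> \<ge> 15/16" for \<delta> \<rho>
  proof -
    define t where "t = Im \<rho>"
    define M where "M = ln (\<bar>t\<bar> + 3)"
    define l where "l = ln (1 / \<delta>)"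
    have \<rho>1: "Re \<rho> \<le> 1" using zeta_reg_nonzero[of \<rho>] \<rho> by force
    have l: "l \<ge> 0" using \<delta> by (simp add: l_def)
    have M: "M \<ge> 1" unfolding M_def by (rule ln_ge_1) auto
    have M0: "ln (\<bar>0\<bar> + 3) \<le> M" unfolding M_def by (subst ln_le_cancel_iff) auto
    have M2: "ln (\<bar>2 * t\<bar> + 3) \<le> 2 * M"
    proof -
      have "\<bar>2 * t\<bar> + 3 \<le> (\<bar>t\<bar> + 3)\<^sup>2" by (simp add: power2_eq_square algebra_simps abs_mult)
      then have "ln (\<bar>2 * t\<bar> + 3) \<le> ln ((\<bar>t\<bar> + 3)\<^sup>2)" by (subst ln_le_cancel_iff) auto
      then show ?thesis unfolding M_def by (subst (asm) ln_realpow) auto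
    qed
    have L: "Re (dirichlet mangoldt (Complex (1 + \<delta>) u)) = \<delta> / (\<delta>\<^sup>2 + u\<^sup>2) - Re_log_deriv_zeta_reg \<delta> u" for u
    proof -
      have "Complex (1 + \<delta>) u - 1 = Complex \<delta> u" by (simp add: complex_eq_iff)
      then have "Re (1 / (Complex (1 + \<delta>) u - 1)) = \<delta> / (\<delta>\<^sup>2 + u\<^sup>2)" by (simp add: Re_divide)
      moreover have "dirichlet mangoldt (Complex (1 + \<delta>) u) = 1 / (Complex (1 + \<delta>) u - 1) - deriv zeta_reg (Complex (1 + \<delta>) u) / zeta_reg (Complex (1 + \<delta>) u)"
        using \<delta> by (intro dirichlet_mangoldt_eq) simp
      ultimately show ?thesis by (simp only: minus_complex.sel)
    qed
    have L0: "Re (dirichlet mangoldt (of_real (1 + \<delta>))) \<le> 1 / \<delta> + B * (M + l)"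
    proof -
      have "\<delta> / (\<delta>\<^sup>2 + 0\<^sup>2) = 1 / \<delta>" using \<delta> by (simp add: power2_eq_square)
      then have "Re (dirichlet mangoldt (of_real (1 + \<delta>))) \<le> 1 / \<delta> + B * (ln (\<bar>0\<bar> + 3) + l)"
        using L[of 0] B1[OF \<delta>, of 0] unfolding l_def complex_of_real_def by linarith
      also have "\<dots> \<le> 1 / \<delta> + B * (M + l)" using M0 B by (intro add_left_mono mult_left_mono) auto
      finally show ?thesis .
    qed
    have L1: "Re (dirichlet mangoldt (Complex (1 + \<delta>) t)) \<le> \<delta> / (\<delta>\<^sup>2 + t\<^sup>2) + B * (M + l) - 1 / (1 + \<delta> - Re \<rho>)"
    proof -
      have d: "Complex (1 + \<delta>) t - \<rho> = of_real (1 + \<delta> - Re \<rho>)" by (simp add: complex_eq_iff t_def)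
      have "norm (\<rho> - Complex (1 + \<delta>) t) = \<bar>1 + \<delta> - Re \<rho>\<bar>"
        using d by (subst norm_minus_commute) (simp only: norm_of_real)
      then have n: "norm (\<rho> - Complex (1 + \<delta>) t) \<le> 1/8" using \<delta> \<rho> \<rho>1 by simp
      have "Re (1 / (Complex (1 + \<delta>) t - \<rho>)) = 1 / (1 + \<delta> - Re \<rho>)" unfolding d
        by (metis Re_complex_of_real of_real_1 of_real_divide)
      then show ?thesis using B2[OF \<delta> n \<rho>(1)] L[of t] unfolding M_def l_def by linarith
    qed
    have L2: "Re (dirichlet mangoldt (Complex (1 + \<delta>) (2 * t))) \<le> \<delta> / (\<delta>\<^sup>2 + t\<^sup>2) + B * (2 * M + l)"
    proof -
      have "\<delta> / (\<delta>\<^sup>2 + (2 * t)\<^sup>2) \<le> \<delta> / (\<delta>\<^sup>2 + t\<^sup>2)"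
        using \<delta> by (intro divide_left_mono add_left_mono) (auto simp: power_mult_distrib add_pos_nonneg)
      moreover have "B * (ln (\<bar>2 * t\<bar> + 3) + l) \<le> B * (2 * M + l)" using M2 B by (intro mult_left_mono) auto
      ultimately show ?thesis using L[of "2 * t"] B1[OF \<delta>, of "2 * t"] unfolding l_def by linarith
    qed
    have "B * (M + l) \<ge> 0" "B * l \<ge> 0" "B * M \<ge> 0" using B M l by auto
    moreover have "3 * (B * (M + l)) + 4 * (B * (M + l)) + B * (2 * M + l) = 9 * (B * M) + 8 * (B * l)" by (simp add: algebra_simps)
    moreover have "(16 * B + 1) * (M + l) = 16 * (B * M) + 16 * (B * l) + M + l" by (simp add: algebra_simps)
    moreover have "0 \<le> 3 * Re (dirichlet mangoldt (of_real (1 + \<delta>))) + 4 * Re (dirichlet mangoldt (Complex (1 + \<delta>) t))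
      + Re (dirichlet mangoldt (Complex (1 + \<delta>) (2 * t)))" using \<delta> by (intro mangoldt_3_4_1) simp
    ultimately have "4 * (1 / (1 + \<delta> - Re \<rho>)) \<le> 3 * (1 / \<delta>) + 5 * (\<delta> / (\<delta>\<^sup>2 + t\<^sup>2)) + (16 * B + 1) * (M + l)"
      using L0 L1 L2 M l by linarith
    then show ?thesis by (simp add: M_def l_def t_def)
  qed
  then show thesis using that[of "16 * B + 1"] B by simp
qed

text \<open>A zero on the line would give \<open>4 / \<delta>\<close> on the left against
  \<open>3 / \<delta>\<close> plus terms of order \<open>ln (1 / \<delta>)\<close>, which fails as
  \<delta> tends to 0 for fixed \<open>t \<noteq> 0\<close>. At \<open>t = 0\<close> the value
  \<open>zeta_reg 1 = 1\<close> decides.\<close>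

lemma zeta_reg_nonzero_line: 
  assumes "Re s = 1" shows "zeta_reg s \<noteq> 0"
proof
  assume z: "zeta_reg s = 0"
  define t where "t = Im s"
  have t: "t \<noteq> 0"
  proof
    assume "t = 0"
    then have "s = 1" using assms by (simp add: t_def complex_eq_iff)
    then show False using z zeta_reg_one by simp
  qed
  obtain B where B: "B \<ge> 1" and ineq: "\<And>\<delta> \<rho>. 0 < \<delta> \<Longrightarrow> \<delta> \<le> 1/16 \<Longrightarrow> zeta_reg \<rho> = 0 \<Longrightarrow> Re \<rho> \<ge> 15/16 \<Longrightarrow>
       4 / (1 + \<delta> - Re \<rho>) \<le> 3 / \<delta> + 5 * (\<delta> / (\<delta>\<^sup>2 + (Im \<rho>)\<^sup>2)) + B * (ln (\<bar>Im \<rho>\<bar> + 3) + ln (1 / \<delta>))"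
    by (rule zeta_reg_zero_inequality) (rule that)
  define M where "M = ln (\<bar>t\<bar> + 3)"
  have t2: "t\<^sup>2 > 0" using t by simp
  have "((\<lambda>\<delta>. \<delta> * (5 * (\<delta> / t\<^sup>2) + B * (M + ln (1 / \<delta>)))) \<longlongrightarrow> 0) (at_right 0)"
    using t2 by real_asymp
  then have "eventually (\<lambda>\<delta>. \<delta> * (5 * (\<delta> / t\<^sup>2) + B * (M + ln (1 / \<delta>))) < 1) (at_right 0)"
    by (rule order_tendstoD) simp
  moreover have "eventually (\<lambda>\<delta>. \<delta> \<in> {0<..<1/16::real}) (at_right 0)" by (rule eventually_at_right_real) simp
  ultimately have "eventually (\<lambda>\<delta>::real. False) (at_right 0)"
  proof eventually_elim
    case (elim \<delta>)
    then have \<delta>: "0 < \<delta>" "\<delta> \<le> 1/16" by auto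
    have "4 / \<delta> \<le> 3 / \<delta> + 5 * (\<delta> / (\<delta>\<^sup>2 + t\<^sup>2)) + B * (M + ln (1 / \<delta>))"
      using ineq[OF \<delta> z] assms by (simp add: t_def M_def)
    moreover have "\<delta> / (\<delta>\<^sup>2 + t\<^sup>2) \<le> \<delta> / t\<^sup>2" using \<delta> t2 by (intro divide_left_mono) (auto simp: add_pos_pos)
    moreover have "4 / \<delta> = 3 / \<delta> + 1 / \<delta>" by simp
    ultimately have "1 / \<delta> \<le> 5 * (\<delta> / t\<^sup>2) + B * (M + ln (1 / \<delta>))" by linarith
    then have "\<delta> * (1 / \<delta>) \<le> \<delta> * (5 * (\<delta> / t\<^sup>2) + B * (M + ln (1 / \<delta>)))" using \<delta> by (intro mult_left_mono) auto
    then show False using elim \<delta> by simp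
  qed
  then show False by simp
qed

text \<open>When \<open>Im s\<close> is small compared with \<delta>, the pole weighs as much as at
  height 0 and the zero inequality says nothing. Compactness covers this range: the largest real
  part of a zero in a closed rectangle is attained, and it is below 1 since there are no zeros on
  the line.\<close>

lemma zeta_reg_zero_free_bounded:
  obtains \<eta> where "\<eta> > 0" "\<And>s. Re s \<ge> 1/2 \<Longrightarrow> \<bar>Im s\<bar> \<le> 1 \<Longrightarrow> zeta_reg s = 0 \<Longrightarrow> Re s \<le> 1 - \<eta>"
proof -
  define Z where "Z = {s \<in> cbox (Complex (1/2) (-1)) (Complex 1 1). zeta_reg s = 0}"
  have Z: "s \<in> Z" if "Re s \<ge> 1/2" "\<bar>Im s\<bar> \<le> 1" "zeta_reg s = 0" for s
    using that zeta_reg_nonzero[of s] by (force simp: Z_def in_cbox_complex_iff)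
  show thesis
  proof (cases "Z = {}")
    case True
    then show thesis using that[of 1] Z by auto
  next
    case False
    have "continuous_on (cbox (Complex (1/2) (-1)) (Complex 1 1)) zeta_reg"
      by (rule holomorphic_on_imp_continuous_on[OF holomorphic_on_subset[OF zeta_reg_holomorphic]])
         (auto simp: in_cbox_complex_iff)
    then have "closed Z"
      unfolding Z_def by (intro continuous_closed_preimage_constant closed_cbox)
    then have "compact Z" unfolding compact_eq_bounded_closed
      by (auto simp: Z_def intro: bounded_subset[OF bounded_cbox])
    then obtain s0 where s0: "s0 \<in> Z" "\<And>s. s \<in> Z \<Longrightarrow> Re s \<le> Re s0"
      using continuous_attains_sup[OF _ False continuous_on_Re[OF continuous_on_id]] by auto
    have "Re s0 \<le> 1" "zeta_reg s0 = 0" using s0(1) by (auto simp: Z_def in_cbox_complex_iff)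
    then have "Re s0 < 1" using zeta_reg_nonzero_line[of s0] by fastforce
    then show thesis using that[of "1 - Re s0"] s0(2) Z by auto
  qed
qed

text \<open>For \<delta> a small multiple of \<open>1 / ln (\<bar>Im s\<bar> + 3)\<close>, the terms
  next to \<open>3 / \<delta>\<close> in the zero inequality stay below
  \<open>1 / (2 * \<delta>)\<close>. Then \<open>4 * \<delta> < 7/2 * (1 + \<delta> - Re s)\<close>,
  so \<open>1 - Re s \<ge> \<delta> / 7\<close>.\<close>

lemma zeta_reg_zero_free:
  obtains b where "0 < b" "b \<le> 1/16" "\<And>s. Re s \<ge> 1/2 \<Longrightarrow> zeta_reg s = 0 \<Longrightarrow> Re s \<le> 1 - b / ln (\<bar>Im s\<bar> + 3)"
proof -
  obtain \<eta> where \<eta>: "\<eta> > 0" "\<And>s. Re s \<ge> 1/2 \<Longrightarrow> \<bar>Im s\<bar> \<le> 1 \<Longrightarrow> zeta_reg s = 0 \<Longrightarrow> Re s \<le> 1 - \<eta>"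
    by (rule zeta_reg_zero_free_bounded) (rule that)
  obtain B where B: "B \<ge> 1" and ineq: "\<And>\<delta> \<rho>. 0 < \<delta> \<Longrightarrow> \<delta> \<le> 1/16 \<Longrightarrow> zeta_reg \<rho> = 0 \<Longrightarrow> Re \<rho> \<ge> 15/16 \<Longrightarrow>
       4 / (1 + \<delta> - Re \<rho>) \<le> 3 / \<delta> + 5 * (\<delta> / (\<delta>\<^sup>2 + (Im \<rho>)\<^sup>2)) + B * (ln (\<bar>Im \<rho>\<bar> + 3) + ln (1 / \<delta>))"
    by (rule zeta_reg_zero_inequality) (rule that)
  define e where "e = 1 / (32 * B)"
  have e: "0 < e" "e \<le> 1/32" using B by (auto simp: e_def field_simps)
  define b where "b = min (1/16) (min (e\<^sup>2 / 7) \<eta>)"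
  have b: "0 < b" "b \<le> 1/16" "b \<le> e\<^sup>2 / 7" "b \<le> \<eta>" using e \<eta> by (auto simp: b_def)
  have "Re s \<le> 1 - b / ln (\<bar>Im s\<bar> + 3)" if s: "Re s \<ge> 1/2" "zeta_reg s = 0" for s
  proof -
    define M where "M = ln (\<bar>Im s\<bar> + 3)"
    have M: "M \<ge> 1" unfolding M_def by (rule ln_ge_1) auto
    have bM: "b / M \<le> b" using M b by (simp add: divide_le_eq)
    consider "\<bar>Im s\<bar> \<le> 1" | "Re s < 15/16" | "\<bar>Im s\<bar> > 1" "Re s \<ge> 15/16" by linarith
    then have "Re s \<le> 1 - b / M"
    proof cases
      case 1 then show ?thesis using \<eta>(2)[OF s(1) _ s(2)] b bM by linarith
    next
      case 2 then show ?thesis using b bM by linarith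
    next
      case 3
      \<comment> \<open>The square matters: \<open>ln (1 / \<delta>)\<close> costs only a factor
        \<open>1 / e\<close>, whereas \<open>1 / \<delta>\<close> gains
        \<open>1 / e\<^sup>2\<close>. The error is at most
        \<open>B * (5 * M / e) = 5 * B * e / \<delta>\<close>, and \<open>e = 1 / (32 * B)\<close>
        makes it \<open>5/32 * (1 / \<delta>)\<close>.\<close>
      define \<delta> where "\<delta> = e\<^sup>2 / M"
      have e2: "e\<^sup>2 \<le> 1/16" using e power_mono[of e "1/32" 2] by (simp add: power2_eq_square)
      have \<delta>: "0 < \<delta>" "\<delta> \<le> 1/16" using e M e2 by (auto simp: \<delta>_def divide_le_eq)
      have i: "4 / (1 + \<delta> - Re s) \<le> 3 / \<delta> + 5 * (\<delta> / (\<delta>\<^sup>2 + (Im s)\<^sup>2)) + B * (M + ln (1 / \<delta>))"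
        unfolding M_def by (rule ineq[OF \<delta> s(2) 3(2)])
      have s1: "Re s \<le> 1" using zeta_reg_nonzero[of s] s by force
      have im: "(Im s)\<^sup>2 \<ge> 1" using 3(1) power_mono[of 1 "\<bar>Im s\<bar>" 2] by simp
      have "\<delta> / (\<delta>\<^sup>2 + (Im s)\<^sup>2) \<le> \<delta> / 1"
        by (rule frac_le) (use im \<delta> in \<open>auto intro: add_increasing\<close>)
      then have k1: "5 * (\<delta> / (\<delta>\<^sup>2 + (Im s)\<^sup>2)) \<le> B * M"
        using \<delta> mult_mono[of 1 B 1 M] B M by simp
      have "ln (1 / \<delta>) = ln M + 2 * ln (1 / e)"
        using e M by (simp add: \<delta>_def ln_div ln_realpow)
      also have "\<dots> \<le> M + 2 * (1 / e)"
        using ln_bound[of M] ln_bound[of "1 / e"] M e by (intro add_mono mult_left_mono) auto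
      also have "2 * (1 / e) \<le> 2 * M / e" using M e by (simp add: divide_right_mono)
      finally have l: "ln (1 / \<delta>) \<le> M + 2 * M / e" by simp
      have "M + (M + ln (1 / \<delta>)) \<le> 5 * M / e"
      proof -
        have "M \<le> M / e" using e M by (simp add: le_divide_eq)
        then show ?thesis using l by (simp add: add_divide_distrib)
      qed
      then have "B * (M + (M + ln (1 / \<delta>))) \<le> B * (5 * M / e)"
        using B by (intro mult_left_mono) auto
      then have "B * M + B * (M + ln (1 / \<delta>)) \<le> B * (5 * M / e)"
        by (simp only: distrib_left)
      also have "\<dots> = 5/32 * (1 / \<delta>)" using B e M by (simp add: \<delta>_def power2_eq_square) (simp add: e_def field_simps)
      finally have "4 / (1 + \<delta> - Re s) \<le> 3 / \<delta> + 5/32 * (1 / \<delta>)" using i k1 by linarith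
      also have "\<dots> < 7/2 / \<delta>" using \<delta> by (simp add: field_simps)
      finally have "4 * \<delta> < 7/2 * (1 + \<delta> - Re s)" using \<delta> s1 by (simp add: divide_simps mult_ac)
      then have "\<delta> / 7 \<le> 1 - Re s" by simp
      moreover have "b / M \<le> (e\<^sup>2 / 7) / M" by (rule divide_right_mono[OF b(3)]) (use M in simp)
      then have "b / M \<le> \<delta> / 7" by (simp add: \<delta>_def)
      ultimately show ?thesis by simp
    qed
    then show ?thesis by (simp add: M_def)
  qed
  then show thesis using that[OF b(1,2)] by blast
qed

text \<open>With \<open>b\<close> from the zero-free region and
  \<open>\<eta> = b / ln (T + 6)\<close>, the disc of radius \<open>2 * \<eta>\<close> about
  \<open>Complex (1 + \<eta>) (Im s)\<close> stays to the right of \<open>1 - \<eta>\<close> and so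
  contains no zero. Points with \<open>\<bar>Re s - 1\<bar> \<le> \<eta> / 2\<close> lie within
  three quarters of its radius, which is why \<open>b\<close> is halved at the end. One logarithm
  comes from the growth, the other from \<open>1 / \<eta>\<close>.\<close>

lemma zeta_reg_log_deriv_bound:
  obtains b C where "0 < b" "b \<le> 1/4" "C > 0"
    "\<And>T s. T \<ge> 1 \<Longrightarrow> \<bar>Im s\<bar> \<le> T \<Longrightarrow> \<bar>Re s - 1\<bar> \<le> b / ln (T + 6) \<Longrightarrow>
       zeta_reg s \<noteq> 0 \<and> norm (deriv zeta_reg s / zeta_reg s) \<le> C * (ln (T + 6))\<^sup>2"
proof -
  obtain b where b: "0 < b" "b \<le> 1/16" "\<And>s. Re s \<ge> 1/2 \<Longrightarrow> zeta_reg s = 0 \<Longrightarrow> Re s \<le> 1 - b / ln (\<bar>Im s\<bar> + 3)"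
    by (rule zeta_reg_zero_free) (rule that)
  obtain A where A: "A > 0" "\<And>s. 1/2 \<le> Re s \<Longrightarrow> Re s \<le> 3 \<Longrightarrow> norm (zeta_reg s) \<le> A * (\<bar>Im s\<bar> + 3)\<^sup>2"
    by (rule norm_zeta_reg_le) (rule that)
  obtain c where c: "c > 0" "\<And>s. 1 < Re s \<Longrightarrow> Re s \<le> 2 \<Longrightarrow> c * norm (s - 1) * (Re s - 1) \<le> norm (zeta_reg s)"
    by (rule norm_zeta_reg_ge) (rule that)
  define D where "D = \<bar>ln (2 * A / c)\<bar> + 4 + 2 * ln (1 / b)"
  have D: "D > 0" using b by (simp add: D_def add_pos_nonneg)
  define C where "C = 56 * D / b"
  have main: "zeta_reg s \<noteq> 0 \<and> norm (deriv zeta_reg s / zeta_reg s) \<le> C * (ln (T + 6))\<^sup>2"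
    if T: "T \<ge> 1" and im: "\<bar>Im s\<bar> \<le> T" and re: "\<bar>Re s - 1\<bar> \<le> (b / 2) / ln (T + 6)" for T s
  proof -
    define l where "l = ln (T + 6)"
    have l: "l \<ge> 1" unfolding l_def using T by (intro ln_ge_1) auto
    define \<eta> where "\<eta> = b / l"
    have \<eta>: "0 < \<eta>" "\<eta> \<le> 1/16" using b l by (auto simp: \<eta>_def divide_le_eq intro: order_trans[OF b(2)])
    define s1 where "s1 = Complex (1 + \<eta>) (Im s)"
    have re': "\<bar>Re s - 1\<bar> \<le> \<eta> / 2" using re by (simp add: \<eta>_def l_def)
    have inb: "1 - \<eta> < Re z" "Re z \<le> 3" "\<bar>Im z\<bar> + 3 \<le> T + 6" if "z \<in> ball s1 (2 * \<eta>)" for z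
    proof -
      have "norm (z - s1) < 2 * \<eta>" using that by (simp add: dist_norm norm_minus_commute)
      then have "\<bar>Re (z - s1)\<bar> < 2 * \<eta>" "\<bar>Im (z - s1)\<bar> < 2 * \<eta>"
        using abs_Re_le_cmod[of "z - s1"] abs_Im_le_cmod[of "z - s1"] by linarith+
      then have "\<bar>Re z - (1 + \<eta>)\<bar> < 2 * \<eta>" "\<bar>Im z - Im s\<bar> < 2 * \<eta>" by (simp_all add: s1_def)
      then show "1 - \<eta> < Re z" "Re z \<le> 3" "\<bar>Im z\<bar> + 3 \<le> T + 6" using \<eta> im by linarith+
    qed
    have nz: "zeta_reg z \<noteq> 0" if z: "z \<in> ball s1 (2 * \<eta>)" for z
    proof
      assume 0: "zeta_reg z = 0"
      have "Re z \<ge> 1/2" using inb(1)[OF z] \<eta> by linarith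
      then have "Re z \<le> 1 - b / ln (\<bar>Im z\<bar> + 3)" using b(3) 0 by blast
      moreover have "b / l \<le> b / ln (\<bar>Im z\<bar> + 3)"
      proof (rule divide_left_mono)
        show "ln (\<bar>Im z\<bar> + 3) \<le> l" unfolding l_def using inb(3)[OF z] by (subst ln_le_cancel_iff) auto
        have "1 \<le> ln (\<bar>Im z\<bar> + 3)" by (rule ln_ge_1) auto
        then show "0 < l * ln (\<bar>Im z\<bar> + 3)" using l by (intro mult_pos_pos) linarith+
      qed (use b in simp)
      ultimately show False using inb(1)[OF z] by (simp add: \<eta>_def)
    qed
    have ss1: "norm (s - s1) \<le> 3/4 * (2 * \<eta>)"
    proof -
      have "s - s1 = of_real (Re s - (1 + \<eta>))" by (simp add: s1_def complex_eq_iff)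
      then have "norm (s - s1) = \<bar>Re s - (1 + \<eta>)\<bar>" by (simp only: norm_of_real)
      then show ?thesis using re' \<eta> by linarith
    qed
    then have sin: "s \<in> ball s1 (2 * \<eta>)" using \<eta> by (simp add: dist_norm norm_minus_commute)
    define X where "X = 2 * A * (T + 6)\<^sup>2 / (c * \<eta>\<^sup>2)"
    have X: "X > 0" using A c \<eta> T by (simp add: X_def)
    have Gs1: "c * \<eta>\<^sup>2 \<le> norm (zeta_reg s1)"
    proof -
      have "c * \<eta> * \<eta> \<le> c * norm (s1 - 1) * \<eta>"
        using c \<eta> abs_Re_le_cmod[of "s1 - 1"] by (intro mult_right_mono mult_left_mono) (auto simp: s1_def)
      also have "\<dots> \<le> norm (zeta_reg s1)" using c(2)[of s1] \<eta> by (simp add: s1_def)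
      finally show ?thesis by (simp add: power2_eq_square mult.assoc)
    qed
    have "norm (deriv zeta_reg s / zeta_reg s) \<le> 112 * ln X / (2 * \<eta>)"
    proof (rule log_deriv_bound[OF _ nz _ ss1])
      show "zeta_reg holomorphic_on ball s1 (2 * \<eta>)"
        by (rule holomorphic_on_subset[OF zeta_reg_holomorphic]) (use inb(1) \<eta> in force)
      show "norm (zeta_reg z) < exp (ln X) * norm (zeta_reg s1)" if z: "z \<in> ball s1 (2 * \<eta>)" for z
      proof -
        have "norm (zeta_reg z) \<le> A * (\<bar>Im z\<bar> + 3)\<^sup>2" using inb[OF z] \<eta> by (intro A(2)) linarith+
        also have "\<dots> \<le> A * (T + 6)\<^sup>2" using inb(3)[OF z] A(1) by (intro mult_left_mono power_mono) auto
        also have "\<dots> < 2 * A * (T + 6)\<^sup>2" using A(1) T by simp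
        also have "\<dots> = X * (c * \<eta>\<^sup>2)" using c \<eta> by (simp add: X_def)
        also have "\<dots> \<le> X * norm (zeta_reg s1)" using Gs1 X by (intro mult_left_mono) auto
        finally show ?thesis using X by simp
      qed
    qed (use \<eta> in auto)
    also have "ln X \<le> D * l"
    proof -
      have "X = (2 * A / c) * ((T + 6)\<^sup>2 * (l * (1 / b))\<^sup>2)" using l b by (simp add: X_def \<eta>_def power_divide power_mult_distrib)
      then have "ln X = ln (2 * A / c) + (2 * ln (T + 6) + 2 * ln (l * (1 / b)))"
        using A(1) c(1) l b(1) T by (simp only:) (rule ln_mult_squares, auto)
      also have "ln (l * (1 / b)) = ln l + ln (1 / b)" using l b(1) by (intro ln_mult_pos) auto
      also have "ln (T + 6) = l" by (simp add: l_def)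
      also have "ln (2 * A / c) + (2 * l + 2 * (ln l + ln (1 / b))) \<le> \<bar>ln (2 * A / c)\<bar> * l + (2 * l + 2 * (l + ln (1 / b) * l))"
      proof (intro add_mono mult_left_mono order_refl)
        show "ln (2 * A / c) \<le> \<bar>ln (2 * A / c)\<bar> * l" using mult_left_mono[OF l, of "\<bar>ln (2 * A / c)\<bar>"] by simp
        show "ln l \<le> l" using ln_bound[of l] l by simp
        show "ln (1 / b) \<le> ln (1 / b) * l" using mult_left_mono[OF l, of "ln (1 / b)"] b by simp
      qed auto
      also have "\<dots> = D * l" by (simp add: D_def algebra_simps)
      finally show ?thesis .
    qed
    then have "112 * ln X / (2 * \<eta>) \<le> 112 * (D * l) / (2 * \<eta>)" using \<eta> by (intro divide_right_mono mult_left_mono) auto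
    also have "\<dots> = C * l\<^sup>2" using l b by (simp add: C_def \<eta>_def power2_eq_square)
    finally show ?thesis using nz[OF sin] by (simp add: l_def)
  qed
  show thesis
  proof (rule that)
    show "0 < b / 2" "b / 2 \<le> 1/4" using b by auto
    show "C > 0" using b(1) D by (simp add: C_def)
  qed (rule main)
qed

section \<open>Perron's formula\<close>

text \<open>Both ways of shifting a vertical segment: the right side is replaced by the three
  others, or the left side is. \<open>B\<close> belongs to the horizontal sides, \<open>B'\<close>
  to the opposite vertical one; the sign of \<open>I\<close> reflects the orientation.\<close>

lemma rectangle_integral_estimates:
  fixes f :: "complex \<Rightarrow> complex"
  assumes c: "c1 < c2" and T: "T > 0"
    and cont: "continuous_on (path_image (rectpath (Complex c1 (-T)) (Complex c2 T))) f"
    and I: "(f has_contour_integral I) (rectpath (Complex c1 (-T)) (Complex c2 T))"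
    and h: "\<And>z. \<bar>Im z\<bar> = T \<Longrightarrow> c1 \<le> Re z \<Longrightarrow> Re z \<le> c2 \<Longrightarrow> norm (f z) \<le> B"
    and B: "B \<ge> 0" "B' \<ge> 0"
  shows "(\<And>z. Re z = c1 \<Longrightarrow> \<bar>Im z\<bar> \<le> T \<Longrightarrow> norm (f z) \<le> B') \<Longrightarrow>
           norm (contour_integral (linepath (Complex c2 (-T)) (Complex c2 T)) f - I) \<le> 2 * (c2 - c1) * B + 2 * T * B'"
    "(\<And>z. Re z = c2 \<Longrightarrow> \<bar>Im z\<bar> \<le> T \<Longrightarrow> norm (f z) \<le> B') \<Longrightarrow>
           norm (contour_integral (linepath (Complex c1 (-T)) (Complex c1 T)) f + I) \<le> 2 * (c2 - c1) * B + 2 * T * B'"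
proof -
  let ?a = "Complex c1 (-T)" and ?b = "Complex c2 (-T)" and ?c = "Complex c2 T" and ?d = "Complex c1 T"
  have pi: "path_image (rectpath ?a ?c) =
      closed_segment ?a ?b \<union> closed_segment ?b ?c \<union> closed_segment ?c ?d \<union> closed_segment ?d ?a"
    by (simp add: rectpath_def Let_def path_image_join Un_assoc)
  have conts: "continuous_on (closed_segment ?a ?b) f" "continuous_on (closed_segment ?b ?c) f"
    "continuous_on (closed_segment ?c ?d) f" "continuous_on (closed_segment ?d ?a) f"
    by (rule continuous_on_subset[OF cont]; simp add: pi; blast)+
  note ci = conts[THEN contour_integrable_continuous_linepath]
  have "contour_integral (rectpath ?a ?c) f = contour_integral (linepath ?a ?b) f +
      (contour_integral (linepath ?b ?c) f + (contour_integral (linepath ?c ?d) f + contour_integral (linepath ?d ?a) f))"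
    using ci by (simp add: rectpath_def Let_def contour_integrable_joinI)
  also have "contour_integral (linepath ?d ?a) f = - contour_integral (linepath ?a ?d) f"
    by (rule contour_integral_reverse_linepath[OF conts(4)])
  finally have eq: "I = contour_integral (linepath ?a ?b) f +
      (contour_integral (linepath ?b ?c) f + (contour_integral (linepath ?c ?d) f - contour_integral (linepath ?a ?d) f))"
    using contour_integral_unique[OF I] by simp
  have "norm (contour_integral (linepath ?a ?b) f) \<le> B * norm (?b - ?a)"
    using c by (intro contour_integral_bound_linepath ci B h)
      (use T in \<open>auto simp: closed_segment_same_Im closed_segment_eq_real_ivl\<close>)
  also have "norm (?b - ?a) = c2 - c1" using c by (simp add: cmod_def)
  finally have 1: "norm (contour_integral (linepath ?a ?b) f) \<le> (c2 - c1) * B" by (simp add: mult_ac)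
  have "norm (contour_integral (linepath ?c ?d) f) \<le> B * norm (?d - ?c)"
    using c by (intro contour_integral_bound_linepath ci B h)
      (use T in \<open>auto simp: closed_segment_same_Im closed_segment_eq_real_ivl\<close>)
  also have "norm (?d - ?c) = c2 - c1" using c by (simp add: cmod_def)
  finally have 2: "norm (contour_integral (linepath ?c ?d) f) \<le> (c2 - c1) * B" by (simp add: mult_ac)
  {
    assume left: "\<And>z. Re z = c1 \<Longrightarrow> \<bar>Im z\<bar> \<le> T \<Longrightarrow> norm (f z) \<le> B'"
    have "norm (contour_integral (linepath ?d ?a) f) \<le> B' * norm (?a - ?d)"
      by (intro contour_integral_bound_linepath ci B left)
        (use T in \<open>auto simp: closed_segment_same_Re closed_segment_eq_real_ivl\<close>)
    also have "norm (?a - ?d) = 2 * T" using T by (simp add: cmod_def real_sqrt_mult)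
    also have "contour_integral (linepath ?d ?a) f = - contour_integral (linepath ?a ?d) f"
      by (rule contour_integral_reverse_linepath[OF conts(4)])
    finally have 3: "norm (contour_integral (linepath ?a ?d) f) \<le> 2 * T * B'" by (simp add: mult_ac)
    have "contour_integral (linepath ?b ?c) f - I =
        contour_integral (linepath ?a ?d) f - (contour_integral (linepath ?a ?b) f + contour_integral (linepath ?c ?d) f)"
      unfolding eq by simp
    also have "norm \<dots> \<le> 2 * T * B' + ((c2 - c1) * B + (c2 - c1) * B)"
      by (intro norm_triangle_le_diff add_mono 1 2 3 norm_triangle_mono)
    finally show "norm (contour_integral (linepath ?b ?c) f - I) \<le> 2 * (c2 - c1) * B + 2 * T * B'"
      by (simp add: algebra_simps)
  next
    assume right: "\<And>z. Re z = c2 \<Longrightarrow> \<bar>Im z\<bar> \<le> T \<Longrightarrow> norm (f z) \<le> B'"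
    have "norm (contour_integral (linepath ?b ?c) f) \<le> B' * norm (?c - ?b)"
      by (intro contour_integral_bound_linepath ci B right)
        (use T in \<open>auto simp: closed_segment_same_Re closed_segment_eq_real_ivl\<close>)
    also have "norm (?c - ?b) = 2 * T" using T by (simp add: cmod_def real_sqrt_mult)
    finally have 3: "norm (contour_integral (linepath ?b ?c) f) \<le> 2 * T * B'" by (simp add: mult_ac)
    have "contour_integral (linepath ?a ?d) f + I =
        contour_integral (linepath ?b ?c) f + (contour_integral (linepath ?a ?b) f + contour_integral (linepath ?c ?d) f)"
      unfolding eq by simp
    also have "norm \<dots> \<le> 2 * T * B' + ((c2 - c1) * B + (c2 - c1) * B)"
      by (intro norm_triangle_mono 1 2 3)
    finally show "norm (contour_integral (linepath ?a ?d) f + I) \<le> 2 * (c2 - c1) * B + 2 * T * B'"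
      by (simp add: algebra_simps)
  }
qed

abbreviation Perron_kernel :: "real \<Rightarrow> complex \<Rightarrow> complex" where
  "Perron_kernel y s \<equiv> of_real y powr s / (s * (s + 1))"

lemma norm_kernel_le:
  fixes s :: complex
  assumes "y > 0" "norm s \<ge> T" "norm (s + 1) \<ge> T" "T > 0" "y powr Re s \<le> y powr c"
  shows "norm (Perron_kernel y s) \<le> y powr c / T\<^sup>2"
  unfolding norm_divide norm_mult power2_eq_square
  using assms by (intro frac_le mult_mono) (auto simp: norm_of_real_powr)

text \<open>For \<open>y \<le> 1\<close> the power decays to the right, where there is no pole.
  Extending the rectangle by exactly \<open>T\<close> keeps \<open>norm s \<ge> T\<close> on its
  three other sides, whose total length is \<open>4 * T\<close>.\<close>

lemma Perron_kernel_small: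
  assumes y: "0 < y" "y \<le> 1" and c: "c > 0" and T: "T > 0"
  shows "norm (contour_integral (linepath (Complex c (-T)) (Complex c T)) (\<lambda>s. Perron_kernel y s))
     \<le> 4 * y powr c / T"
proof -
  let ?f = "\<lambda>s::complex. Perron_kernel y s"
  let ?g = "rectpath (Complex c (-T)) (Complex (c + T) T)"
  have nz: "s \<noteq> 0" "s + 1 \<noteq> 0" if "Re s > 0" for s using that by (auto simp: complex_eq_iff)
  have hol: "?f holomorphic_on {s. Re s > 0}"
    using nz y by (intro holomorphic_intros) auto
  have sub: "path_image ?g \<subseteq> {s. Re s > 0}"
    using path_image_rectpath_subset_cbox[of "Complex c (-T)" "Complex (c + T) T"] c T by (auto simp: in_cbox_complex_iff)
  have I: "(?f has_contour_integral 0) ?g"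
    by (rule Cauchy_theorem_convex_simple[OF hol]) (use sub in \<open>auto simp: convex_halfspace_Re_gt\<close>)
  have mono: "y powr Re z \<le> y powr c" if "c \<le> Re z" for z using that y by (intro powr_mono') auto
  have "norm (contour_integral (linepath (Complex c (-T)) (Complex c T)) ?f + 0) \<le>
     2 * (c + T - c) * (y powr c / T\<^sup>2) + 2 * T * (y powr c / T\<^sup>2)"
  proof (rule rectangle_integral_estimates(2)[OF _ T _ I])
    show "continuous_on (path_image ?g) ?f"
      by (rule holomorphic_on_imp_continuous_on[OF holomorphic_on_subset[OF hol sub]])
    show "norm (?f z) \<le> y powr c / T\<^sup>2" if "\<bar>Im z\<bar> = T" "c \<le> Re z" for z
      using that y T abs_Im_le_cmod[of z] abs_Im_le_cmod[of "z + 1"] mono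
      by (intro norm_kernel_le) auto
    show "norm (?f z) \<le> y powr c / T\<^sup>2" if "Re z = c + T" for z
      using that y T c abs_Re_le_cmod[of z] abs_Re_le_cmod[of "z + 1"] mono[of z]
      by (intro norm_kernel_le) auto
  qed (use T in auto)
  also have "\<dots> = 4 * y powr c / T" using T by (simp add: power2_eq_square)
  finally show ?thesis by simp
qed

text \<open>For \<open>y \<ge> 1\<close> the contour is closed to the left around the poles 0 and
  -1, with residues 1 and \<open>- 1 / y\<close>. The left side is at \<open>- T - 1\<close>, so
  that \<open>norm (s + 1) \<ge> T\<close> holds there too; the three other sides have total length
  at most \<open>10 * T\<close>.\<close>

lemma Perron_kernel_large:
  assumes y: "y \<ge> 1" and c: "0 < c" "c \<le> 2" and T: "T \<ge> 1"
  shows "norm (contour_integral (linepath (Complex c (-T)) (Complex c T)) (\<lambda>s. Perron_kernel y s)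
      - 2 * of_real pi * \<i> * of_real (1 - 1 / y)) \<le> 10 * y powr c / T"
proof -
  let ?f = "\<lambda>s::complex. Perron_kernel y s"
  let ?g = "rectpath (Complex (-T - 1) (-T)) (Complex c T)"
  have pi: "path_image ?g = cbox (Complex (-T - 1) (-T)) (Complex c T) - box (Complex (-T - 1) (-T)) (Complex c T)"
    using c T by (intro path_image_rectpath_cbox_minus_box) auto
  have inb: "0 \<in> box (Complex (-T - 1) (-T)) (Complex c T)" "-1 \<in> box (Complex (-T - 1) (-T)) (Complex c T)"
    using c T by (auto simp: in_box_complex_iff)
  then have nz: "0 \<notin> path_image ?g" "-1 \<notin> path_image ?g" by (auto simp: pi)
  have h: "(\<lambda>s::complex. of_real y powr s) holomorphic_on UNIV" using y by (intro holomorphic_intros) auto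
  have sub: "path_image ?g \<subseteq> UNIV - {0}" "path_image ?g \<subseteq> UNIV - {-1}" using nz by auto
  \<comment> \<open>Partial fractions: Cauchy's integral formula is applied to the two simple poles
    separately, with the entire function \<open>of_real y powr s\<close> as numerator.\<close>
  have "((\<lambda>s. of_real y powr s / (s - 0)) has_contour_integral (2 * of_real pi * \<i> * winding_number ?g 0 * of_real y powr 0)) ?g"
    using Cauchy_integral_formula_convex_simple[OF _ h _ _ sub(1)]
    by (simp only: convex_UNIV interior_UNIV UNIV_I valid_path_rectpath pathstart_rectpath pathfinish_rectpath of_real_mult of_real_numeral)
  moreover have "((\<lambda>s. of_real y powr s / (s - (-1))) has_contour_integral (2 * of_real pi * \<i> * winding_number ?g (-1) * of_real y powr (-1))) ?g"
    using Cauchy_integral_formula_convex_simple[OF _ h _ _ sub(2)]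
    by (simp only: convex_UNIV interior_UNIV UNIV_I valid_path_rectpath pathstart_rectpath pathfinish_rectpath of_real_mult of_real_numeral)
  ultimately have "((\<lambda>s. of_real y powr s / (s - 0) - of_real y powr s / (s - (-1))) has_contour_integral
     (2 * of_real pi * \<i> * winding_number ?g 0 * of_real y powr 0 - 2 * of_real pi * \<i> * winding_number ?g (-1) * of_real y powr (-1))) ?g"
    by (rule has_contour_integral_diff)
  also have "winding_number ?g 0 = 1" by (rule winding_number_rectpath[OF inb(1)])
  also have "winding_number ?g (-1) = 1" by (rule winding_number_rectpath[OF inb(2)])
  also have "2 * of_real pi * \<i> * 1 * of_real y powr 0 - 2 * of_real pi * \<i> * 1 * of_real y powr (-1) = 2 * of_real pi * \<i> * of_real (1 - 1 / y)"
    using y by (simp add: powr_minus field_simps)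
  finally have "((\<lambda>s. of_real y powr s / (s - 0) - of_real y powr s / (s - (-1))) has_contour_integral 2 * of_real pi * \<i> * of_real (1 - 1 / y)) ?g" .
  then have I: "(?f has_contour_integral 2 * of_real pi * \<i> * of_real (1 - 1 / y)) ?g"
  proof (rule has_contour_integral_eq)
    fix x assume "x \<in> path_image ?g"
    then have "x \<noteq> 0" "x \<noteq> -1" using nz by auto
    then have "x \<noteq> 0" "x + 1 \<noteq> 0" by (auto simp: add_eq_0_iff2)
    then show "of_real y powr x / (x - 0) - of_real y powr x / (x - (-1)) = ?f x"
      by (simp add: field_simps)
  qed
  have mono: "y powr Re z \<le> y powr c" if "Re z \<le> c" for z using that y by (intro powr_mono) auto
  have "norm (contour_integral (linepath (Complex c (-T)) (Complex c T)) ?f - 2 * of_real pi * \<i> * of_real (1 - 1 / y)) \<le>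
     2 * (c - (-T - 1)) * (y powr c / T\<^sup>2) + 2 * T * (y powr c / T\<^sup>2)"
  proof (rule rectangle_integral_estimates(1)[OF _ _ _ I])
    show "continuous_on (path_image ?g) ?f"
    proof (rule continuous_on_divide)
      show "continuous_on (path_image ?g) (\<lambda>s. s * (s + 1))" by (intro continuous_intros)
      show "continuous_on (path_image ?g) (\<lambda>s. of_real y powr s)"
        by (rule continuous_on_subset[OF holomorphic_on_imp_continuous_on[OF h]]) simp
      show "\<forall>s\<in>path_image ?g. s * (s + 1) \<noteq> 0" using nz by (auto simp: add_eq_0_iff2)
    qed
    show "norm (?f z) \<le> y powr c / T\<^sup>2" if "\<bar>Im z\<bar> = T" "Re z \<le> c" for z
      using that y T abs_Im_le_cmod[of z] abs_Im_le_cmod[of "z + 1"] mono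
      by (intro norm_kernel_le) auto
    show "norm (?f z) \<le> y powr c / T\<^sup>2" if "Re z = -T - 1" for z
      using that y T c abs_Re_le_cmod[of z] abs_Re_le_cmod[of "z + 1"] mono[of z]
      by (intro norm_kernel_le) auto
  qed (use T c in auto)
  also have "\<dots> \<le> 2 * (4 * T) * (y powr c / T\<^sup>2) + 2 * T * (y powr c / T\<^sup>2)"
    using T c by (intro add_mono mult_right_mono) auto
  also have "\<dots> = 10 * y powr c / T" using T by (simp add: power2_eq_square)
  finally show ?thesis by simp
qed

lemma Perron_kernel_integral:
  assumes y: "y > 0" and c: "0 < c" "c \<le> 2" and T: "T \<ge> 1"
  shows "norm (contour_integral (linepath (Complex c (-T)) (Complex c T)) (\<lambda>s. Perron_kernel y s)
      - 2 * of_real pi * \<i> * of_real (max 0 (1 - 1 / y))) \<le> 10 * y powr c / T"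
proof (cases "y \<ge> 1")
  case True
  then have "max 0 (1 - 1 / y) = 1 - 1 / y" by (simp add: max_def)
  then show ?thesis using Perron_kernel_large[OF True c T] by simp
next
  case False
  then have "max 0 (1 - 1 / y) = 0" using y by (simp add: max_def divide_simps)
  moreover have "4 * y powr c / T \<le> 10 * y powr c / T" using T by (intro divide_right_mono) auto
  ultimately show ?thesis using Perron_kernel_small[of y c T] False y c T by simp
qed

lemma of_real_powr_eq_exp: "x > 0 \<Longrightarrow> of_real x powr s = exp (s * of_real (ln x) :: complex)"
  by (simp add: powr_def Ln_of_real)

text \<open>Sum and integral are interchanged by uniform convergence on the segment, and each
  coefficient meets the kernel integral at \<open>x / n\<close>. The errors
  \<open>10 * (x / n) powr c / T\<close> add up to the series of absolute values at
  \<open>c\<close>, with no loss for \<open>n\<close> near \<open>x\<close>.\<close>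

lemma Perron_truncated:
  assumes a: "abs_conv a" and x: "x \<ge> 1" and c: "1 < c" "c \<le> 2" and T: "T \<ge> 1"
  shows "norm (contour_integral (linepath (Complex c (-T)) (Complex c T)) (\<lambda>s. dirichlet a s * Perron_kernel x s)
      - 2 * of_real pi * \<i> * of_real (\<Sum>n=1..nat \<lfloor>x\<rfloor>. a n * (1 - real n / x)))
      \<le> 10 * x powr c / T * (\<Sum>n. \<bar>a n\<bar> * real n powr (-c))"
proof -
  let ?l = "linepath (Complex c (-T)) (Complex c T)"
  define f where "f = (\<lambda>n (s::complex). (of_real (a n) * of_nat n powr (-s)) * Perron_kernel x s)"
  have Re: "Re s = c" if "s \<in> path_image ?l" for s
    using that T by (auto simp: closed_segment_same_Re)
  have ker: "norm (Perron_kernel x s) \<le> x powr c" if "s \<in> path_image ?l" for s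
  proof -
    have "norm (Perron_kernel x s) \<le> x powr c / 1\<^sup>2"
      using x c Re[OF that] abs_Re_le_cmod[of s] abs_Re_le_cmod[of "s + 1"] by (intro norm_kernel_le) auto
    then show ?thesis by simp
  qed
  have sm: "summable (\<lambda>n. \<bar>a n\<bar> * real n powr (-c))" using a c by (simp add: abs_conv_def)
  have ul: "uniform_limit (path_image ?l) (\<lambda>N s. \<Sum>n<N. f n s) (\<lambda>s. suminf (\<lambda>n. f n s)) sequentially"
  proof (rule Weierstrass_m_test)
    show "summable (\<lambda>n. \<bar>a n\<bar> * real n powr (-c) * x powr c)" using sm by (rule summable_mult2)
    show "norm (f n s) \<le> \<bar>a n\<bar> * real n powr (-c) * x powr c" if "s \<in> path_image ?l" for n s
      unfolding f_def norm_mult[of "_ * _"] using ker[OF that] Re[OF that]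
      by (intro mult_mono) (auto simp: norm_mult norm_nat_powr)
  qed
  have sf: "suminf (\<lambda>n. f n s) = dirichlet a s * Perron_kernel x s" if "s \<in> path_image ?l" for s
    unfolding f_def dirichlet_def
    using Re[OF that] c by (intro suminf_mult2[symmetric] summable_norm_cancel[OF dirichlet_abs_summable[OF a]]) auto
  have contf: "continuous_on (path_image ?l) (f n)" for n
  proof -
    have "f n holomorphic_on {s. Re s > 0}"
    proof -
      have "s \<noteq> 0" "s + 1 \<noteq> 0" if "Re s > 0" for s :: complex using that by (auto simp: complex_eq_iff)
      then show ?thesis unfolding f_def using x by (cases "n = 0") (auto intro!: holomorphic_intros)
    qed
    then show ?thesis
      by (intro holomorphic_on_imp_continuous_on) (erule holomorphic_on_subset, use Re c in auto)
  qed
  then have ci: "f n contour_integrable_on ?l" for n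
    by (intro contour_integrable_continuous_linepath) simp
  have "(\<lambda>N. contour_integral ?l (\<lambda>s. \<Sum>n<N. f n s)) \<longlonglongrightarrow> contour_integral ?l (\<lambda>s. suminf (\<lambda>n. f n s))"
  proof (rule contour_integral_uniform_limit(2)[OF _ ul])
    show "\<forall>\<^sub>F N in sequentially. (\<lambda>s. \<Sum>n<N. f n s) contour_integrable_on ?l"
      using ci by (intro always_eventually allI contour_integrable_sum) auto
    show "norm (vector_derivative ?l (at t)) \<le> norm (Complex c T - Complex c (-T))" for t
      by simp
  qed auto
  also have "contour_integral ?l (\<lambda>s. suminf (\<lambda>n. f n s)) = contour_integral ?l (\<lambda>s. dirichlet a s * Perron_kernel x s)"
    by (rule contour_integral_eq) (rule sf)
  finally have lim: "(\<lambda>N. contour_integral ?l (\<lambda>s. \<Sum>n<N. f n s)) \<longlonglongrightarrow> contour_integral ?l (\<lambda>s. dirichlet a s * Perron_kernel x s)" .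
  let ?I = "\<lambda>N. contour_integral ?l (\<lambda>s. \<Sum>n<N. f n s)" and ?B = "10 * x powr c / T * (\<Sum>n. \<bar>a n\<bar> * real n powr (-c))"
  define S where "S = (\<Sum>n=1..nat \<lfloor>x\<rfloor>. a n * (1 - real n / x))"
  have bd: "norm (?I N - 2 * of_real pi * \<i> * of_real S) \<le> ?B"
    if N: "N > nat \<lfloor>x\<rfloor>" for N
  proof -
    \<comment> \<open>The \<open>max\<close> makes the weight vanish for \<open>n \<ge> x\<close>,
      so all partial sums beyond \<open>x\<close> share the same main term.\<close>
    have S: "S = (\<Sum>n\<in>{1..<N}. a n * max 0 (1 - 1 / (x / real n)))"
      unfolding S_def
    proof (rule sum.mono_neutral_cong_left)
      show "\<forall>n\<in>{1..<N} - {1..nat \<lfloor>x\<rfloor>}. a n * max 0 (1 - 1 / (x / real n)) = 0"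
      proof
        fix n assume "n \<in> {1..<N} - {1..nat \<lfloor>x\<rfloor>}"
        then have "real n \<ge> x" "n \<ge> 1" by (auto simp: not_le) linarith
        then show "a n * max 0 (1 - 1 / (x / real n)) = 0" using x by (simp add: max_def divide_simps)
      qed
      show "a n * (1 - real n / x) = a n * max 0 (1 - 1 / (x / real n))" if "n \<in> {1..nat \<lfloor>x\<rfloor>}" for n
      proof -
        have "real n \<le> x" using that x by (simp add: le_nat_iff) linarith
        then show ?thesis using x that by (simp add: max_def divide_simps)
      qed
    qed (use N in auto)
    have fn: "contour_integral ?l (f n) = of_real (a n) * contour_integral ?l (\<lambda>s. Perron_kernel (x / real n) s)" if n: "n \<ge> 1" for n
    proof -
      have e: "f n = (\<lambda>s. of_real (a n) * (Perron_kernel (x / real n) s))"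
      proof
        fix s :: complex
        have "of_real (x / real n) powr s = exp (s * of_real (ln (x / real n)))"
          using n x by (intro of_real_powr_eq_exp) simp
        also have "ln (x / real n) = ln x - ln (real n)" using n x by (intro ln_divide_pos) auto
        also have "exp (s * of_real (ln x - ln (real n))) = exp (s * of_real (ln x)) * exp (-s * of_real (ln (real n)))"
          by (simp add: right_diff_distrib flip: exp_add)
        also have "exp (s * of_real (ln x)) = of_real x powr s"
          using x by (intro of_real_powr_eq_exp[symmetric]) simp
        also have "exp (-s * of_real (ln (real n))) = of_real (real n) powr (-s)"
          using n by (intro of_real_powr_eq_exp[symmetric]) simp
        finally have "of_real (x / real n) powr s = of_real x powr s * (of_nat n powr (-s) :: complex)" by simp
        then show "f n s = of_real (a n) * (Perron_kernel (x / real n) s)" by (simp add: f_def)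
      qed
      show ?thesis
      \<comment> \<open>Integrability of the kernel is recovered from that of \<open>f n\<close> by
        dividing by \<open>a n\<close>.\<close>
      proof (cases "a n = 0")
        case True then show ?thesis by (simp add: e)
      next
        case False
        then have "(\<lambda>s. (1 / of_real (a n)) * f n s) contour_integrable_on ?l"
          by (intro contour_integrable_lmul ci)
        then have "(\<lambda>s. Perron_kernel (x / real n) s) contour_integrable_on ?l"
          using False by (simp add: e)
        then show ?thesis unfolding e by (rule contour_integral_lmul)
      qed
    qed
    have "?I N = (\<Sum>n<N. contour_integral ?l (f n))"
      by (rule contour_integral_sum) (use ci in auto)
    also have "\<dots> = (\<Sum>n\<in>{1..<N}. contour_integral ?l (f n))"
    proof (rule sum.mono_neutral_right)
      have "f 0 = (\<lambda>s. 0)" by (simp add: f_def)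
      then have "contour_integral ?l (f 0) = 0" by simp
      then show "\<forall>n\<in>{..<N} - {1..<N}. contour_integral ?l (f n) = 0" by (auto simp: not_le)
    qed auto
    finally have e1: "?I N = (\<Sum>n\<in>{1..<N}. contour_integral ?l (f n))" .
    have e2: "?I N - 2 * of_real pi * \<i> * of_real S = (\<Sum>n\<in>{1..<N}. of_real (a n) *
        (contour_integral ?l (\<lambda>s. Perron_kernel (x / real n) s) - 2 * of_real pi * \<i> * of_real (max 0 (1 - 1 / (x / real n)))))"
      unfolding e1 S of_real_sum sum_distrib_left sum_subtractf[symmetric]
      by (intro sum.cong refl) (simp only: fn atLeastLessThan_iff of_real_mult, simp add: algebra_simps)
    have "norm (?I N - 2 * of_real pi * \<i> * of_real S) \<le> (\<Sum>n\<in>{1..<N}. \<bar>a n\<bar> * (10 * (x / real n) powr c / T))"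
      unfolding e2
    proof (rule sum_norm_le)
      fix n assume n: "n \<in> {1..<N}"
      have xn: "x / real n > 0" using n x by simp
      have c0: "0 < c" using c by simp
      show "norm (of_real (a n) * (contour_integral ?l (\<lambda>s. Perron_kernel (x / real n) s) - 2 * of_real pi * \<i> * of_real (max 0 (1 - 1 / (x / real n)))))
        \<le> \<bar>a n\<bar> * (10 * (x / real n) powr c / T)"
        by (subst norm_mult, subst norm_of_real, rule mult_left_mono[OF Perron_kernel_integral[OF xn c0 c(2) T] abs_ge_zero])
    qed
    also have "\<dots> = 10 * x powr c / T * (\<Sum>n\<in>{1..<N}. \<bar>a n\<bar> * real n powr (-c))"
      unfolding sum_distrib_left
    proof (rule sum.cong[OF refl])
      fix n
      have "(x / real n) powr c = x powr c * real n powr (-c)"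
        using x by (simp add: powr_divide powr_minus_divide)
      then show "\<bar>a n\<bar> * (10 * (x / real n) powr c / T) = 10 * x powr c / T * (\<bar>a n\<bar> * real n powr (-c))"
        by simp
    qed
    also have "\<dots> \<le> ?B"
      using T by (intro mult_left_mono sum_le_suminf[OF sm]) auto
    finally show ?thesis .
  qed
  have "norm (contour_integral ?l (\<lambda>s. dirichlet a s * Perron_kernel x s) - 2 * of_real pi * \<i> * of_real S)
     \<le> ?B"
  proof (rule Lim_norm_ubound[OF sequentially_bot])
    show "(\<lambda>N. ?I N - 2 * of_real pi * \<i> * of_real S) \<longlonglongrightarrow>
        contour_integral ?l (\<lambda>s. dirichlet a s * Perron_kernel x s) - 2 * of_real pi * \<i> * of_real S"
      by (intro tendsto_diff lim tendsto_const)
    show "\<forall>\<^sub>F N in sequentially. norm (?I N - 2 * of_real pi * \<i> * of_real S) \<le> ?B"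
      using eventually_gt_at_top[of "nat \<lfloor>x\<rfloor>"] by eventually_elim (rule bd)
  qed
  then show ?thesis by (simp only: S_def)
qed

section \<open>Size of the coefficient series just to the right of 1\<close>

lemma zeta_real_le:
  obtains A where "A > 0" "\<And>\<sigma>. 1 < \<sigma> \<Longrightarrow> \<sigma> \<le> 2 \<Longrightarrow> (\<Sum>n. real n powr (-\<sigma>)) \<le> A / (\<sigma> - 1)"
proof -
  obtain A where A: "A > 0" "\<And>s. 1/2 \<le> Re s \<Longrightarrow> Re s \<le> 3 \<Longrightarrow> norm (zeta_reg s) \<le> A * (\<bar>Im s\<bar> + 3)\<^sup>2"
    by (rule norm_zeta_reg_le) (rule that)
  have "(\<Sum>n. real n powr (-\<sigma>)) \<le> (9 * A) / (\<sigma> - 1)" if \<sigma>: "1 < \<sigma>" "\<sigma> \<le> 2" for \<sigma>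
  proof -
    have "zeta (of_real \<sigma>) = of_real (\<Sum>n. real n powr (-\<sigma>))"
      using dirichlet_of_real[OF abs_conv_one \<sigma>(1)] by simp
    moreover have "of_real \<sigma> - 1 = complex_of_real (\<sigma> - 1)" by simp
    ultimately have "zeta_reg (of_real \<sigma>) = of_real ((\<sigma> - 1) * (\<Sum>n. real n powr (-\<sigma>)))"
      using \<sigma> zeta_reg_eq_zeta[of "of_real \<sigma>"] by (simp only: Re_complex_of_real of_real_mult)
    then have "(\<sigma> - 1) * (\<Sum>n. real n powr (-\<sigma>)) \<le> norm (zeta_reg (of_real \<sigma>))" by (simp only: norm_of_real)
    also have "\<dots> \<le> 9 * A" using A(2)[of "of_real \<sigma>"] \<sigma> by simp
    finally show ?thesis using \<sigma> by (simp add: field_simps)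
  qed
  then show thesis using that[of "9 * A"] A(1) by simp
qed

lemma abs_conv_mangoldt_minus_1: "abs_conv (\<lambda>n. mangoldt n - 1)"
  unfolding abs_conv_def
proof (intro allI impI)
  fix \<sigma> :: real assume \<sigma>: "\<sigma> > 1"
  have "summable (\<lambda>n. mangoldt n * real n powr (-\<sigma>) + real n powr (-\<sigma>))"
    using abs_conv_mangoldt abs_conv_one \<sigma> by (intro summable_add) (auto simp: abs_conv_def)
  then show "summable (\<lambda>n. \<bar>mangoldt n - 1\<bar> * real n powr (-\<sigma>))"
  proof (rule summable_comparison_test'[where N = 0])
    fix n
    have "\<bar>mangoldt n - 1\<bar> \<le> mangoldt n + (1::real)" using mangoldt_nonneg[of n] by (simp add: abs_le_iff)
    then show "norm (\<bar>mangoldt n - 1\<bar> * real n powr (-\<sigma>)) \<le> mangoldt n * real n powr (-\<sigma>) + real n powr (-\<sigma>)"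
      using mult_right_mono[of "\<bar>mangoldt n - 1\<bar>" "mangoldt n + 1" "real n powr (-\<sigma>)"] by (simp add: distrib_right)
  qed
qed

text \<open>With \<open>e = (c - 1) / 2\<close>, the logarithm is paid for by
  \<open>n powr e\<close> and the zeta series at \<open>1 + e\<close> remains; each costs a factor
  of order \<open>1 / (c - 1)\<close>. At \<open>c = 1 + 1 / ln x\<close> the bound becomes
  \<open>K * (ln x)\<^sup>2\<close>.\<close>

lemma mangoldt_minus_1_sum_le:
  obtains K where "K > 0" "\<And>c. 1 < c \<Longrightarrow> c \<le> 2 \<Longrightarrow> (\<Sum>n. \<bar>mangoldt n - 1\<bar> * real n powr (-c)) \<le> K / (c - 1)\<^sup>2"
proof -
  obtain A where A: "A > 0" "\<And>\<sigma>. 1 < \<sigma> \<Longrightarrow> \<sigma> \<le> 2 \<Longrightarrow> (\<Sum>n. real n powr (-\<sigma>)) \<le> A / (\<sigma> - 1)"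
    by (rule zeta_real_le) (rule that)
  have "(\<Sum>n. \<bar>mangoldt n - 1\<bar> * real n powr (-c)) \<le> (6 * A) / (c - 1)\<^sup>2" if c: "1 < c" "c \<le> 2" for c
  proof -
    define e where "e = (c - 1) / 2"
    have e: "0 < e" "e \<le> 1/2" "c - e = 1 + e" using c by (auto simp: e_def field_simps)
    have sm: "summable (\<lambda>n. real n powr (-(1 + e)))" using e by (simp add: summable_real_powr_iff)
    have "(\<Sum>n. \<bar>mangoldt n - 1\<bar> * real n powr (-c)) \<le> (\<Sum>n. (1 / e + 1) * real n powr (-(1 + e)))"
    proof (rule suminf_le)
      fix n
      show "\<bar>mangoldt n - 1\<bar> * real n powr (-c) \<le> (1 / e + 1) * real n powr (-(1 + e))"
      proof (cases "n = 0")
        case False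
        then have n: "real n \<ge> 1" by simp
        have p1: "1 \<le> real n powr e" using n e by (simp add: ge_one_powr_ge_zero)
        have "\<bar>mangoldt n - 1\<bar> \<le> ln (real n) + (1::real)"
          using mangoldt_nonneg[of n] mangoldt_le_ln(1)[of n] n by (auto simp: abs_le_iff)
        also have "\<dots> \<le> real n powr e / e + real n powr e"
          using ln_le_powr[OF e(1) n] p1 by (rule add_mono)
        also have "\<dots> = (1 / e + 1) * real n powr e" by (simp add: field_simps)
        finally have "\<bar>mangoldt n - 1\<bar> * real n powr (-c) \<le> (1 / e + 1) * real n powr e * real n powr (-c)"
          by (rule mult_right_mono) simp
        also have "\<dots> = (1 / e + 1) * real n powr (e + -c)" by (simp only: powr_add mult.assoc)
        also have "e + -c = -(1 + e)" using e by simp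
        finally show ?thesis .
      qed simp
    next
      show "summable (\<lambda>n. \<bar>mangoldt n - 1\<bar> * real n powr (-c))"
        using abs_conv_mangoldt_minus_1 c by (simp add: abs_conv_def)
    qed (intro summable_mult sm)
    also have "\<dots> = (1 / e + 1) * (\<Sum>n. real n powr (-(1 + e)))" by (rule suminf_mult[OF sm])
    also have "\<dots> \<le> (1 / e + 1 / (2 * e)) * (A / e)"
    proof (rule mult_mono)
      show "(\<Sum>n. real n powr (-(1 + e))) \<le> A / e" using A(2)[of "1 + e"] e by simp
      show "0 \<le> (\<Sum>n. real n powr (-(1 + e)))" by (rule suminf_nonneg[OF sm]) simp
    qed (use e in \<open>auto simp: field_simps\<close>)
    also have "\<dots> = (6 * A) / (2 * e)\<^sup>2" using e(1) by (simp add: power2_eq_square field_simps)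
    also have "2 * e = c - 1" by (simp add: e_def)
    finally show ?thesis .
  qed
  then show thesis using that[of "6 * A"] A(1) by simp
qed

section \<open>The prime number theorem with remainder\<close>

text \<open>
  The coefficients \<open>\<Lambda>(n) - 1\<close> make the poles of \<open>-\<zeta>'/\<zeta>\<close> and \<open>\<zeta>\<close> at \<open>1\<close> cancel, so the contour can be
  shifted by Cauchy's theorem without a residue.
\<close>

definition excess_series :: "complex \<Rightarrow> complex" where
  "excess_series s = - (if s = 1 then deriv zeta_reg 1 else (zeta_reg s - zeta_reg 1) / (s - 1)) - deriv zeta_reg s / zeta_reg s"

lemma dirichlet_eq_excess_series:
  assumes s: "Re s > 1" shows "dirichlet (\<lambda>n. mangoldt n - 1) s = excess_series s"
proof -
  have sm: "summable (\<lambda>n. of_real (mangoldt n) * of_nat n powr (-s))" "summable (\<lambda>n. of_real 1 * of_nat n powr (-s))"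
    by (rule summable_norm_cancel, rule dirichlet_abs_summable[OF _ s], rule abs_conv_mangoldt abs_conv_one)+
  have "dirichlet (\<lambda>n. mangoldt n - 1) s = dirichlet mangoldt s - zeta s"
    unfolding dirichlet_def by (subst suminf_diff[OF sm]) (simp add: algebra_simps)
  also have "zeta s = zeta_reg s / (s - 1)" using s by (auto simp: zeta_reg_eq_zeta)
  finally show ?thesis using s
    by (auto simp: excess_series_def dirichlet_mangoldt_eq zeta_reg_one diff_divide_distrib)
qed

lemma excess_series_holomorphic:
  assumes "S \<subseteq> {s. Re s > 0}" "\<And>s. s \<in> S \<Longrightarrow> zeta_reg s \<noteq> 0"
  shows "excess_series holomorphic_on S"
proof -
  have "(\<lambda>s. if s = 1 then deriv zeta_reg 1 else (zeta_reg s - zeta_reg 1) / (s - 1)) holomorphic_on {s. Re s > 0}"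
    by (rule pole_lemma[OF zeta_reg_holomorphic]) (simp add: interior_open open_halfspace_Re_gt)
  moreover have "deriv zeta_reg holomorphic_on {s. Re s > 0}"
    by (rule holomorphic_deriv[OF zeta_reg_holomorphic open_halfspace_Re_gt])
  ultimately have "(\<lambda>s. if s = 1 then deriv zeta_reg 1 else (zeta_reg s - zeta_reg 1) / (s - 1)) holomorphic_on S" "deriv zeta_reg holomorphic_on S"
    "zeta_reg holomorphic_on S"
    using zeta_reg_holomorphic assms(1) by (blast intro: holomorphic_on_subset)+
  then have "(\<lambda>s. - (if s = 1 then deriv zeta_reg 1 else (zeta_reg s - zeta_reg 1) / (s - 1)) - deriv zeta_reg s / zeta_reg s) holomorphic_on S"
    using assms(2) by (intro holomorphic_on_diff holomorphic_on_minus holomorphic_on_divide)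
  then show ?thesis by (simp only: excess_series_def[abs_def])
qed

text \<open>Linear growth in \<open>T\<close> is a deliberate coarsening of the squared logarithm;
  the later choice of \<open>T\<close> absorbs it. For \<open>s \<noteq> 1\<close> the first part is
  an honest difference quotient, bounded by \<open>norm_zeta_reg_minus_1\<close>, and the contour
  used later avoids 1.\<close>

lemma excess_series_bound:
  obtains b E where "0 < b" "b \<le> 1/4" "E > 0"
    "\<And>T s. T \<ge> 1 \<Longrightarrow> \<bar>Im s\<bar> \<le> T \<Longrightarrow> \<bar>Re s - 1\<bar> \<le> b / ln (T + 6) \<Longrightarrow> zeta_reg s \<noteq> 0"
    "\<And>T s. T \<ge> 1 \<Longrightarrow> \<bar>Im s\<bar> \<le> T \<Longrightarrow> \<bar>Re s - 1\<bar> \<le> b / ln (T + 6) \<Longrightarrow> s \<noteq> 1 \<Longrightarrow> norm (excess_series s) \<le> E * T"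
proof -
  obtain b C where b: "0 < b" "b \<le> 1/4" and C: "C > 0" and bC:
    "\<And>T s. T \<ge> 1 \<Longrightarrow> \<bar>Im s\<bar> \<le> T \<Longrightarrow> \<bar>Re s - 1\<bar> \<le> b / ln (T + 6) \<Longrightarrow>
       zeta_reg s \<noteq> 0 \<and> norm (deriv zeta_reg s / zeta_reg s) \<le> C * (ln (T + 6))\<^sup>2"
    by (rule zeta_reg_log_deriv_bound) (rule that)
  obtain B where B: "B > 0" "\<And>s. Re s \<ge> 1/2 \<Longrightarrow> norm (zeta_reg s - 1) \<le> B * norm s * norm (s - 1)"
    by (rule norm_zeta_reg_minus_1) (rule that)
  have "norm (excess_series s) \<le> (3 * B + 28 * C) * T"
    if T: "T \<ge> 1" and im: "\<bar>Im s\<bar> \<le> T" and re: "\<bar>Re s - 1\<bar> \<le> b / ln (T + 6)" and s1: "s \<noteq> 1" for T s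
  proof -
    have l: "1 \<le> ln (T + 6)" using T by (intro ln_ge_1) auto
    have "b / ln (T + 6) \<le> b" using l b by (simp add: divide_le_eq)
    then have re': "1/2 \<le> Re s" "Re s \<le> 2" using re b by linarith+
    have "norm s \<le> 3 * T" using cmod_le[of s] re' im T by linarith
    have "norm ((zeta_reg s - 1) / (s - 1)) \<le> B * norm s"
      using B(2)[OF re'(1)] s1 by (simp add: norm_divide divide_le_eq)
    also have "\<dots> \<le> B * (3 * T)" using \<open>norm s \<le> 3 * T\<close> B(1) by (intro mult_left_mono) auto
    finally have 1: "norm ((zeta_reg s - 1) / (s - 1)) \<le> B * (3 * T)" .
    have "ln (T + 6) \<le> 2 * sqrt (T + 6)"
    proof -
      have "ln (T + 6) = 2 * ln (sqrt (T + 6))" using T by (simp add: ln_sqrt)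
      also have "\<dots> \<le> 2 * sqrt (T + 6)" using T by (intro mult_left_mono ln_bound) auto
      finally show ?thesis .
    qed
    then have "(ln (T + 6))\<^sup>2 \<le> (2 * sqrt (T + 6))\<^sup>2" using l by (intro power_mono) auto
    also have "\<dots> = 4 * (T + 6)" using T by (simp add: power_mult_distrib)
    also have "\<dots> \<le> 28 * T" using T by simp
    finally have "C * (ln (T + 6))\<^sup>2 \<le> C * (28 * T)" using C by (intro mult_left_mono) auto
    then have 2: "norm (deriv zeta_reg s / zeta_reg s) \<le> C * (28 * T)" using bC[OF T im re] by linarith
    have "norm (excess_series s) \<le> norm ((zeta_reg s - 1) / (s - 1)) + norm (deriv zeta_reg s / zeta_reg s)"
      using s1 norm_triangle_ineq4[of "- ((zeta_reg s - 1) / (s - 1))" "deriv zeta_reg s / zeta_reg s"] by (simp add: excess_series_def zeta_reg_one)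
    also have "\<dots> \<le> B * (3 * T) + C * (28 * T)" using 1 2 by (rule add_mono)
    also have "\<dots> = (3 * B + 28 * C) * T" by (simp add: algebra_simps)
    finally show ?thesis .
  qed
  then show thesis using that[of b "3 * B + 28 * C"] b B C bC by simp
qed

text \<open>The line \<open>Re s = 1 + 1 / ln x\<close>, on which
  \<open>x powr Re s = exp 1 * x\<close>, is moved to \<open>Re s = 1 - \<eta>\<close>. Truncation
  and horizontal sides account for the term with \<open>1 / T\<close>, the left side for the term
  with \<open>T\<^sup>2\<close>. The hypothesis \<open>1 / ln x \<le> b / ln (T + 6)\<close> keeps
  the whole rectangle inside the strip of \<open>excess_series_bound\<close>.\<close>

lemma mangoldt_weighted_sum_T:
  obtains b K where "0 < b" "b \<le> 1/4" "K > 0"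
    "\<And>x T. x \<ge> 3 \<Longrightarrow> T \<ge> 1 \<Longrightarrow> 1 / ln x \<le> b / ln (T + 6) \<Longrightarrow>
       \<bar>\<Sum>n=1..nat \<lfloor>x\<rfloor>. (mangoldt n - 1) * (1 - real n / x)\<bar> \<le> K * x * ((ln x)\<^sup>2 / T + T\<^sup>2 * exp (- (b * ln x / ln (T + 6))))"
proof -
  obtain b E where b: "0 < b" "b \<le> 1/4" and E: "E > 0"
    and nz: "\<And>T s. T \<ge> 1 \<Longrightarrow> \<bar>Im s\<bar> \<le> T \<Longrightarrow> \<bar>Re s - 1\<bar> \<le> b / ln (T + 6) \<Longrightarrow> zeta_reg s \<noteq> 0"
    and D: "\<And>T s. T \<ge> 1 \<Longrightarrow> \<bar>Im s\<bar> \<le> T \<Longrightarrow> \<bar>Re s - 1\<bar> \<le> b / ln (T + 6) \<Longrightarrow> s \<noteq> 1 \<Longrightarrow> norm (excess_series s) \<le> E * T"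
    by (rule excess_series_bound) (rule that)
  obtain K where K: "K > 0" "\<And>c. 1 < c \<Longrightarrow> c \<le> 2 \<Longrightarrow> (\<Sum>n. \<bar>mangoldt n - 1\<bar> * real n powr (-c)) \<le> K / (c - 1)\<^sup>2"
    by (rule mangoldt_minus_1_sum_le) (rule that)
  have "\<bar>\<Sum>n=1..nat \<lfloor>x\<rfloor>. (mangoldt n - 1) * (1 - real n / x)\<bar> \<le> (30 * K + 6 * E) * x * ((ln x)\<^sup>2 / T + T\<^sup>2 * exp (- (b * ln x / ln (T + 6))))"
    if x: "x \<ge> 3" and T: "T \<ge> 1" and xT: "1 / ln x \<le> b / ln (T + 6)" for x T
  proof -
    define l where "l = ln (T + 6)"
    define \<eta> where "\<eta> = b / l"
    define c where "c = 1 + 1 / ln x"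
    have l: "1 \<le> l" unfolding l_def using T by (intro ln_ge_1) auto
    have \<eta>: "0 < \<eta>" "\<eta> \<le> 1/4" using b l by (auto simp: \<eta>_def divide_le_eq intro: order_trans[OF b(2)])
    have lx: "1 \<le> ln x" using x by (rule ln_ge_1)
    have c: "1 < c" "c \<le> 2" "c - 1 \<le> \<eta>" using lx xT by (auto simp: c_def \<eta>_def l_def)
    have xc: "x powr c \<le> 3 * x"
    proof -
      have "x powr c = x * x powr (1 / ln x)" using x by (simp add: c_def powr_add)
      also have "x powr (1 / ln x) = exp 1" using x lx by (simp add: powr_def)
      also have "x * exp 1 \<le> x * 3" using exp_le x by (intro mult_left_mono) auto
      finally show ?thesis by simp
    qed
    define W where "W = (\<Sum>n. \<bar>mangoldt n - 1\<bar> * real n powr (-c))"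
    have W: "W \<le> K * (ln x)\<^sup>2"
      using K(2)[OF c(1,2)] lx by (simp add: W_def c_def power_divide)
    define f where "f = (\<lambda>s. excess_series s * Perron_kernel x s)"
    let ?l = "linepath (Complex c (-T)) (Complex c T)"
    let ?g = "rectpath (Complex (1 - \<eta>) (-T)) (Complex c T)"
    define R where "R = cbox (Complex (1 - \<eta>) (-T)) (Complex c T)"
    have R: "\<bar>Im s\<bar> \<le> T" "\<bar>Re s - 1\<bar> \<le> b / ln (T + 6)" "1/2 \<le> Re s" "Re s \<le> c" if "s \<in> R" for s
    proof -
      have "1 - \<eta> \<le> Re s" "Re s \<le> c" "- T \<le> Im s" "Im s \<le> T" using that by (auto simp: R_def in_cbox_complex_iff)
      then show "\<bar>Im s\<bar> \<le> T" "\<bar>Re s - 1\<bar> \<le> b / ln (T + 6)" "1/2 \<le> Re s" "Re s \<le> c"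
        unfolding l_def[symmetric] \<eta>_def[symmetric] using c \<eta> by linarith+
    qed
    have holf: "f holomorphic_on R"
    proof -
      have D: "excess_series holomorphic_on R"
      proof (rule excess_series_holomorphic)
        show "R \<subseteq> {s. Re s > 0}" using R(3) by force
        show "zeta_reg s \<noteq> 0" if "s \<in> R" for s using nz[OF T R(1,2)[OF that]] .
      qed
      have z: "s \<noteq> 0" "s + 1 \<noteq> 0" if "s \<in> R" for s using R(3)[OF that] by (auto simp: complex_eq_iff)
      show ?thesis unfolding f_def using x z by (intro holomorphic_intros D) auto
    qed
    have pR: "path_image ?g \<subseteq> R" unfolding R_def using c \<eta> T by (intro path_image_rectpath_subset_cbox) auto
    have I: "(f has_contour_integral 0) ?g"
      by (rule Cauchy_theorem_convex_simple[OF holf]) (use pR in \<open>auto simp: R_def\<close>)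
    have "norm (contour_integral ?l f - 0) \<le> 2 * (c - (1 - \<eta>)) * (E * (3 * x) / T) + 2 * T * (2 * E * T * x powr (1 - \<eta>))"
    proof (rule rectangle_integral_estimates(1)[OF _ _ _ I])
      show "continuous_on (path_image ?g) f"
        by (rule holomorphic_on_imp_continuous_on[OF holomorphic_on_subset[OF holf pR]])
      fix z assume z: "\<bar>Im z\<bar> = T" "1 - \<eta> \<le> Re z" "Re z \<le> c"
      then have zR: "z \<in> R" by (auto simp: R_def in_cbox_complex_iff)
      have "z \<noteq> 1" using z(1) T by auto
      then have d: "norm (excess_series z) \<le> E * T" by (rule D[OF T R(1,2)[OF zR]])
      have "norm (of_real x powr z / (z * (z + 1))) \<le> x powr c / T\<^sup>2"
        using x T z abs_Im_le_cmod[of z] abs_Im_le_cmod[of "z + 1"]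
        by (intro norm_kernel_le) (auto intro: powr_mono)
      also have "\<dots> \<le> 3 * x / T\<^sup>2" using xc by (rule divide_right_mono) simp
      finally have "norm (f z) \<le> (E * T) * (3 * x / T\<^sup>2)"
        unfolding f_def norm_mult[of "excess_series z"] using d E T by (intro mult_mono) auto
      then show "norm (f z) \<le> E * (3 * x) / T" using T by (simp add: power2_eq_square)
    next
      fix z assume z: "Re z = 1 - \<eta>" "\<bar>Im z\<bar> \<le> T"
      then have zR: "z \<in> R" using c \<eta> by (auto simp: R_def in_cbox_complex_iff)
      have "z \<noteq> 1" using z(1) \<eta> by auto
      then have d: "norm (excess_series z) \<le> E * T" by (rule D[OF T R(1,2)[OF zR]])
      have "norm (of_real x powr z / (z * (z + 1))) \<le> x powr (1 - \<eta>) / (1/2 * 1)"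
        unfolding norm_divide norm_mult
        using x z \<eta> abs_Re_le_cmod[of z] abs_Re_le_cmod[of "z + 1"]
        by (intro frac_le mult_mono) (auto simp: norm_of_real_powr)
      then have "norm (f z) \<le> (E * T) * (x powr (1 - \<eta>) / (1/2 * 1))"
        unfolding f_def norm_mult[of "excess_series z"] using d E T by (intro mult_mono) auto
      then show "norm (f z) \<le> 2 * E * T * x powr (1 - \<eta>)" by simp
    qed (use c \<eta> T E x in auto)
    also have "\<dots> \<le> 2 * 1 * (E * (3 * x) / T) + 2 * T * (2 * E * T * x powr (1 - \<eta>))"
      using c \<eta> E x T by (intro add_right_mono mult_right_mono mult_left_mono) auto
    finally have 1: "norm (contour_integral ?l f) \<le> 6 * E * x / T + 4 * E * T\<^sup>2 * x powr (1 - \<eta>)"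
      by (simp add: power2_eq_square mult_ac)
    have eq: "contour_integral ?l (\<lambda>s. dirichlet (\<lambda>n. mangoldt n - 1) s * Perron_kernel x s) = contour_integral ?l f"
      by (rule contour_integral_eq) (use c T in \<open>auto simp: f_def closed_segment_same_Re dirichlet_eq_excess_series\<close>)
    define S where "S = (\<Sum>n=1..nat \<lfloor>x\<rfloor>. (mangoldt n - 1) * (1 - real n / x))"
    have "norm (contour_integral ?l f - 2 * of_real pi * \<i> * of_real S) \<le> 10 * x powr c / T * W"
      using Perron_truncated[OF abs_conv_mangoldt_minus_1 _ c(1,2) T, of x] x
      unfolding eq S_def[symmetric] W_def[symmetric] by simp
    also have "\<dots> \<le> 10 * (3 * x) / T * (K * (ln x)\<^sup>2)"
      using xc W T K x by (intro mult_mono divide_right_mono) (auto simp: W_def intro!: suminf_nonneg abs_conv_mangoldt_minus_1[unfolded abs_conv_def, rule_format] c)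
    finally have 2: "norm (contour_integral ?l f - 2 * of_real pi * \<i> * of_real S) \<le> 30 * K * x * ((ln x)\<^sup>2 / T)"
      by (simp add: mult_ac)
    have "2 * pi * \<bar>S\<bar> = norm (2 * of_real pi * \<i> * of_real S)" by (simp add: norm_mult)
    also have "\<dots> \<le> norm (contour_integral ?l f) + norm (contour_integral ?l f - 2 * of_real pi * \<i> * of_real S)"
      using norm_triangle_ineq4[of "contour_integral ?l f" "contour_integral ?l f - 2 * of_real pi * \<i> * of_real S"] by simp
    finally have "2 * pi * \<bar>S\<bar> \<le> 6 * E * x / T + 4 * E * T\<^sup>2 * x powr (1 - \<eta>) + 30 * K * x * ((ln x)\<^sup>2 / T)"
      using 1 2 by linarith
    moreover have "\<bar>S\<bar> \<le> 2 * pi * \<bar>S\<bar>" using pi_gt3 mult_right_mono[of 1 "2 * pi" "\<bar>S\<bar>"] by simp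
    moreover have "6 * E * x / T \<le> 6 * E * x * ((ln x)\<^sup>2 / T)"
    proof -
      have "1 \<le> (ln x)\<^sup>2" using lx by simp
      then have "1 / T \<le> (ln x)\<^sup>2 / T" using T by (intro divide_right_mono) auto
      then have "6 * E * x * (1 / T) \<le> 6 * E * x * ((ln x)\<^sup>2 / T)" using E x by (intro mult_left_mono) auto
      then show ?thesis by simp
    qed
    moreover have "4 * E * T\<^sup>2 * x powr (1 - \<eta>) \<le> (30 * K + 6 * E) * x * (T\<^sup>2 * exp (- (b * ln x / l)))"
    proof -
      have "x powr (1 - \<eta>) = x * exp (- (b * ln x / l))"
      proof -
        have "(1 - \<eta>) * ln x = ln x + - (b * ln x / l)" by (simp add: \<eta>_def algebra_simps)
        then have "x powr (1 - \<eta>) = exp (ln x + - (b * ln x / l))" using x by (simp add: powr_def)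
        then show ?thesis using x by (simp only: exp_add) simp
      qed
      moreover have "4 * E \<le> 30 * K + 6 * E" using K E by simp
      then have "4 * E * (x * (T\<^sup>2 * exp (- (b * ln x / l)))) \<le> (30 * K + 6 * E) * (x * (T\<^sup>2 * exp (- (b * ln x / l))))"
        using x by (intro mult_right_mono) auto
      ultimately show ?thesis by (simp only: mult_ac)
    qed
    moreover have "(30 * K + 6 * E) * x * ((ln x)\<^sup>2 / T + T\<^sup>2 * exp (- (b * ln x / l))) =
      30 * K * x * ((ln x)\<^sup>2 / T) + 6 * E * x * ((ln x)\<^sup>2 / T) + (30 * K + 6 * E) * x * (T\<^sup>2 * exp (- (b * ln x / l)))"
      by (simp add: algebra_simps add_divide_distrib)
    ultimately show ?thesis unfolding S_def[symmetric] l_def[symmetric] by linarith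
  qed
  then show thesis using that[of b "30 * K + 6 * E"] b K E by simp
qed

abbreviation decay :: "real \<Rightarrow> real \<Rightarrow> real" where
  "decay k x \<equiv> exp (- k * sqrt (ln x))"

text \<open>With \<open>L = u * sqrt (ln x)\<close> and \<open>T = exp L\<close> the two errors
  balance: \<open>u\<^sup>2 = b / 6\<close> gives \<open>b * ln x = 6 * L\<^sup>2\<close>, and
  \<open>ln (T + 6) \<le> 2 * L\<close>, so the exponent is at least \<open>3 * L\<close> and
  \<open>T\<^sup>2 * exp (- (3 * L))\<close> equals \<open>1 / T\<close>. The factor
  \<open>(ln x)\<^sup>2\<close> is polynomial in \<open>L\<close> and is paid for with half of the
  exponent.\<close>

lemma mangoldt_weighted_sum:
  obtains C k x0 where "C > 0" "k > 0"
    "\<And>x. x \<ge> x0 \<Longrightarrow> \<bar>\<Sum>n=1..nat \<lfloor>x\<rfloor>. (mangoldt n - 1) * (1 - real n / x)\<bar> \<le> C * x * decay k x"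
proof -
  obtain b K where b: "0 < b" "b \<le> 1/4" and K: "K > 0" and S:
    "\<And>x T. x \<ge> 3 \<Longrightarrow> T \<ge> 1 \<Longrightarrow> 1 / ln x \<le> b / ln (T + 6) \<Longrightarrow>
       \<bar>\<Sum>n=1..nat \<lfloor>x\<rfloor>. (mangoldt n - 1) * (1 - real n / x)\<bar> \<le> K * x * ((ln x)\<^sup>2 / T + T\<^sup>2 * exp (- (b * ln x / ln (T + 6))))"
    by (rule mangoldt_weighted_sum_T) (rule that)
  define u where "u = sqrt (b / 6)"
  have u: "u > 0" "u\<^sup>2 = b / 6" using b by (auto simp: u_def)
  have "eventually (\<lambda>L::real. (36 / b\<^sup>2 * L ^ 4 + 1) * exp (-L) \<le> exp (- (L / 2))) at_top"
    using b by real_asymp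
  then obtain L0 where L0: "\<And>L. L \<ge> L0 \<Longrightarrow> (36 / b\<^sup>2 * L ^ 4 + 1) * exp (-L) \<le> exp (- (L / 2))"
    unfolding eventually_at_top_linorder by blast
  define x0 where "x0 = max 3 (exp ((max 3 L0 / u)\<^sup>2))"
  have "\<bar>\<Sum>n=1..nat \<lfloor>x\<rfloor>. (mangoldt n - 1) * (1 - real n / x)\<bar> \<le> K * x * decay (u / 2) x" if x: "x \<ge> x0" for x
  proof -
    have x3: "x \<ge> 3" using x by (simp add: x0_def)
    define L where "L = u * sqrt (ln x)"
    have lx: "ln x \<ge> 1" using x3 by (rule ln_ge_1)
    have L: "L \<ge> 3" "L \<ge> L0"
    proof -
      have "exp ((max 3 L0 / u)\<^sup>2) \<le> x" using x by (simp add: x0_def)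
      then have "(max 3 L0 / u)\<^sup>2 \<le> ln x" using x3 by (subst ln_ge_iff) auto
      then have "max 3 L0 / u \<le> sqrt (ln x)" by (rule real_le_rsqrt)
      then have "max 3 L0 \<le> L" using u by (simp add: L_def divide_le_eq mult.commute)
      then show "L \<ge> 3" "L \<ge> L0" by auto
    qed
    have L2: "b * ln x = 6 * L\<^sup>2" using u lx by (simp add: L_def power_mult_distrib)
    define T where "T = exp L"
    have T: "T \<ge> 1" using L by (simp add: T_def)
    have "ln (T + 6) \<le> ln (7 * T)" using T by (subst ln_le_cancel_iff) auto
    also have "\<dots> = ln 7 + L" by (simp add: T_def ln_mult)
    also have "ln 7 \<le> (3::real)"
    proof -
      have "(2::real) ^ 3 \<le> exp 1 ^ 3" using exp_ge_add_one_self[of 1] by (intro power_mono) auto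
      also have "exp 1 ^ 3 = exp (3::real)" by (simp flip: exp_of_nat_mult)
      finally have "7 \<le> exp (3::real)" by simp
      then have "ln 7 \<le> ln (exp (3::real))" by (subst ln_le_cancel_iff) auto
      then show ?thesis by simp
    qed
    finally have lT: "ln (T + 6) \<le> 2 * L" using L by simp
    have lT1: "1 \<le> ln (T + 6)" using T by (intro ln_ge_1) auto
    have q: "6 * L\<^sup>2 / (2 * L) = 3 * L" using L by (simp add: power2_eq_square)
    have t3: "3 * L \<le> b * ln x / ln (T + 6)"
      unfolding L2 q[symmetric] using lT lT1 by (intro divide_left_mono) auto
    then have "1 \<le> b * ln x / ln (T + 6)" using L by linarith
    then have "1 / ln x \<le> b / ln (T + 6)" using lx by (simp add: field_simps)
    from S[OF x3 T this]
    have "\<bar>\<Sum>n=1..nat \<lfloor>x\<rfloor>. (mangoldt n - 1) * (1 - real n / x)\<bar> \<le> K * x * ((ln x)\<^sup>2 / T + T\<^sup>2 * exp (- (b * ln x / ln (T + 6))))" .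
    also have "\<dots> \<le> K * x * ((ln x)\<^sup>2 / T + T\<^sup>2 * exp (- (3 * L)))"
      using t3 K x3 by (intro mult_left_mono add_left_mono) auto
    also have "(ln x)\<^sup>2 / T + T\<^sup>2 * exp (- (3 * L)) = (36 / b\<^sup>2 * L ^ 4 + 1) * exp (-L)"
    proof -
      have lnx: "ln x = 6 * L\<^sup>2 / b" using L2 b by (simp add: field_simps)
      have "T\<^sup>2 * exp (- (3 * L)) = exp (-L)" by (simp add: T_def power2_eq_square flip: exp_add)
      moreover have "(ln x)\<^sup>2 / T = 36 / b\<^sup>2 * L ^ 4 * exp (-L)"
        unfolding lnx by (simp add: T_def exp_minus power_divide power_mult_distrib divide_inverse power_inverse flip: power_mult)
      ultimately show ?thesis by (simp add: distrib_right)
    qed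
    also have "K * x * \<dots> \<le> K * x * exp (- (L / 2))" using K x3 L0[OF L(2)] by (intro mult_left_mono) auto
    finally show ?thesis by (simp add: L_def)
  qed
  then show thesis using that[of K "u / 2" x0] K u by simp
qed

text \<open>\<open>R\<close> sums up the partial sums of \<open>a\<close>, so
  \<open>R (N + h) - R N\<close> adds \<open>h\<close> consecutive ones. The bound
  \<open>a n \<ge> -1\<close> stands in for monotonicity: across the window the partial sums drop by
  at most \<open>h\<close>, which costs \<open>h\<^sup>2\<close>.\<close>

lemma sum_difference_bounds:
  fixes a :: "nat \<Rightarrow> real"
  assumes a: "\<And>n. a n \<ge> -1"
  defines "R \<equiv> \<lambda>N. \<Sum>n=1..N. a n * (real N - real n)"
  shows "real h * (\<Sum>n=1..N. a n) \<le> R (N + h) - R N + (real h)\<^sup>2"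
    and "R (N + h) - R N - (real h)\<^sup>2 \<le> real h * (\<Sum>n=1..N+h. a n)"
proof -
  have bound: "- (real h)\<^sup>2 \<le> (\<Sum>n=N+1..N+h. a n * w n)" if "\<And>n. n \<in> {N+1..N+h} \<Longrightarrow> 0 \<le> w n \<and> w n \<le> real h" for w
  proof -
    have "- (real h)\<^sup>2 = (\<Sum>n=N+1..N+h. - real h)" by (simp add: power2_eq_square)
    also have "\<dots> \<le> (\<Sum>n=N+1..N+h. a n * w n)"
    proof (rule sum_mono)
      fix n assume "n \<in> {N+1..N+h}"
      then have w: "0 \<le> w n" "w n \<le> real h" using that by auto
      have "- w n \<le> a n * w n" using mult_right_mono[OF a[of n] w(1)] by simp
      then show "- real h \<le> a n * w n" using w by linarith
    qed
    finally show ?thesis .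
  qed
  have R: "R (N + h) = R N + real h * (\<Sum>n=1..N. a n) + (\<Sum>n=N+1..N+h. a n * (real N + real h - real n))"
    unfolding R_def by (subst sum.ub_add_nat) (simp_all add: sum_distrib_left algebra_simps sum.distrib sum_subtractf)
  have "- (real h)\<^sup>2 \<le> (\<Sum>n=N+1..N+h. a n * (real N + real h - real n))"
    by (rule bound) auto
  then show "real h * (\<Sum>n=1..N. a n) \<le> R (N + h) - R N + (real h)\<^sup>2" using R by linarith
  have "- (real h)\<^sup>2 \<le> (\<Sum>n=N+1..N+h. a n * (real n - real N))"
    by (rule bound) auto
  also have "\<dots> = real h * (\<Sum>n=N+1..N+h. a n) - (\<Sum>n=N+1..N+h. a n * (real N + real h - real n))"
    by (simp add: sum_distrib_left algebra_simps sum.distrib sum_subtractf)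
  also have "(\<Sum>n=N+1..N+h. a n) = (\<Sum>n=1..N+h. a n) - (\<Sum>n=1..N. a n)"
    by (subst (2) sum.ub_add_nat) simp_all
  finally show "R (N + h) - R N - (real h)\<^sup>2 \<le> real h * (\<Sum>n=1..N+h. a n)"
    using R by (simp add: right_diff_distrib)
qed

text \<open>The weighted sums have error of order \<open>N\<^sup>2 * q\<^sup>2\<close>. Differencing
  over \<open>h\<close> of size \<open>N * q\<close> and dividing by \<open>h\<close> turns this
  into \<open>N * q\<close>, and the loss \<open>h\<close> from differencing has the same
  size.\<close>

lemma Chebyshev_psi_bound:
  obtains C k and N0 :: nat where "C > 0" "k > 0"
    "\<And>N. N \<ge> N0 \<Longrightarrow> \<bar>\<Sum>n=1..N. mangoldt n - 1\<bar> \<le> C * real N * decay k (real N)"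
proof -
  obtain C k x0 where C: "C > 0" and k: "k > 0" and W:
    "\<And>x. x \<ge> x0 \<Longrightarrow> \<bar>\<Sum>n=1..nat \<lfloor>x\<rfloor>. (mangoldt n - 1) * (1 - real n / x)\<bar> \<le> C * x * decay k x"
    by (rule mangoldt_weighted_sum) (rule that)
  define a :: "nat \<Rightarrow> real" where "a = (\<lambda>n. mangoldt n - 1)"
  have a: "a n \<ge> -1" for n using mangoldt_nonneg[of n] by (simp add: a_def)
  define R where "R = (\<lambda>N. \<Sum>n=1..N. a n * (real N - real n))"
  have Rb: "\<bar>R M\<bar> \<le> C * (real M)\<^sup>2 * decay k (real M)" if "real M \<ge> x0" "M \<ge> 1" for M
  proof -
    have "R M = real M * (\<Sum>n=1..nat \<lfloor>real M\<rfloor>. (mangoldt n - 1) * (1 - real n / real M))"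
      unfolding R_def a_def sum_distrib_left using that by (intro sum.cong) (auto simp: field_simps)
    then have "\<bar>R M\<bar> = real M * \<bar>\<Sum>n=1..nat \<lfloor>real M\<rfloor>. (mangoldt n - 1) * (1 - real n / real M)\<bar>"
      by (simp add: abs_mult)
    also have "\<dots> \<le> real M * (C * real M * decay k (real M))"
      using W[OF that(1)] by (intro mult_left_mono) auto
    finally show ?thesis by (simp add: power2_eq_square mult_ac)
  qed
  have "eventually (\<lambda>N::nat. decay (k/4) (real N) \<le> 1/4 \<and> 1 \<le> real N * decay (k/4) (real N) \<and> N \<ge> 4 \<and> real N \<ge> 2 * x0) at_top"
    using k by (intro eventually_conj eventually_ge_at_top) real_asymp+
  then obtain N0 where N0: "\<And>N::nat. N \<ge> N0 \<Longrightarrow> decay (k/4) (real N) \<le> 1/4 \<and> 1 \<le> real N * decay (k/4) (real N) \<and> N \<ge> 4 \<and> real N \<ge> 2 * x0"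
    unfolding eventually_at_top_linorder by blast
  have "\<bar>\<Sum>n=1..N. mangoldt n - 1\<bar> \<le> (8 * C + 2) * real N * decay (k/4) (real N)" if "N \<ge> N0" for N
  proof -
    \<comment> \<open>One halving of \<open>k\<close> because \<open>q\<^sup>2\<close>, not
      \<open>q\<close>, has to match the weighted error; another because only
      \<open>ln M \<ge> ln N / 4\<close> is used for \<open>M \<ge> N / 2\<close>.\<close>
    define q where "q = decay (k/4) (real N)"
    have q: "q > 0" "q \<le> 1/4" "1 \<le> real N * q" and N: "N \<ge> 4" "real N \<ge> 2 * x0"
      using N0[OF that] by (auto simp: q_def)
    have RM: "\<bar>R M\<bar> \<le> 4 * C * (real N)\<^sup>2 * q\<^sup>2" if M: "real N / 2 \<le> real M" "real M \<le> 2 * real N" for M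
    proof -
      have M1: "real M \<ge> x0" "M \<ge> 1" using M N by auto
      have "ln (real N) / 4 \<le> ln (real N / 2)"
      proof -
        have "ln (2 * 2) \<le> ln (real N)" using N by (subst ln_le_cancel_iff) auto
        then have "2 * ln 2 \<le> ln (real N)" by (subst (asm) ln_mult) auto
        moreover have "ln (real N / 2) = ln (real N) - ln 2" using N by (intro ln_divide_pos) auto
        moreover have "ln (2::real) \<ge> 0" by simp
        ultimately show ?thesis by linarith
      qed
      also have "\<dots> \<le> ln (real M)" using M N by (subst ln_le_cancel_iff) auto
      finally have "sqrt (ln (real N) / 4) \<le> sqrt (ln (real M))" by simp
      then have "sqrt (ln (real N)) / 2 \<le> sqrt (ln (real M))" by (simp add: real_sqrt_divide)
      then have "k * (sqrt (ln (real N)) / 2) \<le> k * sqrt (ln (real M))" using k by (intro mult_left_mono) auto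
      then have "decay k (real M) \<le> q\<^sup>2"
        unfolding q_def by (simp flip: exp_double)
      moreover have "(real M)\<^sup>2 \<le> (2 * real N)\<^sup>2" using M by (intro power_mono) auto
      ultimately have "C * (real M)\<^sup>2 * decay k (real M) \<le> C * (2 * real N)\<^sup>2 * q\<^sup>2"
        using C by (intro mult_mono) auto
      then show ?thesis using Rb[OF M1] by (simp add: power_mult_distrib)
    qed
    define h where "h = nat \<lceil>real N * q\<rceil>"
    have h: "real N * q \<le> real h" "real h \<le> 2 * (real N * q)" using q by (auto simp: h_def) linarith+
    have "real N * q \<le> real N * (1/4)" using q by (intro mult_left_mono) auto
    then have hN: "real h \<le> real N / 2" using h by linarith
    then have hle: "h \<le> N" by linarith
    have h0: "real h > 0" using h q by linarith
    define E where "E = (\<Sum>n=1..N. a n)"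
    have "real h * E \<le> R (N + h) - R N + (real h)\<^sup>2"
      unfolding E_def R_def by (rule sum_difference_bounds(1)[OF a])
    moreover have "R N - R (N - h) - (real h)\<^sup>2 \<le> real h * E"
      unfolding E_def R_def using sum_difference_bounds(2)[where a = a and N = "N - h" and h = h, OF a] hle by simp
    moreover have "\<bar>R (N + h)\<bar> \<le> 4 * C * (real N)\<^sup>2 * q\<^sup>2" "\<bar>R (N - h)\<bar> \<le> 4 * C * (real N)\<^sup>2 * q\<^sup>2" "\<bar>R N\<bar> \<le> 4 * C * (real N)\<^sup>2 * q\<^sup>2"
      using hN hle by (auto intro!: RM)
    ultimately have "\<bar>real h * E\<bar> \<le> 8 * C * (real N)\<^sup>2 * q\<^sup>2 + (real h)\<^sup>2" by linarith
    also have "\<dots> = 8 * C * (real N * q) * (real N * q) + real h * real h" by (simp add: power2_eq_square mult_ac)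
    also have "\<dots> \<le> 8 * C * (real N * q) * real h + 2 * (real N * q) * real h"
      using h C q by (intro add_mono mult_left_mono mult_right_mono) auto
    also have "\<dots> = real h * ((8 * C + 2) * (real N * q))" by (simp add: algebra_simps)
    finally have "\<bar>E\<bar> \<le> (8 * C + 2) * (real N * q)" using h0 by (simp add: abs_mult)
    then show ?thesis by (simp add: E_def a_def q_def mult.assoc)
  qed
  then show thesis using that[of "8 * C + 2" "k / 4" N0] C k by simp
qed

text \<open>A proper prime power \<open>p ^ k \<le> N\<close> has \<open>p \<le> sqrt N\<close> and,
  as \<open>ln 2 \<ge> 1/2\<close>, also \<open>k \<le> 2 * ln N\<close>. Counting such pairs
  suffices, each with weight at most \<open>ln N\<close>.\<close>

lemma mangoldt_prime_powers_le:
  assumes N: "N \<ge> 1"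
  shows "0 \<le> (\<Sum>n=1..N. mangoldt n - (if prime n then ln (real n) else 0))"
    and "(\<Sum>n=1..N. mangoldt n - (if prime n then ln (real n) else 0)) \<le> sqrt (real N) * (2 * ln (real N) + 1) * ln (real N)"
proof -
  define B where "B = {n\<in>{1..N}. primepow n \<and> \<not> prime n}"
  have eq: "mangoldt n - (if prime n then ln (real n) else 0) = (if n \<in> B then mangoldt n else 0 :: real)" if "n \<in> {1..N}" for n
    using that by (auto simp: B_def mangoldt_def)
  have s: "(\<Sum>n=1..N. mangoldt n - (if prime n then ln (real n) else 0)) = (\<Sum>n\<in>B. mangoldt n :: real)"
  proof -
    have "(\<Sum>n=1..N. mangoldt n - (if prime n then ln (real n) else 0)) = (\<Sum>n\<in>{1..N}. if n \<in> B then mangoldt n else 0 :: real)"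
      by (rule sum.cong[OF refl eq])
    also have "\<dots> = (\<Sum>n\<in>{1..N} \<inter> B. mangoldt n)" by (rule sum.inter_restrict[symmetric]) simp
    also have "{1..N} \<inter> B = B" by (auto simp: B_def)
    finally show ?thesis .
  qed
  show "0 \<le> (\<Sum>n=1..N. mangoldt n - (if prime n then ln (real n) else 0))"
    unfolding s by (intro sum_nonneg mangoldt_nonneg)
  define P where "P = nat \<lfloor>sqrt (real N)\<rfloor>"
  define K where "K = nat \<lfloor>2 * ln (real N)\<rfloor>"
  have ln2: "ln (2::real) \<ge> 1/2" 
    using ln_le_minus_one[of "1/2::real"] by (simp add: ln_div)
  have "B \<subseteq> (\<lambda>(p, k). p ^ k) ` ({1..P} \<times> {..K})"
  proof
    fix n assume "n \<in> B"
    then have n: "n \<le> N" "primepow n" "\<not> prime n" by (auto simp: B_def)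
    then obtain p k where pk: "prime p" "k > 0" "n = p ^ k" by (auto simp: primepow_def)
    have "k \<noteq> 1" using pk n(3) by auto
    then have k2: "k \<ge> 2" using pk(2) by simp
    have p2: "p \<ge> 2" using pk(1) by (rule prime_ge_2_nat)
    have "p\<^sup>2 \<le> p ^ k" using p2 k2 by (intro power_increasing) auto
    then have "real (p\<^sup>2) \<le> real N" using pk(3) n(1) by (simp only: of_nat_le_iff)
    then have "real p \<le> sqrt (real N)" by (intro real_le_rsqrt) simp
    then have "p \<le> P" by (simp add: P_def le_nat_floor)
    have "2 ^ k \<le> p ^ k" using p2 by (intro power_mono) auto
    then have "real (2 ^ k) \<le> real N" using pk(3) n(1) by (simp only: of_nat_le_iff)
    then have "ln (2 ^ k) \<le> ln (real N)" by (subst ln_le_cancel_iff) (use N in auto)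
    then have "real k * ln 2 \<le> ln (real N)" by (simp add: ln_realpow)
    moreover have "real k * (1/2) \<le> real k * ln 2" using ln2 by (intro mult_left_mono) auto
    ultimately have "real k \<le> 2 * ln (real N)" by simp
    then have "k \<le> K" by (simp add: K_def le_nat_floor)
    show "n \<in> (\<lambda>(p, k). p ^ k) ` ({1..P} \<times> {..K})"
      using \<open>p \<le> P\<close> \<open>k \<le> K\<close> p2 pk(3) by (intro image_eqI[where x = "(p, k)"]) auto
  qed
  then have "card B \<le> card ({1..P} \<times> {..K})"
    using card_mono[OF finite_imageI] card_image_le order_trans by (metis finite_SigmaI finite_atLeastAtMost finite_atMost)
  then have "card B \<le> P * (K + 1)" by (simp add: card_cartesian_product)
  then have "real (card B) \<le> real (P * (K + 1))" by (simp only: of_nat_le_iff)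
  then have "real (card B) \<le> real P * (real K + 1)" by (simp add: distrib_left)
  also have "\<dots> \<le> sqrt (real N) * (2 * ln (real N) + 1)"
    using N by (intro mult_mono) (auto simp: P_def K_def)
  finally have card: "real (card B) \<le> sqrt (real N) * (2 * ln (real N) + 1)" .
  have "(\<Sum>n\<in>B. mangoldt n :: real) \<le> real (card B) * ln (real N)"
  proof (rule sum_bounded_above)
    fix n assume "n \<in> B"
    then have "ln (real n) \<le> ln (real N)" by (subst ln_le_cancel_iff) (auto simp: B_def)
    then show "mangoldt n \<le> ln (real N)" using mangoldt_le_ln(1)[of n] by linarith
  qed
  also have "\<dots> \<le> sqrt (real N) * (2 * ln (real N) + 1) * ln (real N)"
    using card N by (intro mult_right_mono) auto
  finally show "(\<Sum>n=1..N. mangoldt n - (if prime n then ln (real n) else 0)) \<le> sqrt (real N) * (2 * ln (real N) + 1) * ln (real N)"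
    unfolding s .
qed

text \<open>Its partial sums over \<open>1..N\<close> are the Chebyshev function \<theta> at
  \<open>N\<close> minus \<open>N\<close>.\<close>

definition prime_excess :: "nat \<Rightarrow> real" where
  "prime_excess n = (if prime n then ln (real n) else 0) - 1"

lemma abs_prime_excess_le: "n \<ge> 1 \<Longrightarrow> n \<le> N \<Longrightarrow> \<bar>prime_excess n\<bar> \<le> ln (real N) + 1"
proof -
  assume "n \<ge> 1" "n \<le> N"
  then have "0 \<le> ln (real n)" "ln (real n) \<le> ln (real N)" by (auto simp: ln_le_cancel_iff)
  then show ?thesis by (auto simp: prime_excess_def)
qed

lemma Chebyshev_theta_bound:
  obtains C k and N0 :: nat where "C > 0" "k > 0"
    "\<And>N. N \<ge> N0 \<Longrightarrow> \<bar>\<Sum>n=1..N. prime_excess n\<bar> \<le> C * real N * decay k (real N)"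
proof -
  obtain C k and N0 :: nat where C: "C > 0" and k: "k > 0" and psi:
    "\<And>N. N \<ge> N0 \<Longrightarrow> \<bar>\<Sum>n=1..N. mangoldt n - 1\<bar> \<le> C * real N * decay k (real N)"
    by (rule Chebyshev_psi_bound) (rule that)
  have "eventually (\<lambda>N::nat. sqrt (real N) * (2 * ln (real N) + 1) * ln (real N) \<le> real N * decay k (real N)) at_top"
    using k by real_asymp
  then obtain N1 where N1: "\<And>N::nat. N \<ge> N1 \<Longrightarrow> sqrt (real N) * (2 * ln (real N) + 1) * ln (real N) \<le> real N * decay k (real N)"
    unfolding eventually_at_top_linorder by blast
  have "\<bar>\<Sum>n=1..N. prime_excess n\<bar> \<le> (C + 1) * real N * decay k (real N)" if N: "N \<ge> max 1 (max N0 N1)" for N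
  proof -
    have "(\<Sum>n=1..N. prime_excess n) = (\<Sum>n=1..N. mangoldt n - 1) - (\<Sum>n=1..N. mangoldt n - (if prime n then ln (real n) else 0))"
      by (simp add: prime_excess_def flip: sum_subtractf)
    moreover have "(C + 1) * real N * decay k (real N) = C * real N * decay k (real N) + real N * decay k (real N)"
      by (simp add: algebra_simps)
    ultimately show ?thesis
      using psi[of N] N1[of N] mangoldt_prime_powers_le[of N] N by linarith
  qed
  then show thesis using that[of "C + 1" k "max 1 (max N0 N1)"] C k by simp
qed

text \<open>Abel summation needs one bound for all partial sums up to \<open>N\<close>. Up to
  \<open>sqrt N\<close> the trivial estimate is good enough, and beyond it \<open>ln M\<close> is
  comparable to \<open>ln N\<close>, so that only the constant in the exponent suffers.\<close>

lemma Chebyshev_theta_bound_uniform: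
  obtains C k and N0 :: nat where "C > 0" "k > 0"
    "\<And>N M. N \<ge> N0 \<Longrightarrow> M \<le> N \<Longrightarrow> \<bar>\<Sum>n=1..M. prime_excess n\<bar> \<le> C * real N * decay k (real N)"
proof -
  obtain C k and N1 :: nat where C: "C > 0" and k: "k > 0" and theta:
    "\<And>N. N \<ge> N1 \<Longrightarrow> \<bar>\<Sum>n=1..N. prime_excess n\<bar> \<le> C * real N * decay k (real N)"
    by (rule Chebyshev_theta_bound) (rule that)
  have "eventually (\<lambda>N::nat. sqrt (real N) * (ln (real N) + 1) \<le> real N * decay (k/2) (real N) \<and> real N1 \<le> sqrt (real N) \<and> N \<ge> 1) at_top"
    using k by (intro eventually_conj eventually_ge_at_top) real_asymp+
  then obtain N0 where N0: "\<And>N::nat. N \<ge> N0 \<Longrightarrow> sqrt (real N) * (ln (real N) + 1) \<le> real N * decay (k/2) (real N) \<and> real N1 \<le> sqrt (real N) \<and> N \<ge> 1"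
    unfolding eventually_at_top_linorder by blast
  have "\<bar>\<Sum>n=1..M. prime_excess n\<bar> \<le> (C + 1) * real N * decay (k/2) (real N)" if N: "N \<ge> N0" and M: "M \<le> N" for N M
  proof -
    define q where "q = real N * decay (k/2) (real N)"
    have q: "sqrt (real N) * (ln (real N) + 1) \<le> q" "real N1 \<le> sqrt (real N)" "N \<ge> 1"
      using N0[OF N] by (auto simp: q_def)
    have q0: "q \<ge> 0" by (simp add: q_def)
    have "\<bar>\<Sum>n=1..M. prime_excess n\<bar> \<le> (C + 1) * q"
    proof (cases "real M \<le> sqrt (real N)")
      case True
      have "\<bar>\<Sum>n=1..M. prime_excess n\<bar> \<le> (\<Sum>n=1..M. \<bar>prime_excess n\<bar>)" by (rule sum_abs)
      also have "\<dots> \<le> (\<Sum>n=1..M. ln (real N) + 1)" using M by (intro sum_mono abs_prime_excess_le) auto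
      also have "\<dots> = real M * (ln (real N) + 1)" by simp
      also have "\<dots> \<le> sqrt (real N) * (ln (real N) + 1)" using True q(3) by (intro mult_right_mono) auto
      also have "\<dots> \<le> 1 * q" using q(1) by simp
      also have "\<dots> \<le> (C + 1) * q" using C q0 by (intro mult_right_mono) auto
      finally show ?thesis .
    next
      case False
      then have "N1 \<le> M" using q(2) by linarith
      have "0 < real M" using False real_sqrt_ge_zero[of "real N"] by linarith
      then have "ln (sqrt (real N)) \<le> ln (real M)" using False q(3) by (subst ln_le_cancel_iff) auto
      then have "ln (real N) / 2 \<le> ln (real M)" using q(3) by (simp add: ln_sqrt)
      moreover have "0 \<le> ln (real N)" using q(3) by simp
      ultimately have "ln (real N) / 4 \<le> ln (real M)" by linarith
      then have "sqrt (ln (real N) / 4) \<le> sqrt (ln (real M))" by simp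
      then have "sqrt (ln (real N)) / 2 \<le> sqrt (ln (real M))" by (simp add: real_sqrt_divide)
      then have "k * (sqrt (ln (real N)) / 2) \<le> k * sqrt (ln (real M))" using k by (intro mult_left_mono) auto
      then have "decay k (real M) \<le> decay (k/2) (real N)" by simp
      then have "C * real M * decay k (real M) \<le> C * real N * decay (k/2) (real N)"
        using C M by (intro mult_mono) auto
      then have "\<bar>\<Sum>n=1..M. prime_excess n\<bar> \<le> C * q"
        using theta[OF \<open>N1 \<le> M\<close>] by (simp add: q_def mult.assoc)
      also have "\<dots> \<le> (C + 1) * q" using q0 by (intro mult_right_mono) auto
      finally show ?thesis .
    qed
    then show ?thesis by (simp add: q_def mult.assoc)
  qed
  then show thesis using that[of "C + 1" "k / 2" N0] C k by simp
qed

section \<open>Lattice points in a quarter annulus\<close>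

definition nsqrt :: "nat \<Rightarrow> nat" where "nsqrt A = nat \<lfloor>sqrt (real A)\<rfloor>"

lemma le_nsqrt_iff: "m \<le> nsqrt A \<longleftrightarrow> m\<^sup>2 \<le> A"
proof -
  have "m \<le> nsqrt A \<longleftrightarrow> real m \<le> sqrt (real A)"
    unfolding nsqrt_def by (simp add: le_nat_iff le_floor_iff)
  also have "\<dots> \<longleftrightarrow> (real m)\<^sup>2 \<le> real A"
    using real_sqrt_le_iff[of "(real m)\<^sup>2" "real A"] by simp
  also have "\<dots> \<longleftrightarrow> m\<^sup>2 \<le> A" by (metis of_nat_le_iff of_nat_power)
  finally show ?thesis .
qed

lemma nsqrt_bounds: "real (nsqrt A) \<le> sqrt (real A)" "sqrt (real A) - 1 \<le> real (nsqrt A)"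
  unfolding nsqrt_def by simp linarith

text \<open>For \<open>u\<close> between 0 and 1, the area under the unit circle from 0 to
  \<open>u\<close>: it is 0 at 0 and \<open>pi / 4\<close> at 1.\<close>

definition circle_area :: "real \<Rightarrow> real" where
  "circle_area u = (u * sqrt (1 - u\<^sup>2) + arcsin u) / 2"

lemma circle_area_derivative:
  assumes "-1 < u" "u < 1" shows "(circle_area has_real_derivative sqrt (1 - u\<^sup>2)) (at u)"
proof -
  have u: "u\<^sup>2 < 1" using assms by (simp add: abs_square_less_1 abs_less_iff)
  define w where "w = sqrt (1 - u\<^sup>2)"
  have w: "w > 0" "w * w = 1 - u\<^sup>2" using u by (auto simp: w_def)
  have "(circle_area has_real_derivative (w + u * ((- 2 * u) * (inverse w / 2)) + inverse w) / 2) (at u)"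
    unfolding circle_area_def w_def using assms u
    by (auto intro!: derivative_eq_intros)
  also have "(w + u * ((- 2 * u) * (inverse w / 2)) + inverse w) / 2 = w"
    using w by (simp add: field_simps power2_eq_square)
  finally show ?thesis by (simp add: w_def)
qed

text \<open>The mean value theorem asks for differentiability in the interior only, so
  \<open>b = 1\<close>, where \<open>arcsin\<close> has no derivative, is covered by
  continuity.\<close>

lemma circle_area_diff:
  assumes "0 \<le> a" "a \<le> b" "b \<le> 1"
  shows "(b - a) * sqrt (1 - b\<^sup>2) \<le> circle_area b - circle_area a"
    "circle_area b - circle_area a \<le> (b - a) * sqrt (1 - a\<^sup>2)"
proof -
  have "(b - a) * sqrt (1 - b\<^sup>2) \<le> circle_area b - circle_area a \<and> circle_area b - circle_area a \<le> (b - a) * sqrt (1 - a\<^sup>2)"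
  proof (cases "a = b")
    case False
    then have ab: "a < b" using assms by simp
    have "continuous_on {a..b} circle_area"
      unfolding circle_area_def using assms by (intro continuous_intros) auto
    moreover have "circle_area differentiable (at x)" if "a < x" "x < b" for x
      using circle_area_derivative[of x] that assms by (auto simp: real_differentiable_def)
    ultimately obtain l z where z: "a < z" "z < b" "DERIV circle_area z :> l" "circle_area b - circle_area a = (b - a) * l"
      using MVT[OF ab] by blast
    have "l = sqrt (1 - z\<^sup>2)"
      using z assms by (intro DERIV_unique[OF z(3) circle_area_derivative]) auto
    moreover have "z\<^sup>2 \<le> b\<^sup>2" "a\<^sup>2 \<le> z\<^sup>2" using z assms by (auto intro!: power_mono)
    ultimately show ?thesis unfolding z(4) using ab by (auto intro!: mult_left_mono)
  qed simp
  then show "(b - a) * sqrt (1 - b\<^sup>2) \<le> circle_area b - circle_area a"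
    "circle_area b - circle_area a \<le> (b - a) * sqrt (1 - a\<^sup>2)" by auto
qed

text \<open>The sum of the decreasing heights differs from the integral by at most the first height,
  which is the radius, and rounding costs at most 1 in each column. Beyond the circle truncated
  subtraction makes the heights 0, so \<open>P\<close> is free and two circles can be summed over
  the same range.\<close>

lemma quarter_circle_lattice_points:
  assumes M: "M \<ge> 1" and P: "nsqrt M \<le> P"
  shows "\<bar>(\<Sum>n=1..P. real (nsqrt (M - n\<^sup>2))) - pi / 4 * real M\<bar> \<le> 2 * sqrt (real M)"
proof -
  define r where "r = sqrt (real M)"
  have r: "r > 0" "r\<^sup>2 = real M" using M by (auto simp: r_def)
  define R where "R = nsqrt M"
  have Rr: "real R \<le> r" "r - real R \<le> 1" using nsqrt_bounds[of M] by (auto simp: R_def r_def)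
  define f where "f = (\<lambda>n. sqrt (real (M - n\<^sup>2)))"
  define h where "h = (\<lambda>t. real M * circle_area (t / r))"
  have f: "f n = r * sqrt (1 - (real n / r)\<^sup>2)" if "n \<le> R" for n
  proof -
    have "n\<^sup>2 \<le> M" using that by (simp add: R_def le_nsqrt_iff)
    moreover have "r\<^sup>2 * (1 - (real n / r)\<^sup>2) = r\<^sup>2 - (real n)\<^sup>2"
      using r(1) by (simp add: power_divide right_diff_distrib)
    ultimately have "real (M - n\<^sup>2) = r\<^sup>2 * (1 - (real n / r)\<^sup>2)"
      using r(2) by (simp add: of_nat_diff)
    then show ?thesis using r(1) by (simp add: f_def real_sqrt_mult)
  qed
  have h1: "(t - s) * (r * sqrt (1 - (t / r)\<^sup>2)) \<le> h t - h s" and h2: "h t - h s \<le> (t - s) * (r * sqrt (1 - (s / r)\<^sup>2))"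
    if "0 \<le> s" "s \<le> t" "t \<le> r" for s t
  proof -
    have st: "0 \<le> s / r" "s / r \<le> t / r" "t / r \<le> 1" using that r by (auto simp: divide_right_mono)
    have e: "r * r * ((t / r - s / r) * y) = (t - s) * (r * y)" for y using r by (simp add: field_simps)
    have hM: "h t - h s = r * r * (circle_area (t / r) - circle_area (s / r))"
      by (simp add: h_def r(2)[symmetric] power2_eq_square right_diff_distrib)
    show "(t - s) * (r * sqrt (1 - (t / r)\<^sup>2)) \<le> h t - h s"
      unfolding hM e[symmetric] using circle_area_diff(1)[OF st] r by (intro mult_left_mono) auto
    show "h t - h s \<le> (t - s) * (r * sqrt (1 - (s / r)\<^sup>2))"
      unfolding hM e[symmetric] using circle_area_diff(2)[OF st] r by (intro mult_left_mono) auto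
  qed
  have step: "f (Suc n) \<le> h (real (Suc n)) - h (real n)" "h (real (Suc n)) - h (real n) \<le> f n" if "n < R" for n
    using h1[of "real n" "real (Suc n)"] h2[of "real n" "real (Suc n)"] f[of n] f[of "Suc n"] that Rr by auto
  have h0: "h 0 = 0" and hr: "h r = pi / 4 * real M" using r by (auto simp: h_def circle_area_def)
  have tele: "(\<Sum>n<R. h (real (Suc n)) - h (real n)) = h (real R)"
    using sum_lessThan_telescope[of "\<lambda>n. h (real n)" R] h0 by simp
  have up: "(\<Sum>n<R. f (Suc n)) \<le> h (real R)" unfolding tele[symmetric] by (intro sum_mono step) auto
  have lo: "h (real R) \<le> (\<Sum>n<R. f n)" unfolding tele[symmetric] by (intro sum_mono step) auto
  have sh: "(\<Sum>n<R. f n) + f R = f 0 + (\<Sum>n<R. f (Suc n))"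
    by (metis sum.lessThan_Suc sum.lessThan_Suc_shift)
  have fR: "0 \<le> r * sqrt (1 - (real R / r)\<^sup>2)" by (subst f[of R, symmetric]) (simp_all add: f_def)
  have e1: "h (real R) \<le> h r"
    using h1[of "real R" r] Rr r by simp
  have e2: "h r - h (real R) \<le> f R"
  proof -
    have "h r - h (real R) \<le> (r - real R) * (r * sqrt (1 - (real R / r)\<^sup>2))" using h2[of "real R" r] Rr by simp
    also have "\<dots> \<le> 1 * (r * sqrt (1 - (real R / r)\<^sup>2))" using Rr(2) fR by (rule mult_right_mono)
    finally show ?thesis using f[of R] by simp
  qed
  have f0: "f 0 = r" by (simp add: f_def r_def)
  have sf: "(\<Sum>n=1..R. f n) = (\<Sum>n<R. f (Suc n))" by (simp add: sum.atLeast1_atMost_eq)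
  have "(\<Sum>n=1..P. real (nsqrt (M - n\<^sup>2))) = (\<Sum>n=1..R. real (nsqrt (M - n\<^sup>2)))"
  proof (rule sum.mono_neutral_right)
    show "\<forall>n\<in>{1..P} - {1..R}. real (nsqrt (M - n\<^sup>2)) = 0"
    proof
      fix n assume "n \<in> {1..P} - {1..R}"
      then have "\<not> n\<^sup>2 \<le> M" unfolding le_nsqrt_iff[symmetric] by (auto simp: R_def)
      then show "real (nsqrt (M - n\<^sup>2)) = 0" by (simp add: nsqrt_def)
    qed
  qed (use P in \<open>auto simp: R_def\<close>)
  moreover have "(\<Sum>n=1..R. real (nsqrt (M - n\<^sup>2))) \<le> (\<Sum>n=1..R. f n)"
    unfolding f_def by (intro sum_mono nsqrt_bounds)
  moreover have "(\<Sum>n=1..R. f n) - real R \<le> (\<Sum>n=1..R. real (nsqrt (M - n\<^sup>2)))"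
  proof -
    have "(\<Sum>n=1..R. f n) - real R = (\<Sum>n=1..R. f n - 1)" by (simp add: sum_subtractf)
    also have "\<dots> \<le> (\<Sum>n=1..R. real (nsqrt (M - n\<^sup>2)))"
      unfolding f_def by (intro sum_mono nsqrt_bounds)
    finally show ?thesis .
  qed
  ultimately show ?thesis
    unfolding hr[symmetric] r_def[symmetric] using up lo sh e1 e2 f0 sf Rr by linarith
qed

section \<open>Columns of the annulus and weighted sums over them\<close>

definition annulus :: "nat \<Rightarrow> nat \<Rightarrow> nat \<Rightarrow> nat set" where
  "annulus N H n = {m. 1 \<le> m \<and> N < n\<^sup>2 + m\<^sup>2 \<and> n\<^sup>2 + m\<^sup>2 \<le> N + H}"

text \<open>Truncated subtraction gives the right answer outside the circles: for
  \<open>n\<^sup>2 > N\<close> the lower end is \<open>nsqrt 0 = 0\<close>, which is the condition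
  \<open>1 \<le> m\<close>, and for \<open>n\<^sup>2 > N + H\<close> the interval is empty.\<close>

lemma annulus_eq: "annulus N H n = {nsqrt (N - n\<^sup>2) <.. nsqrt (N + H - n\<^sup>2)}"
proof -
  have "m \<in> annulus N H n \<longleftrightarrow> nsqrt (N - n\<^sup>2) < m \<and> m \<le> nsqrt (N + H - n\<^sup>2)" for m
  proof (cases "m = 0")
    case False
    then have "m\<^sup>2 > 0" "1 \<le> m" by auto
    moreover have "N < a + b \<and> a + b \<le> N + H \<longleftrightarrow> \<not> b \<le> N - a \<and> b \<le> N + H - a" if "b > 0" for a b :: nat
      using that by arith
    ultimately show ?thesis
      unfolding annulus_def not_le[symmetric] le_nsqrt_iff mem_Collect_eq by (simp add: not_le)
  qed (simp add: annulus_def)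
  then show ?thesis unfolding set_eq_iff greaterThanAtMost_iff by blast
qed

lemma finite_annulus: "finite (annulus N H n)" by (simp add: annulus_eq)

lemma nsqrt_mono: "A \<le> B \<Longrightarrow> nsqrt A \<le> nsqrt B"
  using le_nsqrt_iff[of "nsqrt A" A] le_nsqrt_iff[of "nsqrt A" B] by simp

lemma card_annulus: "real (card (annulus N H n)) = real (nsqrt (N + H - n\<^sup>2)) - real (nsqrt (N - n\<^sup>2))"
  using nsqrt_mono[of "N - n\<^sup>2" "N + H - n\<^sup>2"] by (simp add: annulus_eq of_nat_diff)

text \<open>The length of a column before rounding. The integer counts need not be monotone in
  \<open>n\<close>, so it is this version that enters Abel summation.\<close>

definition gap :: "nat \<Rightarrow> nat \<Rightarrow> nat \<Rightarrow> real" where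
  "gap N H n = sqrt (real (N + H - n\<^sup>2)) - sqrt (real (N - n\<^sup>2))"

lemma card_annulus_gap: "\<bar>real (card (annulus N H n)) - gap N H n\<bar> \<le> 1"
  unfolding card_annulus gap_def using nsqrt_bounds[of "N + H - n\<^sup>2"] nsqrt_bounds[of "N - n\<^sup>2"] by linarith

lemma gap_eq:
  assumes "n\<^sup>2 \<le> N" "H > 0"
  shows "gap N H n = real H / (sqrt (real (N - n\<^sup>2) + real H) + sqrt (real (N - n\<^sup>2)))"
proof -
  define A where "A = real (N - n\<^sup>2)"
  have A: "A \<ge> 0" "real (N + H - n\<^sup>2) = A + real H" using assms by (auto simp: A_def of_nat_diff)
  have p: "sqrt (A + real H) + sqrt A > 0" using A assms by (simp add: add_pos_nonneg)
  have "(sqrt (A + real H) - sqrt A) * (sqrt (A + real H) + sqrt A) = real H"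
    using A assms by (simp add: algebra_simps)
  then show ?thesis unfolding gap_def A(2) A_def[symmetric] using p by (simp add: field_simps)
qed

text \<open>In the rationalised form of \<open>gap_eq\<close> only the denominator depends on
  \<open>n\<close>, and it decreases as long as the column still meets the inner circle.\<close>

lemma gap_mono:
  assumes "m \<le> n" "n\<^sup>2 \<le> N" "H > 0" shows "gap N H m \<le> gap N H n"
proof -
  have m2: "m\<^sup>2 \<le> n\<^sup>2" using assms(1) by (rule power_mono) simp
  define A B where "A = real (N - n\<^sup>2)" and "B = real (N - m\<^sup>2)"
  have AB: "0 \<le> A" "A \<le> B" using m2 by (auto simp: A_def B_def diff_le_mono2 simp del: of_nat_diff)
  have "gap N H m = real H / (sqrt (B + real H) + sqrt B)"
    unfolding B_def using le_trans[OF m2 assms(2)] assms(3) by (intro gap_eq)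
  also have "\<dots> \<le> real H / (sqrt (A + real H) + sqrt A)"
    using AB assms(3) by (intro divide_left_mono add_mono real_sqrt_le_mono mult_pos_pos add_pos_nonneg) auto
  also have "\<dots> = gap N H n" unfolding A_def using assms by (intro gap_eq[symmetric])
  finally show ?thesis .
qed

lemma gap_nonneg: "gap N H n \<ge> 0"
  unfolding gap_def by (simp add: diff_le_mono)

lemma gap_le:
  assumes "n\<^sup>2 \<le> N" "H > 0" "0 < y" "y\<^sup>2 \<le> real N - (real n)\<^sup>2"
  shows "gap N H n \<le> real H / y"
proof -
  have "real N - (real n)\<^sup>2 = real (N - n\<^sup>2)" using assms(1) by (simp add: of_nat_diff)
  then have "y \<le> sqrt (real (N - n\<^sup>2))" using assms(4) by (intro real_le_rsqrt) simp
  moreover have "0 \<le> sqrt (real (N - n\<^sup>2) + real H)" by simp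
  ultimately have "y \<le> sqrt (real (N - n\<^sup>2) + real H) + sqrt (real (N - n\<^sup>2))" by linarith
  then show ?thesis unfolding gap_eq[OF assms(1,2)] using assms(2,3) by (intro divide_left_mono) auto
qed

text \<open>The weights increase from a nonnegative value, so their total variation is at most
  \<open>b Z\<close>; the boundary term costs another \<open>R * b Z\<close>, whence the factor 2.
  The induction carries the difference between the weighted sum and the partial sum times the last
  weight.\<close>

lemma Abel_monotone_bound:
  fixes b c :: "nat \<Rightarrow> real"
  assumes mono: "\<And>n. n < Z \<Longrightarrow> b n \<le> b (Suc n)" and b0: "b 0 \<ge> 0" and R: "\<And>M. M \<le> Z \<Longrightarrow> \<bar>\<Sum>n=1..M. c n\<bar> \<le> R"
  shows "\<bar>\<Sum>n=1..Z. c n * b n\<bar> \<le> 2 * R * b Z"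
proof -
  have R0: "R \<ge> 0" using R[of 0] by simp
  have "0 \<le> b M \<and> \<bar>(\<Sum>n=1..M. c n * b n) - (\<Sum>n=1..M. c n) * b M\<bar> \<le> R * b M" if "M \<le> Z" for M
    using that
  proof (induction M)
    case 0
    then show ?case using R0 b0 by simp
  next
    case (Suc M)
    then have IH: "0 \<le> b M" "\<bar>(\<Sum>n=1..M. c n * b n) - (\<Sum>n=1..M. c n) * b M\<bar> \<le> R * b M" by auto
    have bm: "b M \<le> b (Suc M)" using mono Suc.prems by simp
    have "(\<Sum>n=1..Suc M. c n * b n) - (\<Sum>n=1..Suc M. c n) * b (Suc M) =
        ((\<Sum>n=1..M. c n * b n) - (\<Sum>n=1..M. c n) * b M) - (\<Sum>n=1..M. c n) * (b (Suc M) - b M)"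
      by (simp add: algebra_simps)
    moreover have "\<bar>(\<Sum>n=1..M. c n) * (b (Suc M) - b M)\<bar> \<le> R * (b (Suc M) - b M)"
      unfolding abs_mult using bm R[of M] Suc.prems by (intro mult_mono) auto
    moreover have "R * (b (Suc M) - b M) = R * b (Suc M) - R * b M" by (simp add: algebra_simps)
    ultimately show ?case using IH bm by linarith
  qed
  from this[of Z] have Z: "0 \<le> b Z" "\<bar>(\<Sum>n=1..Z. c n * b n) - (\<Sum>n=1..Z. c n) * b Z\<bar> \<le> R * b Z" by auto
  have "\<bar>(\<Sum>n=1..Z. c n) * b Z\<bar> \<le> R * b Z" unfolding abs_mult using Z R[of Z] by (intro mult_mono) auto
  then show ?thesis using Z by linarith
qed

text \<open>The pairs \<open>(p, m)\<close> are regrouped by \<open>p\<close>; columns beyond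
  \<open>nsqrt (N + H)\<close> are empty, so any larger \<open>P\<close> may be used.\<close>

lemma sum_r22'_eq:
  assumes P: "nsqrt (N + H) \<le> P"
  shows "(\<Sum>n = N + 1..N + H. r22' n) = (\<Sum>n=1..P. (if prime n then ln (real n) else 0) * real (card (annulus N H n)))"
proof -
  have "(\<Sum>n = N + 1..N + H. r22' n) = (\<Sum>(p, m)\<in>(\<Union>n\<in>{N+1..N+H}. prime_square_reps n). ln (real p))"
    unfolding r22'_def
    by (rule sum.UNION_disjoint[symmetric]) (auto simp: finite_prime_square_reps, auto simp: prime_square_reps_def)
  also have "(\<Union>n\<in>{N+1..N+H}. prime_square_reps n) = Sigma {p\<in>{1..P}. prime p} (annulus N H)"
  proof (intro equalityI subsetI)
    fix x assume "x \<in> (\<Union>n\<in>{N+1..N+H}. prime_square_reps n)"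
    then obtain p m where x: "x = (p, m)" "prime p" "m \<ge> 1" "N < p\<^sup>2 + m\<^sup>2" "p\<^sup>2 + m\<^sup>2 \<le> N + H"
      by (auto simp: prime_square_reps_def)
    then have "p \<le> nsqrt (N + H)" by (simp add: le_nsqrt_iff)
    then show "x \<in> Sigma {p\<in>{1..P}. prime p} (annulus N H)"
      using x P prime_ge_1_nat[of p] by (auto simp: annulus_def)
  qed (auto simp: prime_square_reps_def annulus_def)
  also have "(\<Sum>(p, m)\<in>Sigma {p\<in>{1..P}. prime p} (annulus N H). ln (real p)) = (\<Sum>p\<in>{p\<in>{1..P}. prime p}. \<Sum>m\<in>annulus N H p. ln (real p))"
    by (rule sum.Sigma[symmetric]) (auto simp: finite_annulus)
  also have "\<dots> = (\<Sum>p\<in>{p\<in>{1..P}. prime p}. ln (real p) * real (card (annulus N H p)))"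
    by (simp add: mult.commute)
  also have "\<dots> = (\<Sum>n=1..P. if prime n then ln (real n) * real (card (annulus N H n)) else 0)"
    by (rule sum.inter_filter) simp
  finally show ?thesis by (simp add: if_distrib[of "\<lambda>x. x * _"] cong: if_cong)
qed

text \<open>
  Near \<open>n = sqrt N\<close> the sets \<open>annulus N H n\<close> are large. By symmetry, the same points are counted
  by their second coordinate \<open>m\<close>, which is small, and there the sets are short.
\<close>

lemma sum_annulus_swap:
  assumes "\<And>n m. n > Z \<Longrightarrow> m \<in> annulus N H n \<Longrightarrow> m \<le> V"
  shows "(\<Sum>n=Z+1..P. card (annulus N H n)) \<le> (\<Sum>m=1..V. card (annulus N H m))"
proof -
  have "(\<Sum>n=Z+1..P. card (annulus N H n)) = card (Sigma {Z+1..P} (annulus N H))"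
    by (simp add: card_SigmaI finite_annulus)
  also have "\<dots> \<le> card (Sigma {1..V} (annulus N H))"
  proof (rule card_inj_on_le[of prod.swap])
    show "prod.swap ` Sigma {Z+1..P} (annulus N H) \<subseteq> Sigma {1..V} (annulus N H)"
    proof
      fix x assume "x \<in> prod.swap ` Sigma {Z+1..P} (annulus N H)"
      then obtain n m where x: "x = (m, n)" "n > Z" "m \<in> annulus N H n" by auto
      then have "m \<le> V" by (intro assms)
      with x show "x \<in> Sigma {1..V} (annulus N H)" by (auto simp: annulus_def add.commute)
    qed
  qed (auto simp: finite_annulus)
  also have "\<dots> = (\<Sum>m=1..V. card (annulus N H m))" by (simp add: card_SigmaI finite_annulus)
  finally show ?thesis .
qed

section \<open>Primes in the annulus\<close>

text \<open>The three errors come from rounding (of columns and of the lattice point counts), from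
  Abel summation up to a cut at \<open>sqrt N * (1 - \<kappa>)\<close>, and from the trivial bound
  beyond it. The weight at the cut is about \<open>H / (sqrt N * sqrt \<kappa>)\<close>, while only
  about \<open>sqrt (H + \<kappa> * N)\<close> rows lie beyond, so \<kappa> trades one against the
  other.\<close>

lemma annulus_prime_sum_bound:
  fixes N H :: nat and \<kappa> R :: real
  assumes N: "N \<ge> 4" and H: "4 * H \<le> N" "sqrt (real N) \<le> real H" and \<kappa>: "0 < \<kappa>" "\<kappa> \<le> 1/8"
    and R: "\<And>M. M \<le> nsqrt N \<Longrightarrow> \<bar>\<Sum>n=1..M. prime_excess n\<bar> \<le> R"
  shows "\<bar>(\<Sum>n = N + 1..N + H. r22' n) - pi / 4 * real H\<bar> \<le> sqrt (real N) * (ln (real N) + 7)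
      + 2 * R * (real H / (sqrt (real N) * sqrt \<kappa>))
      + (ln (real N) + 1) * ((sqrt (real H) + sqrt (2 * \<kappa> * real N)) * (3 * (real H / sqrt (real N))))"
proof -
  define X where "X = sqrt (real N)"
  have X: "X \<ge> 2" "X * X = real N" using N real_le_rsqrt[of 2 "real N"] by (auto simp: X_def)
  have H0: "H > 0" using H(2) X(1) by (auto simp: X_def intro!: gr0I)
  have lnN: "ln (real N) \<ge> 0" using N by simp
  define P where "P = nsqrt (N + H)"
  define Z where "Z = nat \<lfloor>X * (1 - \<kappa>)\<rfloor>"
  define w where "w = (\<lambda>n. real (card (annulus N H n)))"
  have k1: "0 \<le> 1 - \<kappa>" using \<kappa> by simp
  have Z: "real Z \<le> X * (1 - \<kappa>)" "X * (1 - \<kappa>) < real Z + 1"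
    using X k1 by (auto simp: Z_def)
  have sq: "(X * (1 - \<kappa>))\<^sup>2 = real N * (1 - \<kappa>)\<^sup>2" using X(2) by (simp add: power_mult_distrib power2_eq_square)
  \<comment> \<open>From \<open>(1 - \<kappa>)\<^sup>2 \<le> 1 - \<kappa>\<close>; thus
    \<open>N - Z\<^sup>2 \<ge> \<kappa> * N\<close>, which bounds the gap at the cut.\<close>
  have Z2: "(real Z)\<^sup>2 \<le> real N * (1 - \<kappa>)"
  proof -
    have "(real Z)\<^sup>2 \<le> (X * (1 - \<kappa>))\<^sup>2" using Z(1) by (intro power_mono) auto
    also have "\<dots> \<le> real N * (1 - \<kappa>)"
      unfolding sq power2_eq_square[of "1 - \<kappa>"] using \<kappa> mult_left_le[of "1 - \<kappa>" "1 - \<kappa>"] by (intro mult_left_mono) auto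
    finally show ?thesis .
  qed
  have "real N * (1 - \<kappa>) \<le> real N" using \<kappa> by (simp add: mult_left_le)
  then have "(real Z)\<^sup>2 \<le> real N" using Z2 by linarith
  then have Z2N: "Z\<^sup>2 \<le> N" by simp
  then have ZN: "Z \<le> nsqrt N" by (simp add: le_nsqrt_iff)
  have ZP: "Z \<le> P" unfolding P_def by (rule order_trans[OF ZN nsqrt_mono]) simp
  \<comment> \<open>The columns reach slightly beyond \<open>sqrt N\<close>; this crude bound keeps
    every weight at most \<open>ln N + 1\<close>.\<close>
  have PN: "P \<le> N"
  proof -
    have "N + H \<le> N * N" using N H(1) mult_le_mono1[of 4 N N] by linarith
    then have "sqrt (real (N + H)) \<le> sqrt (real (N * N))" by (intro real_sqrt_le_mono) (simp only: of_nat_le_iff)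
    then show ?thesis using nsqrt_bounds(1)[of "N + H"] by (simp add: P_def)
  qed
  have c: "\<bar>prime_excess n\<bar> \<le> ln (real N) + 1" if "1 \<le> n" "n \<le> P" for n
    using abs_prime_excess_le[OF that] abs_prime_excess_le[of n N] that PN by simp
  have split: "(\<Sum>n=1..P. u n) = (\<Sum>n=1..Z. u n) + (\<Sum>n=Z+1..P. u n)" for u :: "nat \<Rightarrow> real"
    using sum.ub_add_nat[of 1 Z u "P - Z"] ZP by simp
  have "(\<Sum>n = N + 1..N + H. r22' n) = (\<Sum>n=1..P. (if prime n then ln (real n) else 0) * w n)"
    unfolding w_def by (rule sum_r22'_eq) (simp add: P_def)
  also have "\<dots> = (\<Sum>n=1..P. prime_excess n * w n) + (\<Sum>n=1..P. w n)"
    unfolding sum.distrib[symmetric] by (intro sum.cong) (auto simp: prime_excess_def algebra_simps)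
  also have "(\<Sum>n=1..P. prime_excess n * w n) = (\<Sum>n=1..Z. prime_excess n * gap N H n) + (\<Sum>n=1..Z. prime_excess n * (w n - gap N H n)) + (\<Sum>n=Z+1..P. prime_excess n * w n)"
    unfolding split by (simp add: right_diff_distrib sum_subtractf)
  finally have decomp: "(\<Sum>n = N + 1..N + H. r22' n) = (\<Sum>n=1..Z. prime_excess n * gap N H n) + (\<Sum>n=1..Z. prime_excess n * (w n - gap N H n)) + (\<Sum>n=Z+1..P. prime_excess n * w n) + (\<Sum>n=1..P. w n)" .
  have t1: "\<bar>\<Sum>n=1..Z. prime_excess n * gap N H n\<bar> \<le> 2 * R * (real H / (X * sqrt \<kappa>))"
  proof -
    have "\<bar>\<Sum>n=1..Z. prime_excess n * gap N H n\<bar> \<le> 2 * R * gap N H Z"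
    proof (rule Abel_monotone_bound)
      fix n assume "n < Z"
      then have "Suc n \<le> nsqrt N" using ZN by simp
      then show "gap N H n \<le> gap N H (Suc n)" using H0 by (intro gap_mono) (auto simp: le_nsqrt_iff)
    qed (use gap_nonneg R ZN in auto)
    also have "gap N H Z \<le> real H / (X * sqrt \<kappa>)"
    proof (rule gap_le[OF Z2N H0])
      have "(X * sqrt \<kappa>)\<^sup>2 = X * X * \<kappa>" unfolding power_mult_distrib power2_eq_square[of X] using \<kappa> by simp
      then have "(X * sqrt \<kappa>)\<^sup>2 = real N * \<kappa>" by (simp only: X(2))
      then show "(X * sqrt \<kappa>)\<^sup>2 \<le> real N - (real Z)\<^sup>2" using Z2 by (simp add: right_diff_distrib)
    qed (use X \<kappa> in auto)
    finally show ?thesis using R[of 0] by (simp add: mult_left_mono)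
  qed
  have t2: "\<bar>\<Sum>n=1..Z. prime_excess n * (w n - gap N H n)\<bar> \<le> X * (ln (real N) + 1)"
  proof -
    have "\<bar>\<Sum>n=1..Z. prime_excess n * (w n - gap N H n)\<bar> \<le> (\<Sum>n=1..Z. \<bar>prime_excess n * (w n - gap N H n)\<bar>)" by (rule sum_abs)
    also have "\<dots> \<le> (\<Sum>n=1..Z. (ln (real N) + 1) * 1)"
      unfolding abs_mult w_def using c ZP card_annulus_gap lnN by (intro sum_mono mult_mono) auto
    also have "\<dots> = real Z * (ln (real N) + 1)" by simp
    also have "\<dots> \<le> X * (ln (real N) + 1)"
    proof (rule mult_right_mono)
      have "X * (1 - \<kappa>) \<le> X * 1" using X \<kappa> by (intro mult_left_mono) auto
      then show "real Z \<le> X" using Z(1) by linarith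
    qed (use lnN in simp)
    finally show ?thesis .
  qed
  have t3: "\<bar>\<Sum>n=Z+1..P. prime_excess n * w n\<bar> \<le> (ln (real N) + 1) * ((sqrt (real H) + sqrt (2 * \<kappa> * real N)) * (3 * (real H / X)))"
  proof -
    \<comment> \<open>A point with \<open>n > Z\<close> has
      \<open>m\<^sup>2 \<le> N + H - (X * (1 - \<kappa>))\<^sup>2\<close>, which is at most
      \<open>H + 2 * \<kappa> * N\<close>.\<close>
    define V where "V = nat \<lfloor>sqrt (real H + 2 * \<kappa> * real N)\<rfloor>"
    have Veq: "real V \<le> sqrt (real H + 2 * \<kappa> * real N)" using \<kappa> by (simp add: V_def)
    have "\<bar>\<Sum>n=Z+1..P. prime_excess n * w n\<bar> \<le> (\<Sum>n=Z+1..P. \<bar>prime_excess n * w n\<bar>)" by (rule sum_abs)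
    also have "\<dots> \<le> (\<Sum>n=Z+1..P. (ln (real N) + 1) * w n)"
      unfolding abs_mult using c lnN by (intro sum_mono mult_mono) (auto simp: w_def)
    also have "\<dots> = (ln (real N) + 1) * (\<Sum>n=Z+1..P. w n)" by (rule sum_distrib_left[symmetric])
    also have "(\<Sum>n=Z+1..P. w n) \<le> (\<Sum>m=1..V. w m)"
    proof -
      have "(\<Sum>n=Z+1..P. card (annulus N H n)) \<le> (\<Sum>m=1..V. card (annulus N H m))"
      proof (rule sum_annulus_swap)
        fix n m assume n: "n > Z" and "m \<in> annulus N H n"
        then have "n\<^sup>2 + m\<^sup>2 \<le> N + H" by (simp add: annulus_def)
        then have "real (n\<^sup>2 + m\<^sup>2) \<le> real (N + H)" by (simp only: of_nat_le_iff)
        then have nm: "(real n)\<^sup>2 + (real m)\<^sup>2 \<le> real N + real H" by simp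
        have "X * (1 - \<kappa>) \<le> real n" using Z(2) n by linarith
        then have "(X * (1 - \<kappa>))\<^sup>2 \<le> (real n)\<^sup>2" using X k1 by (intro power_mono) auto
        moreover have "1 - 2 * \<kappa> \<le> (1 - \<kappa>)\<^sup>2" by (simp add: power2_eq_square algebra_simps)
        then have "real N * (1 - 2 * \<kappa>) \<le> real N * (1 - \<kappa>)\<^sup>2" by (intro mult_left_mono) auto
        ultimately have "(real m)\<^sup>2 \<le> real H + 2 * \<kappa> * real N" using nm unfolding sq by (simp add: algebra_simps)
        then have "real m \<le> sqrt (real H + 2 * \<kappa> * real N)" by (rule real_le_rsqrt)
        then show "m \<le> V" by (simp add: V_def le_nat_floor)
      qed
      then have "real (\<Sum>n=Z+1..P. card (annulus N H n)) \<le> real (\<Sum>m=1..V. card (annulus N H m))" by (simp only: of_nat_le_iff)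
      then show ?thesis by (simp add: w_def)
    qed
    also have "\<dots> \<le> (\<Sum>m=1..V. 3 * (real H / X))"
    proof (rule sum_mono)
      fix m assume "m \<in> {1..V}"
      then have "real m \<le> sqrt (real H + 2 * \<kappa> * real N)" using Veq by auto
      then have "(real m)\<^sup>2 \<le> (sqrt (real H + 2 * \<kappa> * real N))\<^sup>2" by (intro power_mono) auto
      also have "\<dots> = real H + 2 * \<kappa> * real N" using \<kappa> by simp
      \<comment> \<open>\<open>4 * H \<le> N\<close> and \<open>\<kappa> \<le> 1/8\<close> keep
        these rows at \<open>m\<^sup>2 \<le> N / 2\<close>, away from the end of the circle. The gap
        there is at most \<open>2 * (H / X)\<close> and the rounding error 1 at most
        \<open>H / X\<close>, hence the factor 3.\<close>
      also have "\<dots> \<le> real N / 4 + 2 * (1/8) * real N"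
        using H(1) \<kappa> by (intro add_mono mult_right_mono mult_left_mono) auto
      finally have m2: "(real m)\<^sup>2 \<le> real N / 2" by simp
      also have "real N / 2 \<le> real N" by simp
      finally have mN: "m\<^sup>2 \<le> N" by simp
      have "gap N H m \<le> real H / (X / 2)"
        using X m2 by (intro gap_le[OF mN H0]) (auto simp: power_divide power2_eq_square)
      moreover have "1 \<le> real H / X" using H(2) X unfolding X_def[symmetric] by (simp add: le_divide_eq)
      ultimately show "w m \<le> 3 * (real H / X)"
        using card_annulus_gap[of N H m] by (simp add: w_def)
    qed
    also have "\<dots> = real V * (3 * (real H / X))" by simp
    also have "\<dots> \<le> (sqrt (real H) + sqrt (2 * \<kappa> * real N)) * (3 * (real H / X))"
      using order_trans[OF Veq sqrt_add_le_add_sqrt[of "real H" "2 * \<kappa> * real N"]] \<kappa> X by (intro mult_right_mono) auto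
    finally show ?thesis using lnN by (simp add: mult_left_mono)
  qed
  \<comment> \<open>The difference of two quarter circles: error \<open>4 * X\<close> for the outer
    one, as \<open>sqrt (N + H) \<le> 2 * X\<close>, and \<open>2 * X\<close> for the inner
    one.\<close>
  have t4: "\<bar>(\<Sum>n=1..P. w n) - pi / 4 * real H\<bar> \<le> 6 * X"
  proof -
    have "(\<Sum>n=1..P. w n) = (\<Sum>n=1..P. real (nsqrt (N + H - n\<^sup>2))) - (\<Sum>n=1..P. real (nsqrt (N - n\<^sup>2)))"
      unfolding w_def card_annulus by (rule sum_subtractf)
    moreover have "\<bar>(\<Sum>n=1..P. real (nsqrt (N + H - n\<^sup>2))) - pi / 4 * real (N + H)\<bar> \<le> 2 * sqrt (real (N + H))"
      using N by (intro quarter_circle_lattice_points) (auto simp: P_def)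
    moreover have "\<bar>(\<Sum>n=1..P. real (nsqrt (N - n\<^sup>2))) - pi / 4 * real N\<bar> \<le> 2 * sqrt (real N)"
      using N by (intro quarter_circle_lattice_points) (auto simp: P_def nsqrt_mono)
    moreover have "sqrt (real (N + H)) \<le> sqrt (4 * real N)" using H(1) by (intro real_sqrt_le_mono) auto
    moreover have "sqrt (4 * real N) = 2 * X" by (simp add: X_def real_sqrt_mult)
    moreover have "pi / 4 * real (N + H) = pi / 4 * real N + pi / 4 * real H" by (simp add: algebra_simps)
    ultimately show ?thesis unfolding X_def[symmetric] by linarith
  qed
  have "X * (ln (real N) + 7) = X * (ln (real N) + 1) + 6 * X" by (simp add: algebra_simps)
  then show ?thesis unfolding decomp X_def[symmetric] using t1 t2 t3 t4 by linarith
qed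

text \<open>With \<open>\<kappa> = (s N)\<^sup>2\<close>, a bound of order
  \<open>sqrt N * (s N)\<^sup>2\<close> for the prime sums makes the Abel term of order
  \<open>H * s N\<close> and the trivial term of order \<open>H * s N * ln N\<close>. The lower
  bound on \<open>H\<close> gives \<open>sqrt N \<le> H * N powr (-1/12)\<close> and so controls
  rounding; the upper bound makes \<open>sqrt H\<close> at most
  \<open>sqrt N * N powr (- \<epsilon> / 2)\<close>. Four errors of at most a quarter of the target
  each allow \<open>K = 1\<close>.\<close>

theorem theorem4:
  fixes \<epsilon> :: real
  assumes "\<epsilon> > 0"
  shows "\<exists>(C::real) (K::real) (N\<^sub>0::nat). C > 0 \<and> K > 0 \<and>
    (\<forall>(N::nat) (H::nat).
       N \<ge> N\<^sub>0 \<longrightarrow>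
       real N powr (7 / 12 + \<epsilon>) \<le> real H \<longrightarrow>
       real H \<le> real N powr (1 - \<epsilon>) \<longrightarrow>
       \<bar>(\<Sum>n = N + 1..N + H. r22' n) - pi / 4 * real H\<bar>
         \<le> K * real H * exp (- C * (ln (real N) / ln (ln (real N))) powr (1 / 3)))"
proof -
  obtain C k and N\<theta> :: nat where C: "C > 0" and k: "k > 0" and theta:
    "\<And>N M. N \<ge> N\<theta> \<Longrightarrow> M \<le> N \<Longrightarrow> \<bar>\<Sum>n=1..M. prime_excess n\<bar> \<le> C * real N * exp (- k * sqrt (ln (real N)))"
    by (rule Chebyshev_theta_bound_uniform) (rule that)
  let ?bound = "\<lambda>N H. \<bar>(\<Sum>n = N + 1..N + H. r22' n) - pi / 4 * real H\<bar>
         \<le> 1 * real H * exp (- (k / 8) * (ln (real N) / ln (ln (real N))) powr (1 / 3))"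
  \<comment> \<open>Its square is the saving available for primes up to \<open>sqrt N\<close>. The
    target exponent \<open>k / 8\<close> leaves half of \<open>k / 4\<close> to absorb logarithms
    and constants.\<close>
  define s where "s = (\<lambda>N. exp (- (k / 4) * sqrt (ln (real N))))"
  have "eventually (\<lambda>N::nat. (s N)\<^sup>2 \<le> 1/8) at_top" unfolding s_def using k by real_asymp
  moreover have "eventually (\<lambda>N::nat. 4 * real N powr (1 - \<epsilon>) \<le> real N) at_top" using assms by real_asymp
  moreover have "eventually (\<lambda>N::nat. real N\<theta> \<le> sqrt (real N)) at_top" by real_asymp
  moreover have "eventually (\<lambda>N::nat. (ln (real N) / ln (ln (real N))) powr (1 / 3) \<le> sqrt (ln (real N))) at_top" by real_asymp
  moreover have "eventually (\<lambda>N::nat. real N powr (-1/12) * (ln (real N) + 7) \<le> 1/4 * exp (- (k / 8) * sqrt (ln (real N)))) at_top"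
    using k by real_asymp
  moreover have "eventually (\<lambda>N::nat. 4 * C * s N \<le> 1/4 * exp (- (k / 8) * sqrt (ln (real N)))) at_top"
    unfolding s_def using k C by real_asymp
  moreover have "eventually (\<lambda>N::nat. 3 * (ln (real N) + 1) * real N powr (- \<epsilon> / 2) \<le> 1/4 * exp (- (k / 8) * sqrt (ln (real N)))) at_top"
    using k assms by real_asymp
  moreover have "eventually (\<lambda>N::nat. 6 * (ln (real N) + 1) * s N \<le> 1/4 * exp (- (k / 8) * sqrt (ln (real N)))) at_top"
    unfolding s_def using k by real_asymp
  moreover have "eventually (\<lambda>N::nat. N \<ge> 4) at_top" by (rule eventually_ge_at_top)
  ultimately have "eventually (\<lambda>N::nat. \<forall>H::nat. real N powr (7 / 12 + \<epsilon>) \<le> real H \<longrightarrow> real H \<le> real N powr (1 - \<epsilon>) \<longrightarrow>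
      ?bound N H) at_top"
  proof eventually_elim
    case (elim N)
    note N = \<open>N \<ge> 4\<close>
    show ?case
    proof (intro allI impI)
      fix H :: nat
      assume H1: "real N powr (7 / 12 + \<epsilon>) \<le> real H" and H2: "real H \<le> real N powr (1 - \<epsilon>)"
      define X where "X = sqrt (real N)"
      have X: "X \<ge> 2" using N real_le_rsqrt[of 2 "real N"] by (simp add: X_def)
      have Xp: "X = real N powr (1/2)" by (simp add: X_def powr_half_sqrt)
      have s0: "s N > 0" by (simp add: s_def)
      have "real N powr (7/12) \<le> real N powr (7/12 + \<epsilon>)" using N assms by (intro powr_mono) auto
      then have "real N powr (7/12) * real N powr (-1/12) \<le> real H * real N powr (-1/12)"
        using H1 by (intro mult_right_mono) auto
      then have XH: "X \<le> real H * real N powr (-1/12)" by (simp add: Xp flip: powr_add)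
      also have "\<dots> \<le> real H * 1" using N powr_mono[of "-1/12" 0 "real N"] by (intro mult_left_mono) auto
      finally have "X \<le> real H" by simp
      \<comment> \<open>The bound for primes is stated at integers, so \<open>sqrt N\<close> is
        rounded up; \<open>Y \<le> 2 * X\<close> and \<open>ln Y \<ge> ln N / 4\<close> are all that
        is used.\<close>
      define Y where "Y = nat \<lceil>X\<rceil>"
      have Y: "X \<le> real Y" "real Y \<le> 2 * X" using X by (auto simp: Y_def) linarith
      define R where "R = C * real Y * exp (- k * sqrt (ln (real Y)))"
      have Rb: "\<bar>\<Sum>n=1..M. prime_excess n\<bar> \<le> R" if "M \<le> nsqrt N" for M
      proof -
        have "real M \<le> X" using that nsqrt_bounds(1)[of N] by (simp add: X_def)
        then have "M \<le> Y" using Y(1) by linarith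
        moreover have "N\<theta> \<le> Y" using elim Y(1) by (simp add: X_def)
        ultimately show ?thesis unfolding R_def by (intro theta)
      qed
      have Rle: "R \<le> C * (2 * X) * (s N * s N)"
      proof -
        have "ln X \<le> ln (real Y)" using X Y(1) by (subst ln_le_cancel_iff) auto
        moreover have "ln X = ln (real N) / 2" using N by (simp add: X_def ln_sqrt)
        moreover have "0 \<le> ln (real N)" using N by simp
        ultimately have "ln (real N) / 4 \<le> ln (real Y)" by linarith
        then have "sqrt (ln (real N) / 4) \<le> sqrt (ln (real Y))" by simp
        then have "sqrt (ln (real N)) / 2 \<le> sqrt (ln (real Y))" by (simp add: real_sqrt_divide)
        then have "k * (sqrt (ln (real N)) / 2) \<le> k * sqrt (ln (real Y))" using k by (intro mult_left_mono) auto
        then have "exp (- k * sqrt (ln (real Y))) \<le> s N * s N" by (simp add: s_def flip: exp_add)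
        then show ?thesis unfolding R_def using Y C by (intro mult_mono) auto
      qed
      have "real (4 * H) \<le> real N" using H2 elim by simp
      then have H4: "4 * H \<le> N" by (simp only: of_nat_le_iff)
      have ssq: "sqrt ((s N)\<^sup>2) = s N" using s0 by simp
      define b where "b = exp (- (k / 8) * sqrt (ln (real N)))"
      have "\<bar>(\<Sum>n = N + 1..N + H. r22' n) - pi / 4 * real H\<bar> \<le> X * (ln (real N) + 7)
        + 2 * R * (real H / (X * sqrt ((s N)\<^sup>2)))
        + (ln (real N) + 1) * ((sqrt (real H) + sqrt (2 * (s N)\<^sup>2 * real N)) * (3 * (real H / X)))"
        unfolding X_def
      proof (rule annulus_prime_sum_bound[OF N H4])
        show "sqrt (real N) \<le> real H" using \<open>X \<le> real H\<close> by (simp add: X_def)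
        show "0 < (s N)\<^sup>2" "(s N)\<^sup>2 \<le> 1/8" using s0 elim by auto
      qed (rule Rb)
      also have "X * (ln (real N) + 7) \<le> real H * (1/4 * b)"
      proof -
        have "X * (ln (real N) + 7) \<le> (real H * real N powr (-1/12)) * (ln (real N) + 7)"
          using XH N by (intro mult_right_mono) auto
        also have "\<dots> = real H * (real N powr (-1/12) * (ln (real N) + 7))" by simp
        also have "\<dots> \<le> real H * (1/4 * b)" using elim by (intro mult_left_mono) (auto simp: b_def)
        finally show ?thesis .
      qed
      also have "2 * R * (real H / (X * sqrt ((s N)\<^sup>2))) \<le> real H * (1/4 * b)"
      proof -
        have "2 * R * (real H / (X * sqrt ((s N)\<^sup>2))) \<le> 2 * (C * (2 * X) * (s N * s N)) * (real H / (X * s N))"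
          unfolding ssq using Rle X s0 by (intro mult_right_mono mult_left_mono) auto
        also have "\<dots> = real H * (4 * C * s N)" using X s0 by (simp add: field_simps)
        also have "\<dots> \<le> real H * (1/4 * b)" using elim by (intro mult_left_mono) (auto simp: b_def)
        finally show ?thesis .
      qed
      also have "(ln (real N) + 1) * ((sqrt (real H) + sqrt (2 * (s N)\<^sup>2 * real N)) * (3 * (real H / X))) \<le> real H * (1/4 * b) + real H * (1/4 * b)"
      proof -
        have "sqrt (real H) \<le> sqrt (real N powr (1 - \<epsilon>))" using H2 by simp
        also have "\<dots> = real N powr ((1 - \<epsilon>) / 2)" by (simp add: powr_half_sqrt[symmetric] powr_powr)
        also have "\<dots> = X * real N powr (- \<epsilon> / 2)" by (simp add: Xp diff_divide_distrib flip: powr_add)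
        finally have 1: "sqrt (real H) \<le> X * real N powr (- \<epsilon> / 2)" .
        have "sqrt (2 * (s N)\<^sup>2 * real N) = sqrt 2 * s N * X" using s0 by (simp add: real_sqrt_mult X_def)
        also have "\<dots> \<le> 2 * s N * X" using s0 X by (intro mult_right_mono) (auto intro: real_le_lsqrt)
        finally have 2: "sqrt (2 * (s N)\<^sup>2 * real N) \<le> 2 * s N * X" .
        have "(ln (real N) + 1) * ((sqrt (real H) + sqrt (2 * (s N)\<^sup>2 * real N)) * (3 * (real H / X))) \<le>
            (ln (real N) + 1) * ((X * real N powr (- \<epsilon> / 2) + 2 * s N * X) * (3 * (real H / X)))"
          using 1 2 X N by (intro mult_left_mono mult_right_mono add_mono) auto
        also have "\<dots> = real H * (3 * (ln (real N) + 1) * real N powr (- \<epsilon> / 2)) + real H * (6 * (ln (real N) + 1) * s N)"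
          using X by (simp add: field_simps)
        also have "\<dots> \<le> real H * (1/4 * b) + real H * (1/4 * b)"
          using elim by (intro add_mono mult_left_mono) (auto simp: b_def)
        finally show ?thesis .
      qed
      also have "real H * (1/4 * b) + real H * (1/4 * b) + (real H * (1/4 * b) + real H * (1/4 * b)) = real H * b" by simp
      also have "real H * b \<le> real H * exp (- (k / 8) * (ln (real N) / ln (ln (real N))) powr (1 / 3))"
        unfolding b_def using elim k by (intro mult_left_mono) auto
      finally show "?bound N H" by simp
    qed
  qed
  then obtain N0 where "\<And>N::nat. N \<ge> N0 \<Longrightarrow> \<forall>H::nat. real N powr (7 / 12 + \<epsilon>) \<le> real H \<longrightarrow> real H \<le> real N powr (1 - \<epsilon>) \<longrightarrow>
      ?bound N H"
    unfolding eventually_at_top_linorder by blast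
  then show ?thesis
    using k by (intro exI[of _ "k / 8"] exI[of _ 1] exI[of _ N0]) auto
qed

end
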